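(* Let $\mathcal{M}''_m$ be a meridian surface of hyperbolic type in the Minkowski space $\mathbb{R}^4_1$, parameterized by $z(u,v)=f(u)\,l(v)+g(u)\,e_1$, $u\in I$, $v\in J$, constructed from the meridian curve $m:u\mapsto(f(u),g(u))$ and the curve $c:l=l(v)$ with spherical curvature $\kappa$. Then $\mathcal{M}''_m$ has pointwise 1-type Gauss map of second kind if and only if one of the following cases holds: (i) the curve $c$ has non-zero constant spherical curvature $\kappa\neq\pm1$ and the meridian curve $m$ is determined by $f(u)=\pm u+a$, $g(u)=b$, where $a=\mathrm{const}$, $b=\mathrm{const}$. In this case $\mathcal{M}''_m$ is a developable ruled surface lying in a constant hyperplane $\mathbb{E}^3_1$ of $\mathbb{R}^4_1$. (ii) the curve $c$ has constant spherical curvature $\kappa$ and the meridian curve $m$ is determined by $f(u)=au+a_1$, $g(u)=bu+b_1$, where $a,a_1,b,b_1$ are constants, $a^2+b^2=1$. In this case $\mathcal{M}''_m$ is either a marginally trapped developable ruled surface (if $\kappa^2=b^2$) or a developable ruled surface lying in a constant hyperplane $\mathbb{E}^3_1$ (if $\kappa^2-b^2>0$) or $\mathbb{E}^3$ (if $\kappa^2-b^2<0$) of $\mathbb{R}^4_1$. (iii) the curve $c$ has zero spherical curvature and the meridian curve $m$ is determined by the solutions $f(u)$ of the differential equation $$\left(\ln\frac{\sqrt{1-f'^2}\left(f(1-f'^2)(ff'')'+f^2f'f''^2+f'(1-f'^2)^2\right)}{(1-f'^2)^2+f^2f''^2+ff'(1-f'^2)(ff'')'}\right)'=-\frac{f'f''}{1-f'^2},$$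 with $g(u)$ defined by $g'(u)=\sqrt{1-f'^2(u)}$.
   Context: $\mathbb{R}^4_1$ (also written $\mathbb{E}^4_1$) is the four-dimensional Minkowski space with flat metric $\langle\cdot,\cdot\rangle$ of signature $(3,1)$ and fixed orthonormal frame $e_1,e_2,e_3,e_4$, $\langle e_i,e_i\rangle=1$ for $i=1,2,3$, $\langle e_4,e_4\rangle=-1$. Meridian surface of hyperbolic type: let $f,g:I\to\mathbb{R}$ be smooth functions on an interval $I\subset\mathbb{R}$ with $f(u)>0$ and $(f'(u))^2+(g'(u))^2=1$ for all $u\in I$ (the plane curve $m:u\mapsto(f(u),g(u))$ is called the meridian curve). Let $c:l=l(v)$, $v\in J$ ($J\subset\mathbb{R}$ an interval), be a smooth curve with $\langle l',l'\rangle=1$ on the de Sitter space $S^2_1(1)=\{V\in\mathbb{R}^3_1:\langle V,V\rangle=1\}$, where $\mathbb{R}^3_1=\operatorname{span}\{e_2,e_3,e_4\}$. The surface $\mathcal{M}''_m:z(u,v)=f(u)\,l(v)+g(u)\,e_1$, $u\in I,\ v\in J$, is called a meridian surface of hyperbolic type; it is spacelike with first fundamental form $du^2+f^2(u)\,dv^2$. Spherical curvature of $c$: put $t=l'$ and let $n(v)$ be the (unique up to sign) vector field such that $\{l,t,n\}$ is an orthonormal frame field of $\mathbb{R}^3_1$, with $\langle n,n\rangle=-1$; then $\kappa(v)=\langle t'(v),n(v)\rangle$, and $l'=t$, $t'=-\kappa n-l$, $n'=-\kappa t$. Gauss map: with $x=z_u$ and $y=z_v/f$ (an orthonormal tangent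 frame), the Gauss map is $G=x\wedge y$, regarded as a map from the surface into the vector space $\wedge^2\mathbb{R}^4_1$, equipped with the indefinite inner product $\langle a_1\wedge a_2,b_1\wedge b_2\rangle=\det(\langle a_k,b_l\rangle)$. Laplacian: $\Delta G=-\nabla'_x\nabla'_xG+\nabla'_{\nabla_xx}G-\nabla'_y\nabla'_yG+\nabla'_{\nabla_yy}G$, where $\nabla'$ is the flat connection of the ambient space (componentwise differentiation) and $\nabla$ is the Levi-Civita connection of the surface. The surface has pointwise 1-type Gauss map of second kind if $\Delta G=\lambda(G+C)$ for some non-zero smooth function $\lambda$ on the surface and some constant vector $C\neq0$ in $\wedge^2\mathbb{R}^4_1$. A spacelike surface is marginally trapped if its mean curvature vector field $H=\frac12\operatorname{tr}\sigma$ ($\sigma$ the second fundamental form) satisfies $H\neq0$ and $\langle H,H\rangle=0$ at each point. A ruled surface is developable if its tangent plane (equivalently its normal space) is constant along each generator. A hyperplane $\mathbb{E}^3$ (resp. $\mathbb{E}^3_1$) of $\mathbb{R}^4_1$ is an affine hyperplane on which the induced metric is positive definite (resp. Lorentzian, of signature $(2,1)$).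
   Formalization: In the equivalence (ii) also needs a≠0, κ≠±1 (false otherwise, e.g. f=1, g=u, κ=0); marginal trapping needs b≠0 (else a plane); (iii) uses ln|·|, |g'|=√(1-f'²), f'² not identically 1, equation only where f'²≠1, with numerator and denominator nonzero there. *)

theory Defs
  imports "HOL-Analysis.Analysis"
begin

section \<open>Smooth maps\<close>

text \<open>Only used for open \<open>S\<close>, where (in finite dimension) \<open>smooth_on S f\<close> says that
  \<open>f\<close> is of class \<open>C\<^sup>\<infinity>\<close> on \<open>S\<close>.\<close>

primrec diff_order_on :: "nat \<Rightarrow> 'a::real_normed_vector set \<Rightarrow> ('a \<Rightarrow> 'b::real_normed_vector) \<Rightarrow> bool"
  where
    "diff_order_on 0 S f \<longleftrightarrow> continuous_on S f"
  | "diff_order_on (Suc k) S f \<longleftrightarrow>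
       (\<forall>x\<in>S. f differentiable (at x)) \<and>
       (\<forall>h. diff_order_on k S (\<lambda>x. frechet_derivative f (at x) h))"

definition smooth_on :: "'a::real_normed_vector set \<Rightarrow> ('a \<Rightarrow> 'b::real_normed_vector) \<Rightarrow> bool"
  where "smooth_on S f \<longleftrightarrow> (\<forall>k. diff_order_on k S f)"


section \<open>Minkowski space and its bivectors\<close>

definition mink :: "real^4 \<Rightarrow> real^4 \<Rightarrow> real"
  where "mink x y = x$1 * y$1 + x$2 * y$2 + x$3 * y$3 - x$4 * y$4"

abbreviation e :: "4 \<Rightarrow> real^4"
  where "e i \<equiv> axis i 1"

definition R31 :: "(real^4) set"
  where "R31 = span {e 2, e 3, e 4}"

definition de_Sitter :: "(real^4) set"
  where "de_Sitter = {V \<in> R31. mink V V = 1}"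

text \<open>The second exterior power is realised as the space of alternating matrices,
  \<open>e i \<and> e j\<close> (\<open>i < j\<close>) being a basis of it.\<close>

definition wedge :: "real^4 \<Rightarrow> real^4 \<Rightarrow> real^4^4"
  where "wedge a b = (\<chi> i j. a$i * b$j - a$j * b$i)"

definition bivectors :: "(real^4^4) set"
  where "bivectors = span {wedge a b | a b. True}"


section \<open>Meridian surfaces of hyperbolic type\<close>

definition meridian_surface ::
    "(real \<Rightarrow> real) \<Rightarrow> (real \<Rightarrow> real) \<Rightarrow> (real \<Rightarrow> real^4) \<Rightarrow> real \<Rightarrow> real \<Rightarrow> real^4"
  where "meridian_surface f g l u v = f u *\<^sub>R l v + g u *\<^sub>R e 1"

definition velocity :: "(real \<Rightarrow> real^4) \<Rightarrow> real \<Rightarrow> real^4"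
  where "velocity l v = vector_derivative l (at v)"

definition spherical_frame :: "real set \<Rightarrow> (real \<Rightarrow> real^4) \<Rightarrow> (real \<Rightarrow> real^4) \<Rightarrow> bool"
  where "spherical_frame J l n \<longleftrightarrow>
    smooth_on J l \<and> smooth_on J n \<and>
    (\<forall>v\<in>J. l v \<in> de_Sitter \<and> mink (velocity l v) (velocity l v) = 1 \<and>
       n v \<in> R31 \<and> mink (n v) (n v) = -1 \<and>
       mink (n v) (l v) = 0 \<and> mink (n v) (velocity l v) = 0)"

definition spherical_curvature :: "(real \<Rightarrow> real^4) \<Rightarrow> (real \<Rightarrow> real^4) \<Rightarrow> real \<Rightarrow> real"
  where "spherical_curvature l n v = mink (vector_derivative (velocity l) (at v)) (n v)"


section \<open>Surfaces with first fundamental form \<open>du\<^sup>2 + f\<^sup>2 dv\<^sup>2\<close>\<close>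

definition d_u :: "(real \<Rightarrow> real \<Rightarrow> 'a::real_normed_vector) \<Rightarrow> real \<Rightarrow> real \<Rightarrow> 'a"
  where "d_u F u v = vector_derivative (\<lambda>s. F s v) (at u)"

definition d_v :: "(real \<Rightarrow> real \<Rightarrow> 'a::real_normed_vector) \<Rightarrow> real \<Rightarrow> real \<Rightarrow> 'a"
  where "d_v F u v = vector_derivative (\<lambda>s. F u s) (at v)"

text \<open>\<open>flat_x F\<close> and \<open>flat_y f F\<close> are the flat covariant derivatives of a vector- or
  bivector-valued \<open>F\<close> along \<open>x = z\<^sub>u\<close> and \<open>y = z\<^sub>v / f\<close>; applied to the immersion \<open>z\<close>
  they give \<open>x\<close> and \<open>y\<close> themselves.\<close>

definition flat_x :: "(real \<Rightarrow> real \<Rightarrow> 'a::real_normed_vector) \<Rightarrow> real \<Rightarrow> real \<Rightarrow> 'a"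
  where "flat_x F u v = d_u F u v"

definition flat_y ::
    "(real \<Rightarrow> real) \<Rightarrow> (real \<Rightarrow> real \<Rightarrow> 'a::real_normed_vector) \<Rightarrow> real \<Rightarrow> real \<Rightarrow> 'a"
  where "flat_y f F u v = (1 / f u) *\<^sub>R d_v F u v"

definition frame_x :: "(real \<Rightarrow> real \<Rightarrow> real^4) \<Rightarrow> real \<Rightarrow> real \<Rightarrow> real^4"
  where "frame_x z = flat_x z"

definition frame_y :: "(real \<Rightarrow> real) \<Rightarrow> (real \<Rightarrow> real \<Rightarrow> real^4) \<Rightarrow> real \<Rightarrow> real \<Rightarrow> real^4"
  where "frame_y f z = flat_y f z"

definition tangential ::
    "(real \<Rightarrow> real) \<Rightarrow> (real \<Rightarrow> real \<Rightarrow> real^4) \<Rightarrow> (real \<Rightarrow> real \<Rightarrow> real^4) \<Rightarrow> real \<Rightarrow> real \<Rightarrow> real^4"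
  where "tangential f z W u v =
    mink (W u v) (frame_x z u v) *\<^sub>R frame_x z u v +
    mink (W u v) (frame_y f z u v) *\<^sub>R frame_y f z u v"

definition normal_part ::
    "(real \<Rightarrow> real) \<Rightarrow> (real \<Rightarrow> real \<Rightarrow> real^4) \<Rightarrow> (real \<Rightarrow> real \<Rightarrow> real^4) \<Rightarrow> real \<Rightarrow> real \<Rightarrow> real^4"
  where "normal_part f z W u v = W u v - tangential f z W u v"

text \<open>The flat derivative of \<open>F\<close> along a tangent vector field
  \<open>W = \<langle>W,x\<rangle> x + \<langle>W,y\<rangle> y\<close>.\<close>

definition flat_along ::
    "(real \<Rightarrow> real) \<Rightarrow> (real \<Rightarrow> real \<Rightarrow> real^4) \<Rightarrow> (real \<Rightarrow> real \<Rightarrow> real^4) \<Rightarrow>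
     (real \<Rightarrow> real \<Rightarrow> 'a::real_normed_vector) \<Rightarrow> real \<Rightarrow> real \<Rightarrow> 'a"
  where "flat_along f z W F u v =
    mink (W u v) (frame_x z u v) *\<^sub>R flat_x F u v +
    mink (W u v) (frame_y f z u v) *\<^sub>R flat_y f F u v"

text \<open>By the Gauss formula, the Levi-Civita derivative of a tangent field is the tangential
  part of its flat derivative, and the second fundamental form is the normal part.\<close>

definition laplacian ::
    "(real \<Rightarrow> real) \<Rightarrow> (real \<Rightarrow> real \<Rightarrow> real^4) \<Rightarrow>
     (real \<Rightarrow> real \<Rightarrow> 'a::real_normed_vector) \<Rightarrow> real \<Rightarrow> real \<Rightarrow> 'a"
  where "laplacian f z F u v =
    - flat_x (flat_x F) u v
    + flat_along f z (tangential f z (flat_x (frame_x z))) F u v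
    - flat_y f (flat_y f F) u v
    + flat_along f z (tangential f z (flat_y f (frame_y f z))) F u v"

definition mean_curvature ::
    "(real \<Rightarrow> real) \<Rightarrow> (real \<Rightarrow> real \<Rightarrow> real^4) \<Rightarrow> real \<Rightarrow> real \<Rightarrow> real^4"
  where "mean_curvature f z u v = (1/2) *\<^sub>R
    (normal_part f z (flat_x (frame_x z)) u v + normal_part f z (flat_y f (frame_y f z)) u v)"

definition marginally_trapped ::
    "real set \<Rightarrow> real set \<Rightarrow> (real \<Rightarrow> real) \<Rightarrow> (real \<Rightarrow> real \<Rightarrow> real^4) \<Rightarrow> bool"
  where "marginally_trapped I J f z \<longleftrightarrow>
    (\<forall>u\<in>I. \<forall>v\<in>J. mean_curvature f z u v \<noteq> 0 \<and>
       mink (mean_curvature f z u v) (mean_curvature f z u v) = 0)"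

definition gauss_map ::
    "(real \<Rightarrow> real) \<Rightarrow> (real \<Rightarrow> real \<Rightarrow> real^4) \<Rightarrow> real \<Rightarrow> real \<Rightarrow> real^4^4"
  where "gauss_map f z u v = wedge (frame_x z u v) (frame_y f z u v)"

definition pointwise_1_type_second_kind ::
    "real set \<Rightarrow> real set \<Rightarrow> (real \<Rightarrow> real) \<Rightarrow> (real \<Rightarrow> real \<Rightarrow> real^4) \<Rightarrow> bool"
  where "pointwise_1_type_second_kind I J f z \<longleftrightarrow>
    (\<exists>lam :: real \<Rightarrow> real \<Rightarrow> real. \<exists>C\<in>bivectors. C \<noteq> 0 \<and>
       smooth_on (I \<times> J) (\<lambda>(u, v). lam u v) \<and>
       (\<forall>u\<in>I. \<forall>v\<in>J. lam u v \<noteq> 0 \<and>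
          laplacian f z (gauss_map f z) u v = lam u v *\<^sub>R (gauss_map f z u v + C)))"


section \<open>Developable ruled surfaces and hyperplanes\<close>

definition diffeo_between ::
    "(real \<times> real) set \<Rightarrow> (real \<times> real) set \<Rightarrow> (real \<times> real \<Rightarrow> real \<times> real) \<Rightarrow> bool"
  where "diffeo_between Q D \<phi> \<longleftrightarrow>
    (\<exists>\<psi>. smooth_on Q \<phi> \<and> smooth_on D \<psi> \<and>
       (\<forall>q\<in>Q. \<phi> q \<in> D \<and> \<psi> (\<phi> q) = q) \<and> (\<forall>p\<in>D. \<psi> p \<in> Q \<and> \<phi> (\<psi> p) = p))"

definition tangent_plane :: "(real \<Rightarrow> real \<Rightarrow> real^4) \<Rightarrow> real \<times> real \<Rightarrow> (real^4) set"
  where "tangent_plane z p = span {d_u z (fst p) (snd p), d_v z (fst p) (snd p)}"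

text \<open>The surface can be reparametrised as \<open>(s, t) \<mapsto> c t + s *\<^sub>R w t\<close>; the generators are
  the segments \<open>t = const\<close>, and the tangent plane is constant along each of them.\<close>

definition developable_ruled :: "(real \<times> real) set \<Rightarrow> (real \<Rightarrow> real \<Rightarrow> real^4) \<Rightarrow> bool"
  where "developable_ruled D z \<longleftrightarrow>
    (\<exists>Q \<phi> c w. open Q \<and> diffeo_between Q D \<phi> \<and>
       (\<forall>t. connected {s. (s, t) \<in> Q}) \<and>
       smooth_on (snd ` Q) c \<and> smooth_on (snd ` Q) w \<and>
       (\<forall>(s, t)\<in>Q. w t \<noteq> 0 \<and> (case \<phi> (s, t) of (u, v) \<Rightarrow> z u v) = c t + s *\<^sub>R w t) \<and>
       (\<forall>s s' t. (s, t) \<in> Q \<longrightarrow> (s', t) \<in> Q \<longrightarrow>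
          tangent_plane z (\<phi> (s, t)) = tangent_plane z (\<phi> (s', t))))"

definition hyperplane_E3 :: "(real^4) set \<Rightarrow> bool"
  where "hyperplane_E3 P \<longleftrightarrow> affine P \<and> aff_dim P = 3 \<and>
    (\<forall>p\<in>P. \<forall>q\<in>P. p \<noteq> q \<longrightarrow> mink (p - q) (p - q) > 0)"

definition hyperplane_E31 :: "(real^4) set \<Rightarrow> bool"
  where "hyperplane_E31 P \<longleftrightarrow> affine P \<and> aff_dim P = 3 \<and>
    (\<exists>p b1 b2 b3. p \<in> P \<and> p + b1 \<in> P \<and> p + b2 \<in> P \<and> p + b3 \<in> P \<and>
       mink b1 b1 = 1 \<and> mink b2 b2 = 1 \<and> mink b3 b3 = -1 \<and>
       mink b1 b2 = 0 \<and> mink b1 b3 = 0 \<and> mink b2 b3 = 0)"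

definition lies_in :: "real set \<Rightarrow> real set \<Rightarrow> (real \<Rightarrow> real \<Rightarrow> real^4) \<Rightarrow> (real^4) set \<Rightarrow> bool"
  where "lies_in I J z P \<longleftrightarrow> (\<forall>u\<in>I. \<forall>v\<in>J. z u v \<in> P)"


section \<open>The three classes of meridian surfaces\<close>

definition case_radial_line ::
    "real set \<Rightarrow> real set \<Rightarrow> (real \<Rightarrow> real) \<Rightarrow> (real \<Rightarrow> real) \<Rightarrow> (real \<Rightarrow> real) \<Rightarrow>
     real \<Rightarrow> real \<Rightarrow> real \<Rightarrow> bool"
  where "case_radial_line I J f g \<kappa> k a b \<longleftrightarrow>
    (\<forall>v\<in>J. \<kappa> v = k) \<and> k \<noteq> 0 \<and> k \<noteq> 1 \<and> k \<noteq> -1 \<and>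
    ((\<forall>u\<in>I. f u = u + a) \<or> (\<forall>u\<in>I. f u = - u + a)) \<and> (\<forall>u\<in>I. g u = b)"

definition case_affine_line ::
    "real set \<Rightarrow> real set \<Rightarrow> (real \<Rightarrow> real) \<Rightarrow> (real \<Rightarrow> real) \<Rightarrow> (real \<Rightarrow> real) \<Rightarrow>
     real \<Rightarrow> real \<Rightarrow> real \<Rightarrow> real \<Rightarrow> real \<Rightarrow> bool"
  where "case_affine_line I J f g \<kappa> k a a1 b b1 \<longleftrightarrow>
    (\<forall>v\<in>J. \<kappa> v = k) \<and> a\<^sup>2 + b\<^sup>2 = 1 \<and>
    (\<forall>u\<in>I. f u = a * u + a1) \<and> (\<forall>u\<in>I. g u = b * u + b1)"

text \<open>Such a surface need not have pointwise 1-type Gauss map of second kind: the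
  characterisation has to add \<open>a \<noteq> 0\<close>, \<open>k \<noteq> 1\<close> and \<open>k \<noteq> -1\<close>. Indeed, with \<open>t = l'\<close>,
  \<open>f\<^sup>2 \<Delta>G = - a k\<^sup>2 (l \<and> t) + b (1 - k\<^sup>2) (e 1 \<and> t) + a k (t \<and> n)\<close> and
  \<open>G = a (l \<and> t) + b (e 1 \<and> t)\<close>. If \<open>a = 0\<close> and \<open>k\<^sup>2 \<noteq> 1\<close>, then \<open>\<Delta>G = \<lambda> (G + C)\<close>
  forces \<open>C = 0\<close>; if \<open>k\<^sup>2 = 1\<close>, it has no solution with \<open>C\<close> constant and \<open>\<lambda>\<close> nowhere zero.
  For \<open>k = b = 0\<close> the surface is part of a plane, so \<open>H = 0\<close> and it is not marginally
  trapped.\<close>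

definition ode_num :: "(real \<Rightarrow> real) \<Rightarrow> real \<Rightarrow> real"
  where "ode_num f u = (let f1 = deriv f u; f2 = deriv (deriv f) u;
      q = deriv (\<lambda>s. f s * deriv (deriv f) s) u in
    f u * (1 - f1\<^sup>2) * q + (f u)\<^sup>2 * f1 * f2\<^sup>2 + f1 * (1 - f1\<^sup>2)\<^sup>2)"

definition ode_den :: "(real \<Rightarrow> real) \<Rightarrow> real \<Rightarrow> real"
  where "ode_den f u = (let f1 = deriv f u; f2 = deriv (deriv f) u;
      q = deriv (\<lambda>s. f s * deriv (deriv f) s) u in
    (1 - f1\<^sup>2)\<^sup>2 + (f u)\<^sup>2 * f2\<^sup>2 + f u * f1 * (1 - f1\<^sup>2) * q)"

text \<open>The equation is imposed wherever it makes sense, i.e. off the zeros of \<open>1 - f'\<^sup>2\<close>,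
  and includes that the argument of the logarithm is defined and non-zero. The logarithm is the
  logarithm of the absolute value, and \<open>g'\<close> is a square root of \<open>1 - f'\<^sup>2\<close> of either sign: the
  change of parameter \<open>u \<mapsto> - u\<close> and the reflection \<open>e 1 \<mapsto> - e 1\<close> change the signs of the
  argument and of \<open>g'\<close>, but neither of them affects the Gauss map condition. Isolated zeros of
  \<open>1 - f'\<^sup>2\<close>, where \<open>g'\<close> changes sign, do occur.\<close>

definition case_ode ::
    "real set \<Rightarrow> real set \<Rightarrow> (real \<Rightarrow> real) \<Rightarrow> (real \<Rightarrow> real) \<Rightarrow> (real \<Rightarrow> real) \<Rightarrow> bool"
  where "case_ode I J f g \<kappa> \<longleftrightarrow>
    (\<forall>v\<in>J. \<kappa> v = 0) \<and>
    (\<exists>u\<in>I. (deriv f u)\<^sup>2 \<noteq> 1) \<and>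
    (\<forall>u\<in>I. (deriv f u)\<^sup>2 \<noteq> 1 \<longrightarrow>
       ode_num f u \<noteq> 0 \<and> ode_den f u \<noteq> 0 \<and>
       deriv (\<lambda>s. ln \<bar>sqrt (1 - (deriv f s)\<^sup>2) * ode_num f s / ode_den f s\<bar>) u
         = - (deriv f u * deriv (deriv f) u / (1 - (deriv f u)\<^sup>2))) \<and>
    (\<forall>u\<in>I. \<bar>deriv g u\<bar> = sqrt (1 - (deriv f u)\<^sup>2))"

end

theory Submission imports Defs begin

text \<open>Let \<open>t = l'\<close>. Expanding \<open>\<Delta>G = \<lambda> (G + C)\<close> in the moving frame \<open>e 1, l, t, n\<close> and using that \<open>C\<close> is
  constant, the components of \<open>C\<close> along \<open>e 1 \<and> l\<close>, \<open>e 1 \<and> t\<close> and \<open>e 1 \<and> n\<close> vanish, so \<open>g' \<kappa>' = 0\<close>.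
  If \<open>g' = 0\<close> throughout, the equations along the curve force \<open>\<kappa> \<kappa>' = 0\<close>. Otherwise \<open>\<kappa> = k\<close> is
  constant and \<open>C = c (l \<and> t - k t \<and> n)\<close>. For \<open>k \<noteq> 0\<close> the curvature of the meridian times \<open>f\<close>
  is constant, \<open>f'\<close> is a function of it and the meridian is a line. For \<open>k = 0\<close>,
  elimination of \<open>\<lambda>\<close> gives the differential equation of case (iii), which says that the quotient
  \<open>ode_num / ode_den = - c\<close> is locally constant off the zeros of \<open>g'\<close>.

  The converse in case (iii) needs the same \<open>c\<close> on all of \<open>I\<close> and a nowhere zero smooth \<open>\<lambda>\<close>.
  A first integral of the equation, combined with Gronwall's inequality, shows that the zeros of
  \<open>g'\<close> are simple; comparing the derivatives of numerator and denominator at such a zero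
  shows that \<open>c\<close> does not change there.

  In the straight line case the generators are the lines \<open>v = const\<close>, and
  \<open>b n + k (b l - a e 1)\<close> is a constant normal vector of squared length \<open>k\<^sup>2 - b\<^sup>2\<close>.\<close>

section \<open>Calculus of smooth maps\<close>

text \<open>The equation of case (iii) says nothing at the zeros of \<open>g'\<close>, where its
  square root, numerator and denominator all vanish. The remedy is to use \<open>p\<close>, that is
  \<open>f\<close> times the curvature of the meridian, as the unknown instead of
  \<open>f''\<close>: then \<open>ode_num = - g'^3 num\<close> and
  \<open>ode_den = g'^3 den\<close>, where \<open>num\<close> and \<open>den\<close> make sense and
  are differentiable on all of \<open>I\<close>. Write \<psi> for \<open>f^2\<close> times
  \<lambda>. For \<kappa> = 0 the component of the equation along e 1 \<and> t reads
  \<open>den = \<psi> g'\<close>. Since \<open>den + f' num = g' (g'^2 + p^2)\<close> always holds,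
  \<open>num = c den\<close> forces \<open>\<psi> = (g'^2 + p^2) / (1 + c f')\<close> off the zeros
  of \<open>g'\<close>. This formula gives a smooth nowhere zero \<lambda> on all of
  \<open>I\<close> as soon as \<open>1 + c f'\<close> does not vanish and \<open>g'\<close> and
  \<open>p\<close> have no common zero. Both conditions are therefore carried along with
  \<open>num = c den\<close> in the predicate \<open>regular\<close>, and the converse is the
  propagation of \<open>regular c\<close> along \<open>I\<close>.\<close>

lemma frechet_derivative_cong_open:
  assumes "open S" "x \<in> S" "\<And>y. y \<in> S \<Longrightarrow> f y = g y"
  shows "frechet_derivative f (at x) = frechet_derivative g (at x)"
    and "f differentiable (at x) \<longleftrightarrow> g differentiable (at x)"
proof -
  have "(f has_derivative D) (at x) \<longleftrightarrow> (g has_derivative D) (at x)" for D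
    using assms has_derivative_transform_within_open[of f D x UNIV S g]
      has_derivative_transform_within_open[of g D x UNIV S f] by auto
  then show "frechet_derivative f (at x) = frechet_derivative g (at x)"
    and "f differentiable (at x) \<longleftrightarrow> g differentiable (at x)"
    by (auto simp: frechet_derivative_def differentiable_def)
qed

lemma diff_order_on_cong:
  assumes "open S" "\<And>x. x \<in> S \<Longrightarrow> f x = g x"
  shows "diff_order_on k S f \<longleftrightarrow> diff_order_on k S g"
  using assms(2)
proof (induction k arbitrary: f g)
  case 0
  then show ?case by (simp cong: continuous_on_cong)
next
  case (Suc k)
  have "diff_order_on k S (\<lambda>x. frechet_derivative f (at x) h) \<longleftrightarrow>
      diff_order_on k S (\<lambda>x. frechet_derivative g (at x) h)" for h
    using frechet_derivative_cong_open(1)[OF assms(1), of _ f g] Suc.prems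
    by (intro Suc.IH) metis
  moreover have "(\<forall>x\<in>S. f differentiable (at x)) \<longleftrightarrow> (\<forall>x\<in>S. g differentiable (at x))"
    using frechet_derivative_cong_open(2)[OF assms(1), of _ f g] Suc.prems by blast
  ultimately show ?case by simp
qed

lemma smooth_on_cong:
  assumes "open S" "\<And>x. x \<in> S \<Longrightarrow> f x = g x" "smooth_on S f"
  shows "smooth_on S g"
  using assms diff_order_on_cong[of S f g] by (simp add: smooth_on_def)

text \<open>\<open>frechet_derivative\<close> can be computed only at points of \<open>S\<close>. As
  \<open>S\<close> is open, orders of differentiability depend only on values in \<open>S\<close>,
  so any explicit derivative may take its place.\<close>

lemma diff_order_on_SucI:
  assumes "open S" and D: "\<And>x. x \<in> S \<Longrightarrow> (f has_derivative D x) (at x)"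
    and "\<And>h. diff_order_on k S (\<lambda>x. D x h)"
  shows "diff_order_on (Suc k) S f"
proof -
  have "D x h = frechet_derivative f (at x) h" if "x \<in> S" for x h
    using frechet_derivative_at[OF D[OF that]] by simp
  then have "diff_order_on k S (\<lambda>x. frechet_derivative f (at x) h)" for h
    using assms(3)[of h] by (subst diff_order_on_cong[OF assms(1), symmetric]) auto
  moreover have "\<forall>x\<in>S. f differentiable (at x)"
    using D differentiable_def by blast
  ultimately show ?thesis by simp
qed

lemma diff_order_on_SucD:
  assumes "diff_order_on (Suc k) S f"
  shows "diff_order_on k S f"
  using assms
proof (induction k arbitrary: f)
  case 0
  then show ?case
    by (auto intro!: continuous_at_imp_continuous_on differentiable_imp_continuous_within)
next
  case (Suc k)
  then show ?case by (metis diff_order_on.simps(2))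
qed

lemma diff_order_on_const: "diff_order_on k S (\<lambda>x. c)"
  by (induction k arbitrary: c) auto

lemma diff_order_on_bounded_linear:
  assumes "bounded_linear L"
  shows "diff_order_on k S L"
proof (cases k)
  case 0
  then show ?thesis by (simp add: assms linear_continuous_on)
next
  case (Suc j)
  have "L differentiable (at x)" "frechet_derivative L (at x) = L" for x
    using bounded_linear_imp_has_derivative[OF assms, of "at x"]
    by (auto simp: differentiable_def frechet_derivative_at[symmetric])
  then show ?thesis by (simp add: Suc diff_order_on_const)
qed

lemma diff_order_on_linear_compose:
  assumes "open S" "bounded_linear L" "diff_order_on k S f"
  shows "diff_order_on k S (\<lambda>x. L (f x))"
  using assms(3)
proof (induction k arbitrary: f)
  case 0
  then show ?case by (simp add: assms(2) bounded_linear.continuous_on)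
next
  case (Suc k)
  have *: "((\<lambda>x. L (f x)) has_derivative (\<lambda>h. L (frechet_derivative f (at x) h))) (at x)"
    if "x \<in> S" for x
    using Suc.prems that
    by (auto intro!: bounded_linear.has_derivative[OF assms(2)] simp: frechet_derivative_works[symmetric])
  have "diff_order_on k S (\<lambda>x. L (frechet_derivative f (at x) h))" for h
    using Suc by simp
  with * show ?case by (intro diff_order_on_SucI[OF assms(1)])
qed

lemma diff_order_on_add:
  assumes "open S" "diff_order_on k S f" "diff_order_on k S g"
  shows "diff_order_on k S (\<lambda>x. f x + g x)"
  using assms(2,3)
proof (induction k arbitrary: f g)
  case 0
  then show ?case by (simp add: continuous_on_add)
next
  case (Suc k)
  have *: "((\<lambda>x. f x + g x) has_derivative
      (\<lambda>h. frechet_derivative f (at x) h + frechet_derivative g (at x) h)) (at x)"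
    if "x \<in> S" for x
    using Suc.prems that
    by (auto intro!: has_derivative_add simp: frechet_derivative_works[symmetric])
  have "diff_order_on k S (\<lambda>x. frechet_derivative f (at x) h + frechet_derivative g (at x) h)" for h
    using Suc by simp
  with * show ?case by (intro diff_order_on_SucI[OF assms(1)])
qed

text \<open>Leibniz rule and induction on the order: each summand of the derivative pairs one
  undifferentiated factor with one derivative, so both have order \<open>k\<close>. It serves
  products of reals as well as \<open>mink\<close>.\<close>

lemma diff_order_on_bilinear:
  assumes "open S" "bounded_bilinear B" "diff_order_on k S f" "diff_order_on k S g"
  shows "diff_order_on k S (\<lambda>x. B (f x) (g x))"
  using assms(3,4)
proof (induction k arbitrary: f g)
  case 0
  then show ?case by (simp add: assms(2) bounded_bilinear.continuous_on)
next
  case (Suc k)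
  let ?D = "\<lambda>x h. B (f x) (frechet_derivative g (at x) h) + B (frechet_derivative f (at x) h) (g x)"
  have *: "((\<lambda>x. B (f x) (g x)) has_derivative ?D x) (at x)" if "x \<in> S" for x
    using Suc.prems that
    by (auto intro!: bounded_bilinear.FDERIV[OF assms(2)] simp: frechet_derivative_works[symmetric])
  have "diff_order_on k S (\<lambda>x. ?D x h)" for h
    using Suc.prems diff_order_on_SucD[OF Suc.prems(1)] diff_order_on_SucD[OF Suc.prems(2)]
    by (intro diff_order_on_add[OF assms(1)] Suc.IH) simp_all
  with * show ?case by (intro diff_order_on_SucI[OF assms(1)])
qed

lemma diff_order_on_inverse:
  fixes f :: "'a::real_normed_vector \<Rightarrow> real"
  assumes "open S" "\<And>x. x \<in> S \<Longrightarrow> f x \<noteq> 0" "diff_order_on k S f"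
  shows "diff_order_on k S (\<lambda>x. inverse (f x))"
  using assms(3)
proof (induction k)
  case 0
  then show ?case using assms(2) by (simp add: continuous_on_inverse)
next
  case (Suc k)
  let ?D = "\<lambda>x h. - (inverse (f x) * frechet_derivative f (at x) h * inverse (f x))"
  have *: "((\<lambda>x. inverse (f x)) has_derivative ?D x) (at x)" if "x \<in> S" for x
    using Suc.prems that assms(2)
    by (auto intro!: has_derivative_inverse simp: frechet_derivative_works[symmetric])
  have "diff_order_on k S (\<lambda>x. ?D x h)" for h
    using Suc diff_order_on_SucD[OF Suc.prems]
    by (intro diff_order_on_bilinear[OF assms(1) bounded_bilinear_mult]
        diff_order_on_linear_compose[OF assms(1) bounded_linear_minus[OF bounded_linear_ident]]) auto
  with * show ?case by (intro diff_order_on_SucI[OF assms(1)])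
qed

text \<open>Needed because \<lambda> will be built as a function of \<open>u\<close> alone but must
  be smooth on the product. The derivative in direction \<open>d\<close> is \<open>fst d\<close>
  times the one-variable derivative, evaluated at \<open>fst q\<close>, so the induction stays among
  functions of this form.\<close>

lemma diff_order_on_compose_fst:
  fixes h :: "real \<Rightarrow> 'b::real_normed_vector" and J :: "real set"
  assumes "open I" "open J" "diff_order_on k I h"
  shows "diff_order_on k (I \<times> J) (\<lambda>q. h (fst q))"
  using assms(3)
proof (induction k arbitrary: h)
  case 0
  then show ?case
    by (auto intro!: continuous_on_compose2[OF _ continuous_on_fst[OF continuous_on_id]])
next
  case (Suc k)
  let ?D = "\<lambda>(q :: real \<times> real) (d :: real \<times> real). fst d *\<^sub>R frechet_derivative h (at (fst q)) 1"
  have *: "((\<lambda>q :: real \<times> real. h (fst q)) has_derivative ?D q) (at q)"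
    if "q \<in> I \<times> J" for q
  proof -
    have "h differentiable (at (fst q))" using Suc.prems that by auto
    then have hd: "(h has_derivative frechet_derivative h (at (fst q))) (at (fst q))"
      by (simp add: frechet_derivative_works)
    show ?thesis
    proof (rule has_derivative_eq_rhs)
      show "((\<lambda>q. h (fst q)) has_derivative (\<lambda>d. frechet_derivative h (at (fst q)) (fst d))) (at q)"
        by (rule has_derivative_compose[OF has_derivative_fst[OF has_derivative_ident] hd])
      show "(\<lambda>d. frechet_derivative h (at (fst q)) (fst d)) = ?D q"
      proof
        fix d :: "real \<times> real"
        show "frechet_derivative h (at (fst q)) (fst d) = ?D q d"
          using linear_scale[OF has_derivative_linear[OF hd], of "fst d" 1] by (metis mult.right_neutral real_scaleR_def)
      qed
    qed
  qed
  have "diff_order_on k (I \<times> J) (\<lambda>q. ?D q d)" for d :: "real \<times> real"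
    using Suc by (intro diff_order_on_linear_compose[OF open_Times[OF assms(1,2)] bounded_linear_scaleR_right]) auto
  with * show ?case by (intro diff_order_on_SucI[OF open_Times[OF assms(1,2)]])
qed

lemma smooth_on_const: "smooth_on S (\<lambda>x. c)"
  by (simp add: smooth_on_def diff_order_on_const)

lemma smooth_on_bounded_linear: "bounded_linear L \<Longrightarrow> smooth_on S L"
  by (simp add: smooth_on_def diff_order_on_bounded_linear)

lemma smooth_on_add:
  "open S \<Longrightarrow> smooth_on S f \<Longrightarrow> smooth_on S g \<Longrightarrow> smooth_on S (\<lambda>x. f x + g x)"
  by (simp add: smooth_on_def diff_order_on_add)

lemma smooth_on_linear_compose:
  "open S \<Longrightarrow> bounded_linear L \<Longrightarrow> smooth_on S f \<Longrightarrow> smooth_on S (\<lambda>x. L (f x))"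
  by (simp add: smooth_on_def diff_order_on_linear_compose)

lemma smooth_on_bilinear:
  "open S \<Longrightarrow> bounded_bilinear B \<Longrightarrow> smooth_on S f \<Longrightarrow> smooth_on S g
    \<Longrightarrow> smooth_on S (\<lambda>x. B (f x) (g x))"
  by (simp add: smooth_on_def diff_order_on_bilinear)

lemma smooth_on_mult:
  fixes f g :: "'a::real_normed_vector \<Rightarrow> real"
  shows "open S \<Longrightarrow> smooth_on S f \<Longrightarrow> smooth_on S g \<Longrightarrow> smooth_on S (\<lambda>x. f x * g x)"
  by (rule smooth_on_bilinear[OF _ bounded_bilinear_mult])

lemma smooth_on_diff:
  fixes f g :: "'a::real_normed_vector \<Rightarrow> real"
  assumes "open S" "smooth_on S f" "smooth_on S g"
  shows "smooth_on S (\<lambda>x. f x - g x)"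
  using smooth_on_add[OF assms(1,2) smooth_on_linear_compose[OF assms(1) bounded_linear_minus[OF bounded_linear_ident] assms(3)]]
  by simp

lemma smooth_on_inverse:
  fixes f :: "'a::real_normed_vector \<Rightarrow> real"
  shows "open S \<Longrightarrow> (\<And>x. x \<in> S \<Longrightarrow> f x \<noteq> 0) \<Longrightarrow> smooth_on S f \<Longrightarrow> smooth_on S (\<lambda>x. inverse (f x))"
  by (simp add: smooth_on_def diff_order_on_inverse)

lemma smooth_on_divide:
  fixes f g :: "'a::real_normed_vector \<Rightarrow> real"
  assumes "open S" "\<And>x. x \<in> S \<Longrightarrow> g x \<noteq> 0" "smooth_on S f" "smooth_on S g"
  shows "smooth_on S (\<lambda>x. f x / g x)"
  unfolding divide_inverse using assms by (intro smooth_on_mult smooth_on_inverse)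

lemma smooth_on_power:
  fixes f :: "'a::real_normed_vector \<Rightarrow> real"
  assumes "open S" "smooth_on S f"
  shows "smooth_on S (\<lambda>x. (f x) ^ m)"
  using assms by (induction m) (auto intro: smooth_on_const smooth_on_mult)

lemma smooth_on_compose_fst:
  fixes h :: "real \<Rightarrow> 'b::real_normed_vector" and J :: "real set"
  shows "open I \<Longrightarrow> open J \<Longrightarrow> smooth_on I h \<Longrightarrow> smooth_on (I \<times> J) (\<lambda>q. h (fst q))"
  by (simp add: smooth_on_def diff_order_on_compose_fst)

lemma smooth_on_differentiable: "smooth_on S f \<Longrightarrow> x \<in> S \<Longrightarrow> f differentiable (at x)"
  unfolding smooth_on_def using diff_order_on.simps(2) by blast

lemma smooth_on_has_vector_derivative:
  "smooth_on S f \<Longrightarrow> x \<in> S \<Longrightarrow> (f has_vector_derivative vector_derivative f (at x)) (at x)"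
  by (simp add: smooth_on_differentiable vector_derivative_works[symmetric])

lemma smooth_on_vector_derivative:
  fixes f :: "real \<Rightarrow> 'b::real_normed_vector"
  assumes "open S" "smooth_on S f"
  shows "smooth_on S (\<lambda>x. vector_derivative f (at x))"
proof (rule smooth_on_cong[OF assms(1)])
  show "smooth_on S (\<lambda>x. frechet_derivative f (at x) 1)"
    using assms(2) unfolding smooth_on_def by (metis diff_order_on.simps(2))
  show "frechet_derivative f (at x) 1 = vector_derivative f (at x)" if "x \<in> S" for x
    using frechet_derivative_eq_vector_derivative[OF smooth_on_differentiable[OF assms(2) that]] by simp
qed

lemma smooth_on_DERIV:
  fixes f :: "real \<Rightarrow> real"
  shows "smooth_on S f \<Longrightarrow> x \<in> S \<Longrightarrow> (f has_real_derivative deriv f x) (at x)"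
  using DERIV_deriv_iff_real_differentiable smooth_on_differentiable by blast

lemma smooth_on_deriv:
  fixes f :: "real \<Rightarrow> real"
  assumes "open S" "smooth_on S f"
  shows "smooth_on S (deriv f)"
proof (rule smooth_on_cong[OF assms(1) _ smooth_on_vector_derivative[OF assms]])
  show "vector_derivative f (at x) = deriv f x" if "x \<in> S" for x
    using smooth_on_DERIV[OF assms(2) that]
    by (simp add: has_real_derivative_iff_has_vector_derivative vector_derivative_at)
qed

lemma smooth_on_continuous_on: "smooth_on S f \<Longrightarrow> continuous_on S f"
  unfolding smooth_on_def using diff_order_on.simps(1) by blast

section \<open>Moving frames in Minkowski space\<close>

lemma bounded_bilinear_mink: "bounded_bilinear mink"
  unfolding bilinear_conv_bounded_bilinear[symmetric] bilinear_def
  by (auto intro!: linearI simp: mink_def algebra_simps)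

interpretation mink: bounded_bilinear mink
  by (rule bounded_bilinear_mink)

lemma mink_commute: "mink a b = mink b a"
  by (simp add: mink_def algebra_simps)

lemma R31_nth_1: "x \<in> R31 \<Longrightarrow> x $ 1 = 0"
  unfolding R31_def
  by (erule span_induct) (auto simp: axis_def subspace_def)

lemma mink_e1: "mink x (e 1) = x $ 1" "mink (e 1) x = x $ 1"
  by (simp_all add: mink_def axis_def)

lemma mink_e1_e1: "mink (e 1) (e 1) = 1"
  by (simp add: mink_def axis_def)

definition mink_frame :: "real^4 \<Rightarrow> real^4 \<Rightarrow> real^4 \<Rightarrow> real^4 \<Rightarrow> bool" where
  "mink_frame p q r s \<longleftrightarrow> mink p p = 1 \<and> mink q q = 1 \<and> mink r r = 1 \<and> mink s s = -1 \<and>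
    mink p q = 0 \<and> mink p r = 0 \<and> mink p s = 0 \<and> mink q r = 0 \<and> mink q s = 0 \<and> mink r s = 0"

text \<open>Pairing with the four vectors recovers the coefficients up to sign, so the coefficient
  map is injective, hence surjective by dimension.\<close>

lemma mink_frame_spans:
  assumes "mink_frame p q r s"
  obtains y :: "real^4" where "x = (y$1) *\<^sub>R p + (y$2) *\<^sub>R q + (y$3) *\<^sub>R r + (y$4) *\<^sub>R s"
proof -
  note fr = assms[unfolded mink_frame_def]
  let ?T = "\<lambda>y::real^4. (y$1) *\<^sub>R p + (y$2) *\<^sub>R q + (y$3) *\<^sub>R r + (y$4) *\<^sub>R s"
  have lin: "linear ?T"
    by (auto intro!: linearI simp: algebra_simps)
  have "y = 0" if "?T y = 0" for y
  proof -
    have "mink (?T y) p = y$1" "mink (?T y) q = y$2" "mink (?T y) r = y$3" "mink (?T y) s = - y$4"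
      using fr by (simp_all add: mink.add_left mink.scaleR_left mink_commute mink.add_right mink.scaleR_right)
    then have "y$1 = 0" "y$2 = 0" "y$3 = 0" "y$4 = 0"
      unfolding that mink.zero_left by simp_all
    then show ?thesis
      by (simp add: vec_eq_iff forall_4)
  qed
  then have "inj ?T"
    using lin linear_injective_0 by blast
  then have "surj ?T"
    using lin linear_injective_imp_surjective by blast
  then obtain y where "x = ?T y"
    unfolding surj_def by blast
  then show ?thesis by (rule that)
qed

lemma mink_frame_expansion:
  assumes "mink_frame p q r s"
  shows "x = mink x p *\<^sub>R p + mink x q *\<^sub>R q + mink x r *\<^sub>R r - mink x s *\<^sub>R s"
proof -
  obtain y :: "real^4" where y: "x = (y$1) *\<^sub>R p + (y$2) *\<^sub>R q + (y$3) *\<^sub>R r + (y$4) *\<^sub>R s"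
    by (rule mink_frame_spans[OF assms])
  have "mink x p = y$1" "mink x q = y$2" "mink x r = y$3" "mink x s = - y$4"
    unfolding y using assms by (simp_all add: mink_frame_def mink.add_left mink.scaleR_left mink_commute
      mink.add_right mink.scaleR_right)
  then show ?thesis using y by simp
qed

section \<open>Bivectors and their components\<close>

lemma bounded_bilinear_wedge: "bounded_bilinear wedge"
  unfolding bilinear_conv_bounded_bilinear[symmetric] bilinear_def
  by (auto intro!: linearI simp: wedge_def vec_eq_iff algebra_simps)

interpretation wedge: bounded_bilinear wedge
  by (rule bounded_bilinear_wedge)

lemma wedge_self [simp]: "wedge a a = 0"
  by (simp add: wedge_def vec_eq_iff)

lemma wedge_bivector: "wedge a b \<in> bivectors"
  unfolding bivectors_def by (rule span_base) auto

text \<open>Lowering of an index: the Euclidean product with \<open>flip a\<close> is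
  \<open>mink\<close> with \<open>a\<close>.\<close>

definition flip :: "real^4 \<Rightarrow> real^4" where
  "flip a = (\<chi> i. if i = 4 then - a$i else a$i)"

text \<open>On bivectors this is the indefinite inner product of \<open>M\<close> with a \<and> b,
  as \<open>bpair_wedge\<close> confirms. As a bilinear form in \<open>a\<close> and
  \<open>b\<close> it can be differentiated along a moving frame while \<open>M\<close> stays
  constant.\<close>

definition bpair :: "real^4^4 \<Rightarrow> real^4 \<Rightarrow> real^4 \<Rightarrow> real" where
  "bpair M a b = flip a \<bullet> (M *v flip b)"

lemma bounded_bilinear_bpair: "bounded_bilinear (bpair M)"
  unfolding bilinear_conv_bounded_bilinear[symmetric] bilinear_def
proof (intro conjI allI)
  have flip: "flip (a + b) = flip a + flip b" "flip (r *\<^sub>R a) = r *\<^sub>R flip a" for a b r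
    by (auto simp: flip_def vec_eq_iff)
  show "linear (bpair M a)" for a
    by (auto intro!: linearI simp: bpair_def flip matrix_vector_right_distrib inner_add_right
      matrix_vector_mult_scaleR)
  show "linear (\<lambda>a. bpair M a b)" for b
    by (auto intro!: linearI simp: bpair_def flip inner_add_left)
qed

interpretation bpair: bounded_bilinear "bpair M"
  by (rule bounded_bilinear_bpair)

lemma bpair_add: "bpair (M + N) a b = bpair M a b + bpair N a b"
  by (simp add: bpair_def matrix_vector_mult_add_rdistrib inner_add_right)

lemma bpair_scaleR: "bpair (r *\<^sub>R M) a b = r * bpair M a b"
  by (simp add: bpair_def scaleR_matrix_vector_assoc[symmetric])

lemma bpair_wedge: "bpair (wedge p q) a b = mink p a * mink q b - mink q a * mink p b"
  by (simp add: bpair_def flip_def wedge_def mink_def inner_vec_def matrix_vector_mult_def sum_4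
      algebra_simps)

lemma bpair_anticommute:
  assumes "M \<in> bivectors"
  shows "bpair M a b = - bpair M b a"
  using assms unfolding bivectors_def
proof (induction rule: span_induct)
  case base
  show ?case
    unfolding subspace_def
    by (auto simp: bpair_add bpair_scaleR) (simp add: bpair_def)
next
  case (step M)
  then show ?case by (auto simp: bpair_wedge)
qed

lemma bpair_eq_0I:
  assumes "\<And>a b. bpair M a b = 0"
  shows "M = 0"
proof -
  have [simp]: "flip (flip a) = a" for a
    by (simp add: flip_def vec_eq_iff)
  have "M $ i $ j = 0" for i j
    using assms[of "flip (axis i 1)" "flip (axis j 1)"]
    by (simp add: bpair_def inner_axis' matrix_vector_mul_component inner_axis)
  then show ?thesis by (simp add: vec_eq_iff)
qed

text \<open>Antisymmetry turns the six given values into all sixteen values on pairs of frame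
  vectors; bilinearity and spanning do the rest.\<close>

lemma bivector_eq_0I:
  assumes "M \<in> bivectors" "mink_frame p q r s"
    and "bpair M p q = 0" "bpair M p r = 0" "bpair M p s = 0"
    and "bpair M q r = 0" "bpair M q s = 0" "bpair M r s = 0"
  shows "M = 0"
proof (rule bpair_eq_0I)
  have self: "bpair M a a = 0" for a
    using bpair_anticommute[OF assms(1), of a a] by simp
  have swap: "bpair M q p = 0" "bpair M r p = 0" "bpair M s p = 0"
    "bpair M r q = 0" "bpair M s q = 0" "bpair M s r = 0"
    using assms bpair_anticommute[OF assms(1)] by (metis neg_equal_0_iff_equal)+
  fix a b
  obtain y :: "real^4" where y: "a = (y$1) *\<^sub>R p + (y$2) *\<^sub>R q + (y$3) *\<^sub>R r + (y$4) *\<^sub>R s"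
    by (rule mink_frame_spans[OF assms(2)])
  obtain x :: "real^4" where x: "b = (x$1) *\<^sub>R p + (x$2) *\<^sub>R q + (x$3) *\<^sub>R r + (x$4) *\<^sub>R s"
    by (rule mink_frame_spans[OF assms(2)])
  show "bpair M a b = 0"
    unfolding x y
    by (simp add: bpair.add_left bpair.add_right bpair.scaleR_left bpair.scaleR_right self swap assms)
qed

text \<open>The device by which identities are differentiated: a relation valid along an open set
  has vanishing derivative, and uniqueness of derivatives turns this into a new relation.\<close>

lemma has_vector_derivative_locally_const:
  assumes "open S" "x \<in> S" "\<And>y. y \<in> S \<Longrightarrow> F y = c" "(F has_vector_derivative D) (at x)"
  shows "D = 0"
proof -
  have "((\<lambda>_. c) has_vector_derivative D) (at x)"
    using has_vector_derivative_transform_within_open[OF assms(4,1,2)] assms(3) by simp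
  then show ?thesis
    using has_vector_derivative_const vector_derivative_unique_at by blast
qed

lemma d_u_eqI:
  assumes "open I" "u \<in> I" "\<And>s. s \<in> I \<Longrightarrow> F s v = H s" "(H has_vector_derivative D) (at u)"
  shows "d_u F u v = D"
  unfolding d_u_def
  by (rule vector_derivative_at, rule has_vector_derivative_transform_within_open[OF assms(4,1,2)])
    (simp add: assms(3))

lemma d_v_eqI:
  assumes "open J" "v \<in> J" "\<And>s. s \<in> J \<Longrightarrow> F u s = H s" "(H has_vector_derivative D) (at v)"
  shows "d_v F u v = D"
  unfolding d_v_def
  by (rule vector_derivative_at, rule has_vector_derivative_transform_within_open[OF assms(4,1,2)])
    (simp add: assms(3))

lemma scaleR_has_vector_derivative_real:
  assumes "(h has_real_derivative h') (at u)"
  shows "((\<lambda>s. h s *\<^sub>R a) has_vector_derivative h' *\<^sub>R a) (at u)"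
  using has_vector_derivative_scaleR[OF assms has_vector_derivative_const[of a]] by simp

lemma nth_has_vector_derivative:
  assumes "(F has_vector_derivative D) (at x)"
  shows "((\<lambda>s. F s $ i) has_vector_derivative D $ i) (at x)"
  by (rule bounded_linear.has_vector_derivative[OF bounded_linear_vec_nth assms])

section \<open>The Frenet equations of the curve\<close>

locale spherical_curve =
  fixes J :: "real set" and l n :: "real \<Rightarrow> real^4"
  assumes open_J: "open J" and interval_J: "is_interval J" and J_nonempty: "J \<noteq> {}"
    and frame: "spherical_frame J l n"
begin

abbreviation t where "t \<equiv> velocity l"
abbreviation \<kappa> where "\<kappa> \<equiv> spherical_curvature l n"
abbreviation \<kappa>' where "\<kappa>' \<equiv> deriv (spherical_curvature l n)"

lemma smooth_l: "smooth_on J l" and smooth_n: "smooth_on J n"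
  using frame by (auto simp: spherical_frame_def)

lemma smooth_t: "smooth_on J t"
  using smooth_on_vector_derivative[OF open_J smooth_l] by (simp add: velocity_def[abs_def])

lemma smooth_\<kappa>: "smooth_on J \<kappa>"
  unfolding spherical_curvature_def[abs_def]
  by (intro smooth_on_bilinear[OF open_J bounded_bilinear_mink] smooth_n
      smooth_on_vector_derivative[OF open_J smooth_t])

lemma \<kappa>_deriv: "v \<in> J \<Longrightarrow> (\<kappa> has_real_derivative \<kappa>' v) (at v)"
  by (rule smooth_on_DERIV[OF smooth_\<kappa>])

lemma l_deriv: "v \<in> J \<Longrightarrow> (l has_vector_derivative t v) (at v)"
  using smooth_on_has_vector_derivative[OF smooth_l] by (simp add: velocity_def)

lemma R31_frame: "v \<in> J \<Longrightarrow> l v $ 1 = 0" "v \<in> J \<Longrightarrow> n v $ 1 = 0"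
  using frame by (auto simp: spherical_frame_def de_Sitter_def R31_nth_1)

lemma t_nth_1: "v \<in> J \<Longrightarrow> t v $ 1 = 0"
  using has_vector_derivative_locally_const[OF open_J _ _ nth_has_vector_derivative[OF l_deriv], of v 1 0]
    R31_frame by blast

lemma frame_products:
  assumes "v \<in> J"
  shows "mink (l v) (l v) = 1" "mink (t v) (t v) = 1" "mink (n v) (n v) = -1"
    "mink (n v) (l v) = 0" "mink (l v) (n v) = 0" "mink (n v) (t v) = 0" "mink (t v) (n v) = 0"
    "mink (l v) (t v) = 0" "mink (t v) (l v) = 0"
    "mink (e 1) (l v) = 0" "mink (l v) (e 1) = 0" "mink (e 1) (n v) = 0" "mink (n v) (e 1) = 0"
    "mink (e 1) (t v) = 0" "mink (t v) (e 1) = 0"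
proof -
  have ll: "mink (l w) (l w) = 1" if "w \<in> J" for w
    using frame that by (simp add: spherical_frame_def de_Sitter_def)
  show "mink (l v) (l v) = 1" "mink (t v) (t v) = 1" "mink (n v) (n v) = -1"
    "mink (n v) (l v) = 0" "mink (l v) (n v) = 0" "mink (n v) (t v) = 0" "mink (t v) (n v) = 0"
    using frame assms mink_commute by (auto simp: spherical_frame_def de_Sitter_def)
  show lt: "mink (l v) (t v) = 0"
    using has_vector_derivative_locally_const[OF open_J assms ll
        mink.has_vector_derivative[OF l_deriv l_deriv, OF assms assms]]
    by (simp add: mink_commute)
  then show "mink (t v) (l v) = 0" by (simp add: mink_commute)
  show "mink (e 1) (l v) = 0" "mink (l v) (e 1) = 0" "mink (e 1) (n v) = 0" "mink (n v) (e 1) = 0"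
    "mink (e 1) (t v) = 0" "mink (t v) (e 1) = 0"
    using R31_frame[OF assms] t_nth_1[OF assms] by (simp_all add: mink_e1)
qed

lemma curve_frame: "v \<in> J \<Longrightarrow> mink_frame (e 1) (l v) (t v) (n v)"
  by (simp add: mink_frame_def frame_products mink_e1_e1)

text \<open>Three components of \<open>t'\<close> come from differentiating
  \<open>mink t t = 1\<close>, \<open>mink t l = 0\<close> and the vanishing first coordinate of
  \<open>t\<close>; the fourth is \<kappa> by definition. As \<open>n\<close> is timelike, \<kappa>
  enters the expansion with a minus sign.\<close>

lemma t_deriv:
  assumes v: "v \<in> J"
  shows "(t has_vector_derivative - \<kappa> v *\<^sub>R n v - l v) (at v)"
proof -
  define t' where "t' = vector_derivative t (at v)"
  have d: "(t has_vector_derivative t') (at v)"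
    unfolding t'_def by (rule smooth_on_has_vector_derivative[OF smooth_t v])
  have "t' $ 1 = 0"
    using has_vector_derivative_locally_const[OF open_J v _ nth_has_vector_derivative[OF d]] t_nth_1 by blast
  moreover have "mink (t v) t' + mink t' (t v) = 0"
    using has_vector_derivative_locally_const[OF open_J v _ mink.has_vector_derivative[OF d d]]
      frame_products(2) by blast
  moreover have "mink (t v) (t v) + mink t' (l v) = 0"
    using has_vector_derivative_locally_const[OF open_J v _ mink.has_vector_derivative[OF d l_deriv[OF v]]]
      frame_products(9) by blast
  moreover have "mink t' (n v) = \<kappa> v"
    by (simp add: t'_def spherical_curvature_def)
  ultimately have "mink t' (e 1) = 0" "mink t' (t v) = 0" "mink t' (l v) = -1" "mink t' (n v) = \<kappa> v"
    using frame_products(2)[OF v] mink_commute[of t' "t v"] by (simp_all add: mink_e1)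
  then have "t' = - \<kappa> v *\<^sub>R n v - l v"
    by (subst mink_frame_expansion[OF curve_frame[OF v], of t']) simp
  then show ?thesis using d by simp
qed

lemma n_deriv:
  assumes v: "v \<in> J"
  shows "(n has_vector_derivative - \<kappa> v *\<^sub>R t v) (at v)"
proof -
  define n' where "n' = vector_derivative n (at v)"
  have d: "(n has_vector_derivative n') (at v)"
    unfolding n'_def by (rule smooth_on_has_vector_derivative[OF smooth_n v])
  have "n' $ 1 = 0"
    using has_vector_derivative_locally_const[OF open_J v _ nth_has_vector_derivative[OF d]] R31_frame by blast
  moreover have "mink (n v) n' + mink n' (n v) = 0"
    using has_vector_derivative_locally_const[OF open_J v _ mink.has_vector_derivative[OF d d]]
      frame_products(3) by blast
  moreover have "mink (n v) (t v) + mink n' (l v) = 0"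
    using has_vector_derivative_locally_const[OF open_J v _ mink.has_vector_derivative[OF d l_deriv[OF v]]]
      frame_products(4) by blast
  moreover have "mink (n v) (- \<kappa> v *\<^sub>R n v - l v) + mink n' (t v) = 0"
    using has_vector_derivative_locally_const[OF open_J v _ mink.has_vector_derivative[OF d t_deriv[OF v]]]
      frame_products(6) by blast
  ultimately have "mink n' (e 1) = 0" "mink n' (n v) = 0" "mink n' (l v) = 0" "mink n' (t v) = - \<kappa> v"
    using frame_products[OF v] mink_commute[of n' "n v"]
    by (simp_all add: mink_e1 mink.diff_right mink.minus_right mink.scaleR_right mink.minus_left)
  then have "n' = - \<kappa> v *\<^sub>R t v"
    by (subst mink_frame_expansion[OF curve_frame[OF v], of n']) simp
  then show ?thesis using d by simp
qed

abbreviation lt where "lt v \<equiv> wedge (l v) (t v)"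
abbreviation et where "et v \<equiv> wedge (e 1) (t v)"
abbreviation el where "el v \<equiv> wedge (e 1) (l v)"
abbreviation en where "en v \<equiv> wedge (e 1) (n v)"
abbreviation l_n where "l_n v \<equiv> wedge (l v) (n v)"
abbreviation tn where "tn v \<equiv> wedge (t v) (n v)"

end

section \<open>The Laplacian of the Gauss map\<close>

context spherical_curve begin

lemma wedge_derivs:
  assumes v: "v \<in> J"
  shows "(lt has_vector_derivative - \<kappa> v *\<^sub>R l_n v) (at v)"
    and "(et has_vector_derivative - \<kappa> v *\<^sub>R en v - el v) (at v)"
    and "(el has_vector_derivative et v) (at v)"
    and "(en has_vector_derivative - \<kappa> v *\<^sub>R et v) (at v)"
    and "(l_n has_vector_derivative tn v - \<kappa> v *\<^sub>R lt v) (at v)"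
    and "(tn has_vector_derivative - l_n v) (at v)"
  using wedge.has_vector_derivative[OF l_deriv[OF v] t_deriv[OF v]]
    wedge.has_vector_derivative[OF has_vector_derivative_const[of "e 1"] t_deriv[OF v]]
    wedge.has_vector_derivative[OF has_vector_derivative_const[of "e 1"] l_deriv[OF v]]
    wedge.has_vector_derivative[OF has_vector_derivative_const[of "e 1"] n_deriv[OF v]]
    wedge.has_vector_derivative[OF l_deriv[OF v] n_deriv[OF v]]
    wedge.has_vector_derivative[OF t_deriv[OF v] n_deriv[OF v]]
  by (simp_all add: wedge.diff_right wedge.diff_left wedge.scaleR_right wedge.scaleR_left
      wedge.minus_right wedge.minus_left wedge.zero_left)

text \<open>A constant bivector has moving components that satisfy the linear system dual to the
  frame equations. These six relations are the only way in which the constancy of \<open>C\<close>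
  is exploited.\<close>

lemma bpair_derivs:
  assumes v: "v \<in> J" and C: "C \<in> bivectors"
  shows "((\<lambda>v. bpair C (l v) (t v)) has_real_derivative - \<kappa> v * bpair C (l v) (n v)) (at v)"
    and "((\<lambda>v. bpair C (e 1) (t v)) has_real_derivative
           - \<kappa> v * bpair C (e 1) (n v) - bpair C (e 1) (l v)) (at v)"
    and "((\<lambda>v. bpair C (e 1) (l v)) has_real_derivative bpair C (e 1) (t v)) (at v)"
    and "((\<lambda>v. bpair C (e 1) (n v)) has_real_derivative - \<kappa> v * bpair C (e 1) (t v)) (at v)"
    and "((\<lambda>v. bpair C (l v) (n v)) has_real_derivative
           bpair C (t v) (n v) - \<kappa> v * bpair C (l v) (t v)) (at v)"
    and "((\<lambda>v. bpair C (t v) (n v)) has_real_derivative - bpair C (l v) (n v)) (at v)"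
proof -
  have self: "bpair C a a = 0" for a
    using bpair_anticommute[OF C, of a a] by simp
  show "((\<lambda>v. bpair C (l v) (t v)) has_real_derivative - \<kappa> v * bpair C (l v) (n v)) (at v)"
    and "((\<lambda>v. bpair C (e 1) (t v)) has_real_derivative
           - \<kappa> v * bpair C (e 1) (n v) - bpair C (e 1) (l v)) (at v)"
    and "((\<lambda>v. bpair C (e 1) (l v)) has_real_derivative bpair C (e 1) (t v)) (at v)"
    and "((\<lambda>v. bpair C (e 1) (n v)) has_real_derivative - \<kappa> v * bpair C (e 1) (t v)) (at v)"
    and "((\<lambda>v. bpair C (l v) (n v)) has_real_derivative
           bpair C (t v) (n v) - \<kappa> v * bpair C (l v) (t v)) (at v)"
    and "((\<lambda>v. bpair C (t v) (n v)) has_real_derivative - bpair C (l v) (n v)) (at v)"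
    using bpair.has_vector_derivative[OF l_deriv[OF v] t_deriv[OF v], of C]
      bpair.has_vector_derivative[OF has_vector_derivative_const[of "e 1"] t_deriv[OF v], of C]
      bpair.has_vector_derivative[OF has_vector_derivative_const[of "e 1"] l_deriv[OF v], of C]
      bpair.has_vector_derivative[OF has_vector_derivative_const[of "e 1"] n_deriv[OF v], of C]
      bpair.has_vector_derivative[OF l_deriv[OF v] n_deriv[OF v], of C]
      bpair.has_vector_derivative[OF t_deriv[OF v] n_deriv[OF v], of C]
    by (simp_all add: has_real_derivative_iff_has_vector_derivative bpair.diff_right bpair.diff_left
        bpair.scaleR_right bpair.scaleR_left bpair.minus_right bpair.minus_left bpair.zero_left self)
qed

end

section \<open>The surface, its adapted frame and its Gauss map\<close>

locale meridian = spherical_curve J l n for J l n +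
  fixes I :: "real set" and f g :: "real \<Rightarrow> real"
  assumes open_I: "open I" and interval_I: "is_interval I" and I_nonempty: "I \<noteq> {}"
    and smooth_f: "smooth_on I f" and smooth_g: "smooth_on I g"
    and f_pos: "u \<in> I \<Longrightarrow> f u > 0"
    and unit_speed: "u \<in> I \<Longrightarrow> (deriv f u)\<^sup>2 + (deriv g u)\<^sup>2 = 1"
begin

abbreviation z where "z \<equiv> meridian_surface f g l"
abbreviation f1 where "f1 \<equiv> deriv f"
abbreviation f2 where "f2 \<equiv> deriv (deriv f)"
abbreviation f3 where "f3 \<equiv> deriv (deriv (deriv f))"
abbreviation g1 where "g1 \<equiv> deriv g"
abbreviation g2 where "g2 \<equiv> deriv (deriv g)"
abbreviation g3 where "g3 \<equiv> deriv (deriv (deriv g))"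

lemma smooth_meridian:
  "smooth_on I f1" "smooth_on I f2" "smooth_on I f3"
  "smooth_on I g1" "smooth_on I g2" "smooth_on I g3"
  by (intro smooth_on_deriv[OF open_I] smooth_f smooth_g)+

lemma meridian_derivs:
  assumes "u \<in> I"
  shows "(f has_real_derivative f1 u) (at u)" "(f1 has_real_derivative f2 u) (at u)"
    "(f2 has_real_derivative f3 u) (at u)"
    "(g has_real_derivative g1 u) (at u)" "(g1 has_real_derivative g2 u) (at u)"
    "(g2 has_real_derivative g3 u) (at u)"
  using assms smooth_f smooth_g smooth_meridian by (auto intro: smooth_on_DERIV)

lemma acceleration_orthogonal:
  assumes u: "u \<in> I"
  shows "f1 u * f2 u + g1 u * g2 u = 0"
proof -
  have "((\<lambda>s. (f1 s)\<^sup>2 + (g1 s)\<^sup>2) has_real_derivative 2 * (f1 u * f2 u + g1 u * g2 u)) (at u)"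
    by (auto intro!: derivative_eq_intros meridian_derivs[OF u])
  then have "((\<lambda>s. (f1 s)\<^sup>2 + (g1 s)\<^sup>2) has_vector_derivative 2 * (f1 u * f2 u + g1 u * g2 u)) (at u)"
    by (simp only: has_real_derivative_iff_has_vector_derivative)
  from has_vector_derivative_locally_const[OF open_I u unit_speed this] show ?thesis by simp
qed

lemma frame_x_eq: "u \<in> I \<Longrightarrow> frame_x z u v = f1 u *\<^sub>R l v + g1 u *\<^sub>R e 1"
  unfolding frame_x_def flat_x_def
  by (rule d_u_eqI[OF open_I, where H = "\<lambda>s. f s *\<^sub>R l v + g s *\<^sub>R e 1"])
    (auto simp: meridian_surface_def intro!: has_vector_derivative_add
      scaleR_has_vector_derivative_real meridian_derivs)

lemma d_v_z: "v \<in> J \<Longrightarrow> d_v z u v = f u *\<^sub>R t v"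
  by (rule d_v_eqI[OF open_J, where H = "\<lambda>s. f u *\<^sub>R l s + g u *\<^sub>R e 1"])
    (auto simp: meridian_surface_def intro!: derivative_eq_intros l_deriv)

lemma frame_y_eq: "u \<in> I \<Longrightarrow> v \<in> J \<Longrightarrow> frame_y f z u v = t v"
  using f_pos by (force simp: frame_y_def flat_y_def d_v_z)

lemma flat_x_frame_x: "u \<in> I \<Longrightarrow> flat_x (frame_x z) u v = f2 u *\<^sub>R l v + g2 u *\<^sub>R e 1"
  unfolding flat_x_def
  by (rule d_u_eqI[OF open_I _ frame_x_eq])
    (auto intro!: has_vector_derivative_add scaleR_has_vector_derivative_real meridian_derivs)

lemma flat_y_frame_y:
  assumes "u \<in> I" "v \<in> J"
  shows "flat_y f (frame_y f z) u v = (1 / f u) *\<^sub>R (- \<kappa> v *\<^sub>R n v - l v)"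
  unfolding flat_y_def
  using d_v_eqI[where F = "frame_y f z" and H = t and u = u, OF open_J assms(2) frame_y_eq[OF assms(1)] t_deriv]
    assms by simp

lemma tangent_products:
  assumes "u \<in> I" "v \<in> J"
  shows "mink (frame_x z u v) (frame_x z u v) = 1" "mink (frame_x z u v) (frame_y f z u v) = 0"
  using unit_speed[OF assms(1)]
  by (simp_all add: assms frame_x_eq frame_y_eq mink.add_left mink.add_right mink.scaleR_left
      mink.scaleR_right frame_products mink_e1_e1 power2_eq_square)

lemma tangential_flat_x:
  assumes "u \<in> I" "v \<in> J"
  shows "tangential f z (flat_x (frame_x z)) u v = 0"
  using acceleration_orthogonal[OF assms(1)]
  by (simp add: tangential_def flat_x_frame_x assms frame_x_eq frame_y_eq mink.add_left
      mink.add_right mink.scaleR_left mink.scaleR_right frame_products mink_e1_e1 mult.commute)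

lemma tangential_flat_y:
  assumes "u \<in> I" "v \<in> J"
  shows "tangential f z (flat_y f (frame_y f z)) u v = - (f1 u / f u) *\<^sub>R frame_x z u v"
  by (simp add: tangential_def flat_y_frame_y assms frame_x_eq frame_y_eq mink.add_left
      mink.add_right mink.scaleR_left mink.scaleR_right mink.diff_left mink.minus_left
      frame_products mink_e1_e1)

lemma gauss_map_eq:
  assumes "u \<in> I" "v \<in> J"
  shows "gauss_map f z u v = f1 u *\<^sub>R lt v + g1 u *\<^sub>R et v"
  by (simp add: gauss_map_def assms frame_x_eq frame_y_eq wedge.add_left wedge.scaleR_left)

lemma flat_x_gauss:
  assumes "u \<in> I" "v \<in> J"
  shows "flat_x (gauss_map f z) u v = f2 u *\<^sub>R lt v + g2 u *\<^sub>R et v"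
  unfolding flat_x_def
  by (rule d_u_eqI[OF open_I assms(1) gauss_map_eq])
    (auto intro!: has_vector_derivative_add scaleR_has_vector_derivative_real meridian_derivs assms)

lemma flat_x_flat_x_gauss:
  assumes "u \<in> I" "v \<in> J"
  shows "flat_x (flat_x (gauss_map f z)) u v = f3 u *\<^sub>R lt v + g3 u *\<^sub>R et v"
  by (subst flat_x_def, rule d_u_eqI[OF open_I assms(1) flat_x_gauss])
    (auto intro!: has_vector_derivative_add scaleR_has_vector_derivative_real meridian_derivs assms)

lemma flat_y_gauss:
  assumes "u \<in> I" "v \<in> J"
  shows "flat_y f (gauss_map f z) u v =
    (1 / f u) *\<^sub>R (f1 u *\<^sub>R (- \<kappa> v *\<^sub>R l_n v) + g1 u *\<^sub>R (- \<kappa> v *\<^sub>R en v - el v))"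
proof -
  have "d_v (gauss_map f z) u v = f1 u *\<^sub>R (- \<kappa> v *\<^sub>R l_n v) + g1 u *\<^sub>R (- \<kappa> v *\<^sub>R en v - el v)"
    by (rule d_v_eqI[where F = "gauss_map f z" and u = u, OF open_J assms(2) gauss_map_eq[OF assms(1)]])
      (assumption | intro has_vector_derivative_add wedge_derivs assms
        bounded_linear.has_vector_derivative[OF bounded_linear_scaleR_right])+
  then show ?thesis by (simp add: flat_y_def)
qed

lemma flat_y_flat_y_gauss:
  assumes "u \<in> I" "v \<in> J"
  shows "flat_y f (flat_y f (gauss_map f z)) u v =
    (1 / f u) *\<^sub>R (1 / f u) *\<^sub>R
      (f1 u *\<^sub>R (- \<kappa> v *\<^sub>R (tn v - \<kappa> v *\<^sub>R lt v) - \<kappa>' v *\<^sub>R l_n v) +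
       g1 u *\<^sub>R (- \<kappa> v *\<^sub>R (- \<kappa> v *\<^sub>R et v) - \<kappa>' v *\<^sub>R en v - et v))"
proof -
  note v = assms(2)
  have k: "((\<lambda>s. - \<kappa> s) has_real_derivative - \<kappa>' v) (at v)"
    by (intro DERIV_minus \<kappa>_deriv v)
  have 1: "((\<lambda>s. - \<kappa> s *\<^sub>R l_n s) has_vector_derivative
      - \<kappa> v *\<^sub>R (tn v - \<kappa> v *\<^sub>R lt v) - \<kappa>' v *\<^sub>R l_n v) (at v)"
    using has_vector_derivative_scaleR[OF k wedge_derivs(5)[OF v]] by simp
  have "((\<lambda>s. - \<kappa> s *\<^sub>R en s) has_vector_derivative
      - \<kappa> v *\<^sub>R (- \<kappa> v *\<^sub>R et v) - \<kappa>' v *\<^sub>R en v) (at v)"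
    using has_vector_derivative_scaleR[OF k wedge_derivs(4)[OF v]] by simp
  from has_vector_derivative_diff[OF this wedge_derivs(3)[OF v]]
  have 2: "((\<lambda>s. - \<kappa> s *\<^sub>R en s - el s) has_vector_derivative
      - \<kappa> v *\<^sub>R (- \<kappa> v *\<^sub>R et v) - \<kappa>' v *\<^sub>R en v - et v) (at v)" .
  have "d_v (flat_y f (gauss_map f z)) u v = (1 / f u) *\<^sub>R
      (f1 u *\<^sub>R (- \<kappa> v *\<^sub>R (tn v - \<kappa> v *\<^sub>R lt v) - \<kappa>' v *\<^sub>R l_n v) +
       g1 u *\<^sub>R (- \<kappa> v *\<^sub>R (- \<kappa> v *\<^sub>R et v) - \<kappa>' v *\<^sub>R en v - et v))"
    by (rule d_v_eqI[where F = "flat_y f (gauss_map f z)" and u = u, OF open_J v flat_y_gauss[OF assms(1)]])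
      (assumption | intro has_vector_derivative_add 1 2
        bounded_linear.has_vector_derivative[OF bounded_linear_scaleR_right])+
  then show ?thesis by (subst flat_y_def) simp
qed

text \<open>The meridians are geodesics, so the only first-order contribution comes from the
  Levi-Civita derivative of \<open>y\<close> along \<open>y\<close>, which is
  \<open>- (f'/f) x\<close>. The remaining terms are the second derivatives, sorted by basis
  bivectors.\<close>

lemma laplacian_gauss_map:
  assumes "u \<in> I" "v \<in> J"
  shows "laplacian f z (gauss_map f z) u v =
    (- f3 u - f1 u * f2 u / f u - f1 u * (\<kappa> v)\<^sup>2 / (f u)\<^sup>2) *\<^sub>R lt v +
    (- g3 u - f1 u * g2 u / f u - g1 u * ((\<kappa> v)\<^sup>2 - 1) / (f u)\<^sup>2) *\<^sub>R et v +
    (f1 u * \<kappa>' v / (f u)\<^sup>2) *\<^sub>R l_n v + (f1 u * \<kappa> v / (f u)\<^sup>2) *\<^sub>R tn v +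
    (g1 u * \<kappa>' v / (f u)\<^sup>2) *\<^sub>R en v"
proof -
  have "flat_along f z (tangential f z (flat_x (frame_x z))) (gauss_map f z) u v = 0"
    by (simp add: flat_along_def tangential_flat_x assms mink.zero_left)
  moreover have "flat_along f z (tangential f z (flat_y f (frame_y f z))) (gauss_map f z) u v =
      - (f1 u / f u) *\<^sub>R (f2 u *\<^sub>R lt v + g2 u *\<^sub>R et v)"
    by (simp add: flat_along_def tangential_flat_y assms mink.scaleR_left mink.minus_left
        tangent_products flat_x_gauss)
  ultimately have "laplacian f z (gauss_map f z) u v =
      - (f3 u *\<^sub>R lt v + g3 u *\<^sub>R et v)
      - (1 / f u) *\<^sub>R (1 / f u) *\<^sub>R
      (f1 u *\<^sub>R (- \<kappa> v *\<^sub>R (tn v - \<kappa> v *\<^sub>R lt v) - \<kappa>' v *\<^sub>R l_n v) +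
       g1 u *\<^sub>R (- \<kappa> v *\<^sub>R (- \<kappa> v *\<^sub>R et v) - \<kappa>' v *\<^sub>R en v - et v))
      - (f1 u / f u) *\<^sub>R (f2 u *\<^sub>R lt v + g2 u *\<^sub>R et v)"
    by (simp add: laplacian_def flat_x_flat_x_gauss flat_y_flat_y_gauss assms)
  then show ?thesis
    by (simp add: vec_eq_iff divide_inverse power2_eq_square algebra_simps)
qed

text \<open>Pair both sides with the six basis bivectors. Those containing \<open>n\<close> have
  square -1, whence the minus signs on the left. The last equation has zero on one side because the
  Laplacian has no part along e 1 \<and> l.\<close>

lemma gauss_map_components:
  assumes "u \<in> I" "v \<in> J"
    and eq: "laplacian f z (gauss_map f z) u v = \<mu> *\<^sub>R (gauss_map f z u v + C)"
  shows "- f3 u - f1 u * f2 u / f u - f1 u * (\<kappa> v)\<^sup>2 / (f u)\<^sup>2 = \<mu> * (f1 u + bpair C (l v) (t v))"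
    and "- g3 u - f1 u * g2 u / f u - g1 u * ((\<kappa> v)\<^sup>2 - 1) / (f u)\<^sup>2 =
      \<mu> * (g1 u + bpair C (e 1) (t v))"
    and "- (f1 u * \<kappa>' v / (f u)\<^sup>2) = \<mu> * bpair C (l v) (n v)"
    and "- (f1 u * \<kappa> v / (f u)\<^sup>2) = \<mu> * bpair C (t v) (n v)"
    and "- (g1 u * \<kappa>' v / (f u)\<^sup>2) = \<mu> * bpair C (e 1) (n v)"
    and "\<mu> * bpair C (e 1) (l v) = 0"
proof -
  have "bpair (laplacian f z (gauss_map f z) u v) p q = \<mu> * (bpair (gauss_map f z u v) p q + bpair C p q)"
    for p q
    unfolding eq by (simp add: bpair_scaleR bpair_add)
  note this[unfolded laplacian_gauss_map[OF assms(1,2)] gauss_map_eq[OF assms(1,2)] bpair_scaleR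
      bpair_add bpair_wedge]
  note * = this[of "l v" "t v"] this[of "e 1" "t v"] this[of "l v" "n v"] this[of "t v" "n v"]
    this[of "e 1" "n v"] this[of "e 1" "l v"]
  show "- f3 u - f1 u * f2 u / f u - f1 u * (\<kappa> v)\<^sup>2 / (f u)\<^sup>2 = \<mu> * (f1 u + bpair C (l v) (t v))"
    and "- g3 u - f1 u * g2 u / f u - g1 u * ((\<kappa> v)\<^sup>2 - 1) / (f u)\<^sup>2 =
      \<mu> * (g1 u + bpair C (e 1) (t v))"
    and "- (f1 u * \<kappa>' v / (f u)\<^sup>2) = \<mu> * bpair C (l v) (n v)"
    and "- (f1 u * \<kappa> v / (f u)\<^sup>2) = \<mu> * bpair C (t v) (n v)"
    and "- (g1 u * \<kappa>' v / (f u)\<^sup>2) = \<mu> * bpair C (e 1) (n v)"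
    and "\<mu> * bpair C (e 1) (l v) = 0"
    using * unfolding frame_products[OF assms(2)] mink_e1_e1 by simp_all
qed

text \<open>Here \<psi> is \<open>f^2\<close> times \<lambda>, and the three equations are the
  coefficients of l \<and> t, e 1 \<and> t and t \<and> n, cleared of denominators. With \<kappa>
  constant no other coefficients remain.\<close>

lemma second_kindI:
  assumes \<kappa>: "\<And>v. v \<in> J \<Longrightarrow> \<kappa> v = k" and c: "c \<noteq> 0"
    and \<psi>: "smooth_on I \<psi>" "\<And>u. u \<in> I \<Longrightarrow> \<psi> u \<noteq> 0"
    and lt: "\<And>u. u \<in> I \<Longrightarrow> \<psi> u * (f1 u + c) = - (f u)\<^sup>2 * f3 u - f u * f1 u * f2 u - f1 u * k\<^sup>2"
    and et: "\<And>u. u \<in> I \<Longrightarrow> \<psi> u * g1 u = - (f u)\<^sup>2 * g3 u - f u * f1 u * g2 u - g1 u * (k\<^sup>2 - 1)"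
    and tn: "\<And>u. u \<in> I \<Longrightarrow> \<psi> u * (- k * c) = f1 u * k"
  shows "pointwise_1_type_second_kind I J f z"
proof -
  \<comment> \<open>Differentiation gives the factor \<open>k - \<kappa>\<close> times l \<and> n,
    so for constant curvature this moving expression is a constant bivector. It becomes
    \<open>C\<close>.\<close>
  define W where "W v = c *\<^sub>R (lt v - k *\<^sub>R tn v)" for v
  have "(W has_vector_derivative 0) (at v within J)" if v: "v \<in> J" for v
  proof -
    have "(W has_vector_derivative c *\<^sub>R (- \<kappa> v *\<^sub>R l_n v - k *\<^sub>R (- l_n v))) (at v)"
      unfolding W_def
      by (intro bounded_linear.has_vector_derivative[OF bounded_linear_scaleR_right]
          has_vector_derivative_diff wedge_derivs v)
    then show ?thesis
      using \<kappa>[OF v] by (simp add: has_vector_derivative_at_within)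
  qed
  then obtain C where C: "\<And>v. v \<in> J \<Longrightarrow> W v = C"
    using has_vector_derivative_zero_constant[of J W] interval_J is_interval_convex by blast
  obtain v0 where v0: "v0 \<in> J" using J_nonempty by blast
  have "bpair C (l v0) (t v0) = c"
    by (simp add: C[OF v0, symmetric] W_def bpair_scaleR bpair_add[of _ "- M" for M, simplified]
        bpair_scaleR[of "-1", simplified] bpair_wedge frame_products[OF v0])
  then have "C \<noteq> 0"
    using c by (auto simp: bpair_def)
  moreover have "C \<in> bivectors"
    unfolding C[OF v0, symmetric] W_def
    using wedge_bivector unfolding bivectors_def by (intro span_mul span_diff)
  moreover have "\<forall>u\<in>I. f u \<noteq> 0" using f_pos by force
  then have "smooth_on (I \<times> J) (\<lambda>q. \<psi> (fst q) / (f (fst q))\<^sup>2)"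
    by (intro smooth_on_compose_fst[of I J "\<lambda>u. \<psi> u / (f u)\<^sup>2"] open_I open_J smooth_on_divide
        smooth_on_power \<psi> smooth_f) simp
  then have "smooth_on (I \<times> J) (\<lambda>(u, v). \<psi> u / (f u)\<^sup>2)"
    by (simp add: case_prod_beta')
  moreover have "\<psi> u / (f u)\<^sup>2 \<noteq> 0 \<and>
      laplacian f z (gauss_map f z) u v = (\<psi> u / (f u)\<^sup>2) *\<^sub>R (gauss_map f z u v + C)"
    if u: "u \<in> I" and v: "v \<in> J" for u v
  proof -
    have "f u \<noteq> 0" using f_pos[OF u] by simp
    have "(\<kappa>' v) = 0"
      using has_vector_derivative_locally_const[OF open_J v \<kappa>] \<kappa>_deriv[OF v]
      by (simp add: has_real_derivative_iff_has_vector_derivative)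
    moreover have "- f3 u - f1 u * f2 u / f u - f1 u * k\<^sup>2 / (f u)\<^sup>2 = \<psi> u / (f u)\<^sup>2 * (f1 u + c)"
      using \<open>f u \<noteq> 0\<close>
      by (subst times_divide_eq_left, subst lt[OF u]) (simp add: field_simps power2_eq_square)
    moreover have "- g3 u - f1 u * g2 u / f u - g1 u * (k\<^sup>2 - 1) / (f u)\<^sup>2 = \<psi> u / (f u)\<^sup>2 * g1 u"
      using \<open>f u \<noteq> 0\<close>
      by (subst times_divide_eq_left, subst et[OF u]) (simp add: field_simps power2_eq_square)
    moreover have "f1 u * k / (f u)\<^sup>2 = \<psi> u / (f u)\<^sup>2 * (- k * c)"
      by (simp only: tn[OF u] times_divide_eq_left)
    ultimately have "laplacian f z (gauss_map f z) u v =
        (\<psi> u / (f u)\<^sup>2 * (f1 u + c)) *\<^sub>R lt v + (\<psi> u / (f u)\<^sup>2 * g1 u) *\<^sub>R et v +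
        (\<psi> u / (f u)\<^sup>2 * (- k * c)) *\<^sub>R tn v"
      using \<kappa>[OF v] by (simp add: laplacian_gauss_map u v)
    also have "\<dots> = (\<psi> u / (f u)\<^sup>2) *\<^sub>R (gauss_map f z u v + C)"
      by (simp add: gauss_map_eq u v C[OF v, symmetric] W_def algebra_simps add_divide_distrib)
    finally show ?thesis using \<psi>(2)[OF u] \<open>f u \<noteq> 0\<close> by simp
  qed
  ultimately show ?thesis
    unfolding pointwise_1_type_second_kind_def
    by (intro exI[of _ "\<lambda>u v. \<psi> u / (f u)\<^sup>2"] bexI[of _ C]) blast+
qed

end

section \<open>Meridians that are straight lines\<close>

lemma mink_eq_inner_flip: "mink p q = flip q \<bullet> p"
  by (simp add: mink_def flip_def inner_vec_def sum_4 algebra_simps)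

lemma mink_hyperplane:
  assumes "\<nu> \<noteq> 0"
  shows "affine {p. mink p \<nu> = r}" "aff_dim {p. mink p \<nu> = r} = 3"
proof -
  have "flip \<nu> \<noteq> 0"
    using assms by (auto simp: vec_eq_iff flip_def) (metis minus_equation_iff neg_equal_0_iff_equal)
  then show "affine {p. mink p \<nu> = r}" "aff_dim {p. mink p \<nu> = r} = 3"
    by (simp_all add: mink_eq_inner_flip affine_hyperplane)
qed

text \<open>Cauchy-Schwarz for the spatial parts: orthogonality bounds
  \<open>(w$4)^2 (\<nu>$4)^2\<close> by the product \<open>x * y\<close> of their squared lengths,
  and \<open>y < (\<nu>$4)^2\<close> because \<nu> is timelike.\<close>

lemma timelike_complement_spacelike:
  assumes \<nu>: "mink \<nu> \<nu> < 0" and "mink w \<nu> = 0" "w \<noteq> 0"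
  shows "mink w w > 0"
proof -
  define x y where "x = w$1 * w$1 + w$2 * w$2 + w$3 * w$3"
    and "y = \<nu>$1 * \<nu>$1 + \<nu>$2 * \<nu>$2 + \<nu>$3 * \<nu>$3"
  have "0 \<le> x" "0 \<le> y" by (simp_all add: x_def y_def)
  have y: "y < (\<nu>$4)\<^sup>2"
    using \<nu> by (simp add: mink_def y_def power2_eq_square)
  have w4: "w$4 * \<nu>$4 = w$1 * \<nu>$1 + w$2 * \<nu>$2 + w$3 * \<nu>$3"
    using assms(2) by (simp add: mink_def)
  have "(w$4 * \<nu>$4)\<^sup>2 \<le> x * y"
  proof -
    \<comment> \<open>Lagrange's identity in three dimensions.\<close>
    have "x * y - (w$4 * \<nu>$4)\<^sup>2 = (w$1 * \<nu>$2 - w$2 * \<nu>$1)\<^sup>2 + (w$1 * \<nu>$3 - w$3 * \<nu>$1)\<^sup>2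
        + (w$2 * \<nu>$3 - w$3 * \<nu>$2)\<^sup>2"
      unfolding w4 x_def y_def by (simp add: power2_eq_square algebra_simps)
    then show ?thesis by (smt (verit) zero_le_power2)
  qed
  have "\<nu>$4 \<noteq> 0" using y \<open>0 \<le> y\<close> by auto
  have "x \<noteq> 0"
  proof
    assume "x = 0"
    then have "w$1 = 0" "w$2 = 0" "w$3 = 0"
      unfolding x_def by (smt (verit) mult_eq_0_iff zero_le_square)+
    moreover from this have "w$4 = 0" using w4 \<open>\<nu>$4 \<noteq> 0\<close> by simp
    ultimately show False using \<open>w \<noteq> 0\<close> by (simp add: vec_eq_iff forall_4)
  qed
  then have "x * y < x * (\<nu>$4)\<^sup>2"
    using y \<open>0 \<le> x\<close> by simp
  then have "(w$4)\<^sup>2 * (\<nu>$4)\<^sup>2 < x * (\<nu>$4)\<^sup>2"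
    using \<open>(w$4 * \<nu>$4)\<^sup>2 \<le> x * y\<close> by (simp add: power_mult_distrib)
  then have "(w$4)\<^sup>2 < x"
    using mult_less_cancel_right_pos[of "(\<nu>$4)\<^sup>2"] \<open>\<nu>$4 \<noteq> 0\<close> by simp
  then show ?thesis by (simp add: mink_def x_def power2_eq_square)
qed

lemma deriv_eqI_open:
  fixes f :: "real \<Rightarrow> real"
  assumes "open S" "x \<in> S" "\<And>y. y \<in> S \<Longrightarrow> f y = h y" "(h has_real_derivative D) (at x)"
  shows "deriv f x = D"
  using has_field_derivative_transform_within_open[OF assms(4,1,2)] assms(3)
  by (simp add: DERIV_imp_deriv)

lemma affine_deriv:
  fixes f :: "real \<Rightarrow> real"
  assumes "open S" "x \<in> S" "\<And>y. y \<in> S \<Longrightarrow> f y = a * y + c"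
  shows "deriv f x = a"
  by (rule deriv_eqI_open[OF assms]) (auto intro!: derivative_eq_intros)

lemma const_deriv:
  fixes f :: "real \<Rightarrow> real"
  assumes "open S" "x \<in> S" "\<And>y. y \<in> S \<Longrightarrow> f y = c"
  shows "deriv f x = 0"
  using affine_deriv[of S x f 0 c] assms by simp

lemma interval_constI:
  fixes h :: "real \<Rightarrow> real"
  assumes "is_interval S" "\<And>x. x \<in> S \<Longrightarrow> (h has_real_derivative 0) (at x)"
  obtains c where "\<And>x. x \<in> S \<Longrightarrow> h x = c"
  using has_field_derivative_zero_constant[of S h] assms is_interval_convex
    has_field_derivative_at_within by blast

context meridian begin

lemma case_affine_derivs:
  assumes "case_affine_line I J f g \<kappa> k a a1 b b1" "u \<in> I"
  shows "f1 u = a" "f2 u = 0" "f3 u = 0" "g1 u = b" "g2 u = 0" "g3 u = 0"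
proof -
  have *: "f1 s = a" "g1 s = b" if "s \<in> I" for s
    using assms(1) that by (auto simp: case_affine_line_def intro!: affine_deriv[OF open_I])
  then have **: "f2 s = 0" "g2 s = 0" if "s \<in> I" for s
    using that by (auto intro!: const_deriv[OF open_I])
  then show "f1 u = a" "f2 u = 0" "f3 u = 0" "g1 u = b" "g2 u = 0" "g3 u = 0"
    using * assms(2) by (auto intro!: const_deriv[OF open_I])
qed

lemma case_affine_second_kind:
  assumes cas: "case_affine_line I J f g \<kappa> k a a1 b b1" and "a \<noteq> 0" "k \<noteq> 1" "k \<noteq> -1"
  shows "pointwise_1_type_second_kind I J f z"
proof -
  have k: "k\<^sup>2 - 1 \<noteq> 0" using assms by (simp add: power2_eq_1_iff)
  show ?thesis
  \<comment> \<open>On a line all higher derivatives vanish: the e 1 \<and> t equation suggests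
    \<open>1 - k^2\<close> for \<psi>, and the t \<and> n equation then suggests
    \<open>c = - a / \<psi>\<close>. Thus \<psi> is non-zero by
    \<open>k \<noteq> \<plusminus>1\<close> and \<open>c\<close> by
    \<open>a \<noteq> 0\<close>.\<close>
  proof (rule second_kindI[where k = k and c = "a / (k\<^sup>2 - 1)" and \<psi> = "\<lambda>_. 1 - k\<^sup>2"])
    show "\<kappa> v = k" if "v \<in> J" for v
      using cas that by (simp add: case_affine_line_def)
  qed (use k \<open>a \<noteq> 0\<close> in \<open>auto simp: case_affine_derivs[OF cas] smooth_on_const field_simps\<close>)
qed

text \<open>The slope of \<open>f\<close> is \<epsilon> = \<plusminus>1 and that of \<open>g\<close>
  is 0, so \<open>k^2 - b^2\<close> for the affine line becomes \<open>k^2 > 0\<close>. The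
  constants \<open>a\<close> and \<open>b\<close> of the radial case move to the places of
  \<open>a1\<close> and \<open>b1\<close>.\<close>

lemma case_radial_imp_affine:
  assumes "case_radial_line I J f g \<kappa> k a b"
  obtains \<epsilon> where "case_affine_line I J f g \<kappa> k \<epsilon> a 0 b" "\<epsilon> \<noteq> 0" "k \<noteq> 0" "k \<noteq> 1" "k \<noteq> -1"
  using assms that[of 1] that[of "-1"] by (auto simp: case_radial_line_def case_affine_line_def)

text \<open>The given parametrisation is already ruled, \<open>z u v = c v + u w v\<close>, so the
  identity serves as \<phi>. The tangent plane is spanned by \<open>w v\<close> and
  \<open>t v\<close>, neither of which depends on \<open>u\<close>.\<close>

lemma case_affine_developable:
  assumes cas: "case_affine_line I J f g \<kappa> k a a1 b b1"
  shows "developable_ruled (I \<times> J) z"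
proof -
  define c w where "c v = a1 *\<^sub>R l v + b1 *\<^sub>R e 1" and "w v = a *\<^sub>R l v + b *\<^sub>R e 1" for v
  have snd: "snd ` (I \<times> J) = J" using I_nonempty by force
  have "smooth_on D (\<lambda>q::real \<times> real. q)" for D
    by (rule smooth_on_bounded_linear[OF bounded_linear_ident])
  then have 1: "diffeo_between (I \<times> J) (I \<times> J) (\<lambda>q. q)"
    unfolding diffeo_between_def by (intro exI[of _ "\<lambda>q. q"]) auto
  have 2: "connected {s. (s, v) \<in> I \<times> J}" for v
    using interval_I is_interval_connected by (cases "v \<in> J") auto
  have 3: "smooth_on J c" "smooth_on J w"
    unfolding c_def w_def
    by (rule smooth_on_add[OF open_J smooth_on_linear_compose[OF open_J bounded_linear_scaleR_right smooth_l]
          smooth_on_const])+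
  have x: "d_u z u v = w v" if "u \<in> I" for u v
    using frame_x_eq[OF that] case_affine_derivs[OF cas that]
    by (simp add: frame_x_def flat_x_def w_def)
  have "mink (w v) (w v) = 1" if "v \<in> J" for v
    using cas by (simp add: w_def mink.add_left mink.add_right mink.scaleR_left mink.scaleR_right
        frame_products[OF that] mink_e1_e1 case_affine_line_def power2_eq_square)
  then have 4: "w v \<noteq> 0" if "v \<in> J" for v
    using that mink.zero_left by (metis zero_neq_one)
  have 5: "z u v = c v + u *\<^sub>R w v" if "u \<in> I" for u v
    using cas that by (simp add: meridian_surface_def c_def w_def case_affine_line_def algebra_simps)
  have plane: "tangent_plane z (u, v) = span {w v, t v}" if "u \<in> I" "v \<in> J" for u v
  proof -
    have "f u \<noteq> 0" using f_pos[OF that(1)] by simp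
    have "span {w v, f u *\<^sub>R t v} = span {w v, t v}"
      unfolding span_eq
    proof
      have "(1 / f u) *\<^sub>R (f u *\<^sub>R t v) \<in> span {w v, f u *\<^sub>R t v}"
        by (intro span_mul span_base) simp
      then show "{w v, t v} \<subseteq> span {w v, f u *\<^sub>R t v}"
        using \<open>f u \<noteq> 0\<close> by (simp add: span_base)
      show "{w v, f u *\<^sub>R t v} \<subseteq> span {w v, t v}"
        by (auto intro: span_base span_mul)
    qed
    then show ?thesis by (simp add: tangent_plane_def x d_v_z that)
  qed
  have 6: "\<forall>(u, v)\<in>I \<times> J. w v \<noteq> 0 \<and> (case (u, v) of (u, v) \<Rightarrow> z u v) = c v + u *\<^sub>R w v"
    using 4 5 by auto
  have 7: "\<forall>u u' v. (u, v) \<in> I \<times> J \<longrightarrow> (u', v) \<in> I \<times> J \<longrightarrow>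
      tangent_plane z (u, v) = tangent_plane z (u', v)"
    using plane by (metis mem_Sigma_iff)
  have "open (I \<times> J) \<and> diffeo_between (I \<times> J) (I \<times> J) (\<lambda>q. q) \<and>
      (\<forall>v. connected {s. (s, v) \<in> I \<times> J}) \<and>
      smooth_on (snd ` (I \<times> J)) c \<and> smooth_on (snd ` (I \<times> J)) w \<and>
      (\<forall>(u, v)\<in>I \<times> J. w v \<noteq> 0 \<and> (case (u, v) of (u, v) \<Rightarrow> z u v) = c v + u *\<^sub>R w v) \<and>
      (\<forall>u u' v. (u, v) \<in> I \<times> J \<longrightarrow> (u', v) \<in> I \<times> J \<longrightarrow>
        tangent_plane z (u, v) = tangent_plane z (u', v))"
    unfolding snd using 1 2 3 6 7 open_Times[OF open_I open_J] by blast
  then show ?thesis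
    unfolding developable_ruled_def by blast
qed

lemma case_affine_mean_curvature:
  assumes cas: "case_affine_line I J f g \<kappa> k a a1 b b1" and "u \<in> I" "v \<in> J"
  shows "mean_curvature f z u v =
    (1 / (2 * f u)) *\<^sub>R (- k *\<^sub>R n v - b\<^sup>2 *\<^sub>R l v + (a * b) *\<^sub>R e 1)"
proof -
  have "a\<^sup>2 + b\<^sup>2 = 1" "\<kappa> v = k" using assms by (auto simp: case_affine_line_def)
  then have ab: "a * a = 1 - b * b" by (simp add: power2_eq_square)
  note der = case_affine_derivs[OF cas assms(2)]
  have nx: "normal_part f z (flat_x (frame_x z)) u v = 0"
    by (simp add: normal_part_def tangential_flat_x flat_x_frame_x assms der)
  have "normal_part f z (flat_y f (frame_y f z)) u v =
      (1 / f u) *\<^sub>R (- k *\<^sub>R n v - l v) + (a / f u) *\<^sub>R (a *\<^sub>R l v + b *\<^sub>R e 1)"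
    by (simp add: normal_part_def tangential_flat_y flat_y_frame_y frame_x_eq assms der \<open>\<kappa> v = k\<close>)
  also have "\<dots> = (1 / f u) *\<^sub>R (- k *\<^sub>R n v - l v + (a * a) *\<^sub>R l v + (a * b) *\<^sub>R e 1)"
    by (simp add: algebra_simps)
  also have "\<dots> = (1 / f u) *\<^sub>R (- k *\<^sub>R n v - b\<^sup>2 *\<^sub>R l v + (a * b) *\<^sub>R e 1)"
    unfolding ab by (simp add: algebra_simps power2_eq_square)
  finally show ?thesis by (simp add: mean_curvature_def nx)
qed

text \<open>\<open>m\<close> is \<open>2 f\<close> times the mean curvature vector. The computation
  is used again for the Lorentzian hyperplane, where \<open>m\<close> supplies the timelike
  direction.\<close>

lemma mean_curvature_norm:
  fixes a b k :: real
  assumes v: "v \<in> J" and "a\<^sup>2 + b\<^sup>2 = 1"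
  defines "m \<equiv> - k *\<^sub>R n v - b\<^sup>2 *\<^sub>R l v + (a * b) *\<^sub>R e 1"
  shows "mink m m = b\<^sup>2 - k\<^sup>2"
proof -
  have "mink m m = b\<^sup>2 * (a\<^sup>2 + b\<^sup>2) - k\<^sup>2"
    by (simp add: m_def mink.add_left mink.add_right mink.scaleR_left mink.scaleR_right
        mink.diff_left mink.diff_right mink.minus_left mink.minus_right
        frame_products[OF v] mink_e1_e1 power2_eq_square algebra_simps)
  then show ?thesis using assms(2) by simp
qed

lemma case_affine_marginally_trapped:
  assumes cas: "case_affine_line I J f g \<kappa> k a a1 b b1" and k: "k\<^sup>2 = b\<^sup>2" "b \<noteq> 0"
  shows "marginally_trapped I J f z"
  unfolding marginally_trapped_def
proof (intro ballI conjI)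
  fix u v assume u: "u \<in> I" and v: "v \<in> J"
  define m where "m = - k *\<^sub>R n v - b\<^sup>2 *\<^sub>R l v + (a * b) *\<^sub>R e 1"
  have H: "mean_curvature f z u v = (1 / (2 * f u)) *\<^sub>R m"
    unfolding m_def by (rule case_affine_mean_curvature[OF cas u v])
  have "a\<^sup>2 + b\<^sup>2 = 1" using cas by (simp add: case_affine_line_def)
  then have "mink m m = 0"
    using mean_curvature_norm[OF v] k by (simp add: m_def)
  then show "mink (mean_curvature f z u v) (mean_curvature f z u v) = 0"
    by (simp add: H mink.scaleR_left mink.scaleR_right)
  \<comment> \<open>Since \<open>m\<close> is null, its norm cannot show that it is non-zero; its
    component along \<open>n\<close> does.\<close>
  have "mink m (n v) = k"
    by (simp add: m_def mink.add_left mink.diff_left mink.scaleR_left mink.minus_left frame_products[OF v])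
  then have "m \<noteq> 0" using k mink.zero_left by force
  then show "mean_curvature f z u v \<noteq> 0"
    using f_pos[OF u] by (simp add: H)
qed

text \<open>Pairing \<open>z\<close> with the normal gives \<open>k (b f - a g)\<close>, in which
  the terms with \<open>u\<close> cancel along the line. The explicit form of \<nu> is exported
  because an orthonormal basis of its complement is needed later.\<close>

lemma case_affine_hyperplane:
  assumes cas: "case_affine_line I J f g \<kappa> k a a1 b b1"
  obtains \<nu> r v0 where "lies_in I J z {p. mink p \<nu> = r}" "mink \<nu> \<nu> = k\<^sup>2 - b\<^sup>2"
    "v0 \<in> J" "\<nu> = b *\<^sub>R n v0 + k *\<^sub>R (b *\<^sub>R l v0 - a *\<^sub>R e 1)"
proof -
  have ab: "a\<^sup>2 + b\<^sup>2 = 1" and \<kappa>: "\<And>v. v \<in> J \<Longrightarrow> \<kappa> v = k"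
    and f: "\<And>u. u \<in> I \<Longrightarrow> f u = a * u + a1" and g: "\<And>u. u \<in> I \<Longrightarrow> g u = b * u + b1"
    using cas by (auto simp: case_affine_line_def)
  define N where "N v = b *\<^sub>R n v + k *\<^sub>R (b *\<^sub>R l v - a *\<^sub>R e 1)" for v
  have "(N has_vector_derivative 0) (at v within J)" if v: "v \<in> J" for v
  proof -
    have "(N has_vector_derivative b *\<^sub>R (- \<kappa> v *\<^sub>R t v) + k *\<^sub>R (b *\<^sub>R t v - 0)) (at v)"
      unfolding N_def
      by (intro has_vector_derivative_add has_vector_derivative_diff has_vector_derivative_const
          bounded_linear.has_vector_derivative[OF bounded_linear_scaleR_right] n_deriv l_deriv v)
    then show ?thesis
      using \<kappa>[OF v] by (simp add: has_vector_derivative_at_within algebra_simps)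
  qed
  then obtain \<nu> where \<nu>: "\<And>v. v \<in> J \<Longrightarrow> N v = \<nu>"
    using has_vector_derivative_zero_constant[of J N] interval_J is_interval_convex by blast
  obtain v0 where v0: "v0 \<in> J" using J_nonempty by blast
  have "mink (z u v) \<nu> = k * (b * a1 - a * b1)" if "u \<in> I" "v \<in> J" for u v
  proof -
    have "mink (z u v) \<nu> = k * (b * f u - a * g u)"
      unfolding \<nu>[OF that(2), symmetric] N_def meridian_surface_def
      by (simp add: mink.add_left mink.add_right mink.scaleR_left mink.scaleR_right
          mink.diff_right frame_products[OF that(2)] mink_e1_e1 algebra_simps)
    then show ?thesis by (simp add: f g that algebra_simps)
  qed
  then have "lies_in I J z {p. mink p \<nu> = k * (b * a1 - a * b1)}"
    by (simp add: lies_in_def)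
  moreover have "mink \<nu> \<nu> = k\<^sup>2 * (a\<^sup>2 + b\<^sup>2) - b\<^sup>2"
    unfolding \<nu>[OF v0, symmetric] N_def
    by (simp add: mink.add_left mink.add_right mink.scaleR_left mink.scaleR_right
        mink.diff_left mink.diff_right frame_products[OF v0] mink_e1_e1 power2_eq_square algebra_simps)
  ultimately show ?thesis
    using that v0 \<nu>[OF v0, symmetric] ab by (simp add: N_def)
qed

lemma case_affine_E3:
  assumes cas: "case_affine_line I J f g \<kappa> k a a1 b b1" and "k\<^sup>2 - b\<^sup>2 < 0"
  shows "\<exists>P. hyperplane_E3 P \<and> lies_in I J z P"
proof -
  obtain \<nu> r v0 where lies: "lies_in I J z {p. mink p \<nu> = r}" and \<nu>: "mink \<nu> \<nu> = k\<^sup>2 - b\<^sup>2"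
    by (rule case_affine_hyperplane[OF cas])
  have "\<nu> \<noteq> 0" using \<nu> assms(2) mink.zero_left by force
  have "mink (p - q) (p - q) > 0" if "mink p \<nu> = r" "mink q \<nu> = r" "p \<noteq> q" for p q
    using that \<nu> assms(2) by (intro timelike_complement_spacelike[of \<nu>]) (simp_all add: mink.diff_left)
  then have "hyperplane_E3 {p. mink p \<nu> = r}"
    by (simp add: hyperplane_E3_def mink_hyperplane[OF \<open>\<nu> \<noteq> 0\<close>])
  then show ?thesis using lies by blast
qed

lemma case_affine_E31:
  assumes cas: "case_affine_line I J f g \<kappa> k a a1 b b1" and pos: "k\<^sup>2 - b\<^sup>2 > 0"
  shows "\<exists>P. hyperplane_E31 P \<and> lies_in I J z P"
proof -
  have ab: "a\<^sup>2 + b\<^sup>2 = 1"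
    using cas by (auto simp: case_affine_line_def)
  obtain \<nu> r v0 where lies: "lies_in I J z {p. mink p \<nu> = r}" and \<nu>: "mink \<nu> \<nu> = k\<^sup>2 - b\<^sup>2"
    and v0: "v0 \<in> J" and \<nu>_eq: "\<nu> = b *\<^sub>R n v0 + k *\<^sub>R (b *\<^sub>R l v0 - a *\<^sub>R e 1)"
    by (rule case_affine_hyperplane[OF cas])
  have "\<nu> \<noteq> 0" using \<nu> assms(2) mink.zero_left by force
  obtain u0 where u0: "u0 \<in> I" using I_nonempty by blast
  \<comment> \<open>An orthonormal basis of the hyperplane direction: the tangent vectors
    \<open>x\<close> and \<open>t v0\<close>, and the multiple of the mean curvature vector
    \<open>m\<close> by \<open>s\<close>. As \<open>mink m m = b^2 - k^2 < 0\<close>, the factor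
    \<open>s\<close> normalises it to square -1.\<close>
  define x m where "x = a *\<^sub>R l v0 + b *\<^sub>R e 1"
    and "m = - k *\<^sub>R n v0 - b\<^sup>2 *\<^sub>R l v0 + (a * b) *\<^sub>R e 1"
  define s where "s = 1 / sqrt (k\<^sup>2 - b\<^sup>2)"
  note expand = mink.add_left mink.add_right mink.scaleR_left mink.scaleR_right mink.minus_left
    mink.minus_right mink.diff_left mink.diff_right frame_products[OF v0] mink_e1_e1
  have mm: "mink m m = b\<^sup>2 - k\<^sup>2"
    unfolding m_def by (rule mean_curvature_norm[OF v0 ab])
  have "s * s * (b\<^sup>2 - k\<^sup>2) = -1"
    using pos by (simp add: s_def field_simps)
  then have orthonormal: "mink x x = 1" "mink (t v0) (t v0) = 1" "mink (s *\<^sub>R m) (s *\<^sub>R m) = -1"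
    "mink x (t v0) = 0" "mink x (s *\<^sub>R m) = 0" "mink (t v0) (s *\<^sub>R m) = 0"
    using ab by (simp_all add: mink.scaleR_left mink.scaleR_right mm)
      (simp_all add: x_def m_def expand power2_eq_square)
  have "mink m \<nu> = k * b * (1 - (a\<^sup>2 + b\<^sup>2))"
    by (simp add: \<nu>_eq m_def expand power2_eq_square algebra_simps)
  then have "mink (s *\<^sub>R m) \<nu> = 0"
    using ab by (simp add: mink.scaleR_left)
  moreover have "mink x \<nu> = 0" "mink (t v0) \<nu> = 0"
    by (simp_all add: \<nu>_eq x_def expand)
  ultimately have "z u0 v0 + x \<in> {p. mink p \<nu> = r}" "z u0 v0 + t v0 \<in> {p. mink p \<nu> = r}"
    "z u0 v0 + s *\<^sub>R m \<in> {p. mink p \<nu> = r}" "z u0 v0 \<in> {p. mink p \<nu> = r}"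
    using lies u0 v0 by (auto simp: lies_in_def mink.add_left)
  then have "hyperplane_E31 {p. mink p \<nu> = r}"
    unfolding hyperplane_E31_def using orthonormal mink_hyperplane[OF \<open>\<nu> \<noteq> 0\<close>] by blast
  then show ?thesis using lies by blast
qed

end

section \<open>Continuation of the differential equation\<close>

text \<open>\<open>T\<close> need only accumulate at \<open>x\<close>, so that a relation known on
  one side of \<open>x\<close> already determines the derivative there.\<close>

lemma DERIV_eq_0_if_const_within:
  fixes h :: "real \<Rightarrow> real"
  assumes "(h has_real_derivative D) (at x)" "x islimpt T" "h x = 0" "\<And>y. y \<in> T \<Longrightarrow> h y = 0"
  shows "D = 0"
proof -
  have "((\<lambda>y. (h y - h x) / (y - x)) \<longlongrightarrow> D) (at x within T)"
    using has_field_derivative_subset[OF assms(1), of T] by (simp add: has_field_derivative_iff)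
  moreover have "\<forall>\<^sub>F y in at x within T. (h y - h x) / (y - x) = 0"
    by (simp add: eventually_at_filter assms)
  then have "((\<lambda>y. (h y - h x) / (y - x)) \<longlongrightarrow> 0) (at x within T)"
    by (rule tendsto_eventually)
  ultimately show ?thesis
    using assms(2) tendsto_unique trivial_limit_within by blast
qed

text \<open>The integrating factor \<open>exp (M s)\<close> or \<open>exp (- M s)\<close> makes the
  product with \<open>h\<close> monotone in the direction that bounds \<open>h x\<close> by the
  value 0 at \<open>y\<close>. Both orientations are treated since the limit point may lie on either
  side.\<close>

lemma gronwall_zero:
  fixes h h' :: "real \<Rightarrow> real"
  assumes der: "\<And>s. s \<in> closed_segment x y \<Longrightarrow> (h has_real_derivative h' s) (at s)"
    and bound: "\<And>s. s \<in> closed_segment x y \<Longrightarrow> \<bar>h' s\<bar> \<le> M * h s"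
    and "h y = 0" "h x \<ge> 0"
  shows "h x = 0"
proof (cases "x \<le> y")
  case True
  have "h x * exp (M * x) \<le> h y * exp (M * y)"
  proof (rule DERIV_nonneg_imp_nondecreasing[OF True])
    fix s assume "x \<le> s" "s \<le> y"
    then have s: "s \<in> closed_segment x y" using True by (simp add: closed_segment_eq_real_ivl)
    have "((\<lambda>s. h s * exp (M * s)) has_real_derivative (h' s + M * h s) * exp (M * s)) (at s)"
      by (auto intro!: derivative_eq_intros der[OF s] simp: algebra_simps)
    moreover have "0 \<le> (h' s + M * h s) * exp (M * s)"
      using bound[OF s] by simp
    ultimately show "\<exists>d. ((\<lambda>s. h s * exp (M * s)) has_real_derivative d) (at s) \<and> 0 \<le> d" by blast
  qed
  then have "h x * exp (M * x) \<le> 0" using \<open>h y = 0\<close> by simp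
  then show ?thesis using \<open>h x \<ge> 0\<close> by (simp add: mult_le_0_iff)
next
  case False
  then have le: "y \<le> x" by simp
  have "h x * exp (- M * x) \<le> h y * exp (- M * y)"
  proof (rule DERIV_nonpos_imp_nonincreasing[OF le])
    fix s assume "y \<le> s" "s \<le> x"
    then have s: "s \<in> closed_segment x y" using False by (simp add: closed_segment_eq_real_ivl)
    have "((\<lambda>s. h s * exp (- M * s)) has_real_derivative (h' s - M * h s) * exp (- M * s)) (at s)"
      by (auto intro!: derivative_eq_intros der[OF s] simp: algebra_simps)
    moreover have "(h' s - M * h s) * exp (- M * s) \<le> 0"
      using bound[OF s] by (simp add: mult_le_0_iff)
    ultimately show "\<exists>d. ((\<lambda>s. h s * exp (- M * s)) has_real_derivative d) (at s) \<and> d \<le> 0" by blast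
  qed
  then have "h x * exp (- M * x) \<le> 0" using \<open>h y = 0\<close> by simp
  then show ?thesis using \<open>h x \<ge> 0\<close> by (simp add: mult_le_0_iff)
qed

lemma isCont_eq_0_closure:
  fixes h :: "real \<Rightarrow> real"
  assumes "isCont h x" "x \<in> closure S" "\<And>y. y \<in> S \<Longrightarrow> h y = 0"
  shows "h x = 0"
proof (rule ccontr)
  assume "h x \<noteq> 0"
  then obtain \<epsilon> where "\<epsilon> > 0" "\<And>y. dist x y < \<epsilon> \<Longrightarrow> h y \<noteq> 0"
    using continuous_at_avoid[OF assms(1)] by blast
  then show False
    using assms(2,3) by (metis closure_approachable dist_commute)
qed

text \<open>The profile equations of a meridian with \<open>a = f'\<close>, \<open>b = g'\<close> and \<open>p = f (f' g'' - g' f'')\<close>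
  (\<open>f\<close> times its curvature). For a second kind Gauss map over a curve with \<open>\<kappa> = 0\<close> one has
  \<open>num = c den\<close> with a constant \<open>c\<close>; off the zeros of \<open>b\<close> this is the differential
  equation of case (iii).\<close>

locale meridian_ode =
  fixes I :: "real set" and f a b p p1 p2 :: "real \<Rightarrow> real"
  assumes open_I: "open I" and interval_I: "is_interval I"
    and f_pos: "u \<in> I \<Longrightarrow> f u > 0"
    and f_deriv: "u \<in> I \<Longrightarrow> (f has_real_derivative a u) (at u)"
    and a_deriv: "u \<in> I \<Longrightarrow> (a has_real_derivative - (b u * p u / f u)) (at u)"
    and b_deriv: "u \<in> I \<Longrightarrow> (b has_real_derivative a u * p u / f u) (at u)"
    and p_deriv: "u \<in> I \<Longrightarrow> (p has_real_derivative p1 u) (at u)"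
    and p1_deriv: "u \<in> I \<Longrightarrow> (p1 has_real_derivative p2 u) (at u)"
    and unit: "u \<in> I \<Longrightarrow> (a u)\<^sup>2 + (b u)\<^sup>2 = 1"
begin

definition num where "num u = f u * p1 u - a u * b u"
definition den where "den u = b u * (1 + (p u)\<^sup>2) - a u * f u * p1 u"

text \<open>Origin: \<open>num = c den\<close> reads
  \<open>f p' (1 + c a) = b (a + c + c p^2)\<close>. With \<open>a\<close> as independent variable,
  \<open>a' = - b p / f\<close> makes this linear in \<open>p^2\<close>; after multiplication by
  \<open>1 + c a\<close> it says that the derivative of \<open>p^2 (1 + c a)^2\<close> in
  \<open>a\<close> is \<open>- 2 (a + c) (1 + c a)\<close>. The remaining terms are the
  antiderivative.\<close>

definition first_integral where
  "first_integral c u = (p u)\<^sup>2 * (1 + c * a u)\<^sup>2 + (a u)\<^sup>2 * (1 + c\<^sup>2) + 2 * c * a u + 2 / 3 * c * a u ^ 3"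

lemmas derivs = f_deriv a_deriv b_deriv p_deriv p1_deriv

lemma num_deriv:
  assumes "u \<in> I"
  shows "(num has_real_derivative
    a u * p1 u + f u * p2 u + b u * p u / f u * b u - a u * (a u * p u / f u)) (at u)"
  unfolding num_def by (auto intro!: derivative_eq_intros derivs assms simp: algebra_simps)

lemma den_deriv:
  assumes "u \<in> I"
  shows "(den has_real_derivative
    a u * p u / f u * (1 + (p u)\<^sup>2) + b u * (2 * p u * p1 u) + b u * p u / f u * f u * p1 u
      - a u * (a u * p1 u + f u * p2 u)) (at u)"
  unfolding den_def by (auto intro!: derivative_eq_intros derivs assms simp: algebra_simps add_divide_distrib)

lemma isCont_all:
  assumes "u \<in> I"
  shows "isCont f u" "isCont a u" "isCont b u" "isCont p u" "isCont num u" "isCont den u"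
    "isCont (first_integral c) u"
proof -
  show "isCont f u" "isCont a u" "isCont b u" "isCont p u" "isCont num u" "isCont den u"
    using assms derivs num_deriv den_deriv DERIV_isCont by blast+
  then show "isCont (first_integral c) u"
    unfolding first_integral_def by (intro continuous_intros) auto
qed

lemma first_integral_deriv:
  assumes u: "u \<in> I" and eq: "num u = c * den u"
  shows "(first_integral c has_real_derivative 0) (at u)"
proof -
  have f0: "f u \<noteq> 0" using f_pos[OF u] by simp
  have "(first_integral c has_real_derivative
      2 * p u * p1 u * (1 + c * a u)\<^sup>2 - (p u)\<^sup>2 * (2 * (1 + c * a u) * c * (b u * p u / f u))
      - 2 * a u * (b u * p u / f u) * (1 + c\<^sup>2) - 2 * c * (b u * p u / f u)
      - 2 * c * (a u)\<^sup>2 * (b u * p u / f u)) (at u)"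
    unfolding first_integral_def
    by (auto intro!: derivative_eq_intros derivs u simp: algebra_simps power2_eq_square add_divide_distrib)
  moreover have "2 * p u * p1 u * (1 + c * a u)\<^sup>2 - (p u)\<^sup>2 * (2 * (1 + c * a u) * c * (b u * p u / f u))
      - 2 * a u * (b u * p u / f u) * (1 + c\<^sup>2) - 2 * c * (b u * p u / f u)
      - 2 * c * (a u)\<^sup>2 * (b u * p u / f u) = 2 * p u * (1 + c * a u) / f u * (num u - c * den u)"
    using f0 by (simp add: num_def den_def field_simps power2_eq_square)
  ultimately show ?thesis using eq by simp
qed

lemma den_identity:
  assumes u: "u \<in> I" and eq: "num u = c * den u"
  shows "(1 + c * a u) * den u = b u * ((b u)\<^sup>2 + (p u)\<^sup>2)"
proof -
  have "(1 + c * a u) * den u = den u + a u * num u"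
    using eq by (simp add: algebra_simps)
  also have "\<dots> = b u * (1 - (a u)\<^sup>2 + (p u)\<^sup>2)"
    by (simp add: num_def den_def power2_eq_square algebra_simps)
  also have "1 - (a u)\<^sup>2 = (b u)\<^sup>2" using unit[OF u] by simp
  finally show ?thesis .
qed

text \<open>By \<open>den_identity\<close> the factor relating \<open>den\<close> to
  \<open>b\<close> is \<open>(b^2 + p^2) / (1 + c a)\<close>; the last two conditions make it finite
  and non-zero, also where \<open>b = 0\<close>.\<close>

definition regular where
  "regular c u \<longleftrightarrow> num u = c * den u \<and> 1 + c * a u \<noteq> 0 \<and> (b u \<noteq> 0 \<or> p u \<noteq> 0)"

lemma regularI:
  assumes "u \<in> I" "num u = c * den u" "b u \<noteq> 0"
  shows "regular c u"
  using den_identity[OF assms(1,2)] assms(2,3) unfolding regular_def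
  by (metis add_nonneg_eq_0_iff mult_eq_0_iff mult_zero_left power_not_zero zero_le_power2)

text \<open>The equation is known only on \<open>S\<close>; continuity carries the conserved value
  to a boundary point \<open>u1\<close>, which is where it is exploited.\<close>

lemma first_integral_const:
  assumes "open S" "is_interval S" "S \<subseteq> I" "\<And>u. u \<in> S \<Longrightarrow> num u = c * den u"
    and "u1 \<in> I" "u1 \<in> closure S" "s \<in> S"
  shows "first_integral c s = first_integral c u1"
proof -
  obtain E where E: "\<And>u. u \<in> S \<Longrightarrow> first_integral c u = E"
    using interval_constI[OF assms(2) first_integral_deriv] assms(3,4) by blast
  have "isCont (\<lambda>u. first_integral c u - E) u1"
    using isCont_all[OF assms(5)] by (intro continuous_intros)
  from isCont_eq_0_closure[OF this assms(6)] E show ?thesis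
    using assms(7) by simp
qed

text \<open>With \<open>a(u\<^sub>1) = \<epsilon> = \<plusminus>1\<close> and \<open>h = 1 - \<epsilon> a\<close>, conservation of the first integral gives
  \<open>p\<^sup>2 (1 + c a)\<^sup>2\<close> as a polynomial in \<open>h\<close>.\<close>

lemma first_integral_expand:
  assumes "\<epsilon>\<^sup>2 = 1" "a u1 = \<epsilon>" "p u1 = 0 \<or> 1 + c * \<epsilon> = 0"
    and "first_integral c s = first_integral c u1" "h = 1 - \<epsilon> * a s" "d = c * \<epsilon>"
  shows "(p s)\<^sup>2 * (1 + c * a s)\<^sup>2 = 2 * (1 + d)\<^sup>2 * h - (1 + d)\<^sup>2 * h\<^sup>2 + 2 / 3 * d * h ^ 3"
proof -
  have \<epsilon>: "\<epsilon> = 1 \<or> \<epsilon> = -1" using assms(1) by (simp add: power2_eq_1_iff)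
  have "first_integral c u1 = 1 + c\<^sup>2 + 2 * c * \<epsilon> + 2 / 3 * c * \<epsilon>"
    using \<epsilon> assms(2,3) by (auto simp: first_integral_def)
  then have "(p s)\<^sup>2 * (1 + c * a s)\<^sup>2 =
      1 + c\<^sup>2 + 2 * c * \<epsilon> + 2 / 3 * c * \<epsilon>
        - ((a s)\<^sup>2 * (1 + c\<^sup>2) + 2 * c * a s + 2 / 3 * c * a s ^ 3)"
    using assms(4) by (simp add: first_integral_def)
  then show ?thesis
    using \<epsilon> unfolding assms(5,6)
    by (auto simp: field_simps power2_eq_square power3_eq_cube)
qed

text \<open>If \<open>d = -1\<close>, the linear and quadratic terms of the expansion drop out and a
  square equals \<open>- 2/3 h^3\<close> with \<open>h \<ge> 0\<close>. So \<open>h = 0\<close>,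
  which means \<open>a = \<epsilon>\<close> and \<open>b = 0\<close>.\<close>

lemma no_degenerate_coefficient:
  assumes "s \<in> I" "\<epsilon>\<^sup>2 = 1" "a u1 = \<epsilon>" "1 + c * \<epsilon> = 0"
    and "first_integral c s = first_integral c u1"
  shows "b s = 0"
proof -
  define h where "h = 1 - \<epsilon> * a s"
  have "c * \<epsilon> = -1" using assms(4) by simp
  have "(p s)\<^sup>2 * (1 + c * a s)\<^sup>2 = - 2 / 3 * h ^ 3"
    using first_integral_expand[OF assms(2,3) _ assms(5) h_def refl] assms(4) \<open>c * \<epsilon> = -1\<close> by simp
  moreover have "0 \<le> (p s)\<^sup>2 * (1 + c * a s)\<^sup>2" by simp
  ultimately have "h ^ 3 \<le> 0" by linarith
  moreover have "\<bar>a s\<bar> \<le> 1"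
    using unit[OF assms(1)] by (metis abs_le_square_iff abs_one le_add_same_cancel1 one_power2 zero_le_power2)
  then have "h \<ge> 0"
    using \<open>\<epsilon>\<^sup>2 = 1\<close> by (auto simp: h_def power2_eq_1_iff)
  ultimately have "h = 0"
    using zero_less_power[of h 3] by linarith
  then have "\<epsilon> * a s = 1" by (simp add: h_def)
  then have "(\<epsilon> * a s)\<^sup>2 = 1" by simp
  then have "(a s)\<^sup>2 = 1"
    using assms(2) by (simp add: power_mult_distrib)
  then show ?thesis using unit[OF assms(1)] by simp
qed

text \<open>If \<open>b\<close> and \<open>p\<close> vanish together at \<open>u1\<close>, the first integral gives \<open>p\<^sup>2 \<le> K h\<close>, hence
  \<open>\<bar>h'\<bar> = \<bar>b p / f\<bar> \<le> M h\<close>, near \<open>u1\<close>, and \<open>h\<close> vanishes identically.\<close>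

lemma no_stationary_limit:
  assumes S: "open S" "is_interval S" "S \<subseteq> I" and reg: "\<And>u. u \<in> S \<Longrightarrow> regular c u"
    and u1: "u1 \<in> I" "u1 \<in> closure S" "b u1 = 0" "1 + c * a u1 \<noteq> 0"
  shows "p u1 \<noteq> 0"
proof
  assume p0: "p u1 = 0"
  define \<epsilon> where "\<epsilon> = a u1"
  define h where "h s = 1 - \<epsilon> * a s" for s
  define d where "d = c * \<epsilon>"
  have \<epsilon>2: "\<epsilon>\<^sup>2 = 1" using unit[OF u1(1)] u1(3) by (simp add: \<epsilon>_def)
  then have \<epsilon>: "\<epsilon> = 1 \<or> \<epsilon> = -1" by (simp add: power2_eq_1_iff)
  have d: "1 + d \<noteq> 0" using u1(4) by (simp add: d_def \<epsilon>_def)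
  have h_bounds: "0 \<le> h s" "h s \<le> 2" "(b s)\<^sup>2 \<le> 2 * h s" if "s \<in> I" for s
  proof -
    have "\<bar>a s\<bar> \<le> 1"
      using unit[OF that] by (metis abs_le_square_iff abs_one le_add_same_cancel1 one_power2 zero_le_power2)
    then show *: "0 \<le> h s" "h s \<le> 2" using \<epsilon> by (auto simp: h_def)
    have "(b s)\<^sup>2 = 1 - (a s)\<^sup>2" using unit[OF that] by simp
    also have "\<dots> = h s * (2 - h s)"
      using \<epsilon> by (auto simp: h_def power2_eq_square algebra_simps)
    also have "\<dots> \<le> h s * 2" using * by (intro mult_left_mono) auto
    finally show "(b s)\<^sup>2 \<le> 2 * h s" by simp
  qed
  have eq: "(p s)\<^sup>2 * (1 + c * a s)\<^sup>2 =
      2 * (1 + d)\<^sup>2 * h s - (1 + d)\<^sup>2 * (h s)\<^sup>2 + 2 / 3 * d * h s ^ 3"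
    if "s \<in> S" for s
    using first_integral_expand[OF \<epsilon>2 _ disjI1[OF p0] _ h_def d_def]
      first_integral_const[OF S _ u1(1,2) that] reg by (simp add: \<epsilon>_def regular_def)
  \<comment> \<open>As \<open>0 \<le> h \<le> 2\<close>, the cubic term is at most
    \<open>8/3 \<bar>d\<bar> h\<close>; the denominator is a lower bound of
    \<open>(1 + c a)^2\<close> near \<open>u1\<close>. In \<open>M\<close> the numerator comes from
    \<open>\<bar>b p\<bar> \<le> (b^2 + p^2) / 2\<close> with \<open>b^2 \<le> 2 h\<close>, the
    denominator from \<open>f > f u1 / 2\<close>.\<close>
  define K where "K = (2 * (1 + d)\<^sup>2 + 8 / 3 * \<bar>d\<bar>) / ((1 + d)\<^sup>2 / 4)"
  define M where "M = (2 + K) / 2 / (f u1 / 2)"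
  obtain \<delta> where \<delta>: "\<delta> > 0" "\<And>s. dist s u1 < \<delta> \<Longrightarrow> s \<in> I \<and> f s > f u1 / 2 \<and> (1 + c * a s)\<^sup>2 > (1 + d)\<^sup>2 / 4"
  proof -
    have "isCont (\<lambda>s. (1 + c * a s)\<^sup>2) u1"
      using isCont_all[OF u1(1)] by (intro continuous_intros)
    then have "((\<lambda>s. (1 + c * a s)\<^sup>2) \<longlongrightarrow> (1 + c * a u1)\<^sup>2) (nhds u1)"
      using tendsto_at_iff_tendsto_nhds[of "\<lambda>s. (1 + c * a s)\<^sup>2" u1] by (simp add: isCont_def)
    then have "\<forall>\<^sub>F s in nhds u1. (1 + c * a s)\<^sup>2 > (1 + d)\<^sup>2 / 4"
      using d by (intro order_tendstoD(1)[of _ "(1 + c * a u1)\<^sup>2"]) (auto simp: d_def \<epsilon>_def)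
    moreover have "\<forall>\<^sub>F s in nhds u1. f s > f u1 / 2"
      using isCont_all(1)[OF u1(1)] f_pos[OF u1(1)]
      by (intro order_tendstoD(1)[of _ "f u1"]) (auto simp: isCont_def tendsto_at_iff_tendsto_nhds)
    moreover have "\<forall>\<^sub>F s in nhds u1. s \<in> I"
      using open_I u1(1) by (rule eventually_nhds_in_open)
    ultimately have "\<forall>\<^sub>F s in nhds u1. s \<in> I \<and> f s > f u1 / 2 \<and> (1 + c * a s)\<^sup>2 > (1 + d)\<^sup>2 / 4"
      by eventually_elim auto
    then show ?thesis using that unfolding eventually_nhds_metric by blast
  qed
  have p_bound: "(p s)\<^sup>2 \<le> K * h s" if "s \<in> S" "dist s u1 < \<delta>" for s
  proof -
    have s: "s \<in> I" using that S(3) by blast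
    note hb = h_bounds[OF s]
    have "h s ^ 3 \<le> 4 * h s"
      using mult_mono[OF mult_mono[OF hb(2,2)] order_refl, of "h s"] hb(1) by (simp add: power3_eq_cube)
    then have "2 / 3 * d * h s ^ 3 \<le> 2 / 3 * \<bar>d\<bar> * (4 * h s)"
      using mult_right_mono[OF abs_ge_self[of d], of "h s ^ 3"] hb(1)
        mult_left_mono[of "h s ^ 3" "4 * h s" "\<bar>d\<bar>"] by simp
    moreover have "0 \<le> (1 + d)\<^sup>2 * (h s)\<^sup>2" by simp
    moreover have "(2 * (1 + d)\<^sup>2 + 8 / 3 * \<bar>d\<bar>) * h s =
        2 * (1 + d)\<^sup>2 * h s + 2 / 3 * \<bar>d\<bar> * (4 * h s)"
      by (simp add: algebra_simps)
    ultimately have "(p s)\<^sup>2 * (1 + c * a s)\<^sup>2 \<le> (2 * (1 + d)\<^sup>2 + 8 / 3 * \<bar>d\<bar>) * h s"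
      unfolding eq[OF that(1)] by linarith
    moreover have "(p s)\<^sup>2 * ((1 + d)\<^sup>2 / 4) \<le> (p s)\<^sup>2 * (1 + c * a s)\<^sup>2"
      using \<delta>(2)[OF that(2)] by (intro mult_left_mono) auto
    ultimately have "(p s)\<^sup>2 * ((1 + d)\<^sup>2 / 4) \<le> (2 * (1 + d)\<^sup>2 + 8 / 3 * \<bar>d\<bar>) * h s" by simp
    moreover have "(1 + d)\<^sup>2 / 4 > 0" using d by simp
    ultimately show ?thesis
      by (simp only: K_def times_divide_eq_left pos_le_divide_eq)
  qed
  have "h u1 = 0" using \<epsilon>2 by (simp add: h_def \<epsilon>_def power2_eq_square)
  have "K \<ge> 0" using d by (simp add: K_def)
  have h_deriv: "(h has_real_derivative \<epsilon> * (b s * p s / f s)) (at s)" if "s \<in> I" for s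
    unfolding h_def by (auto intro!: derivative_eq_intros a_deriv that)
  have h'_bound: "\<bar>\<epsilon> * (b s * p s / f s)\<bar> \<le> M * h s"
    if "s \<in> S \<or> s = u1" "dist s u1 < \<delta>" for s
  proof (cases "s = u1")
    case True
    then show ?thesis using \<open>h u1 = 0\<close> p0 by simp
  next
    case False
    then have s: "s \<in> S" using that by blast
    have "\<bar>b s * p s\<bar> \<le> ((b s)\<^sup>2 + (p s)\<^sup>2) / 2"
      using sum_squares_bound[of "\<bar>b s\<bar>" "\<bar>p s\<bar>"] by (simp add: abs_mult)
    also have "\<dots> \<le> (2 + K) / 2 * h s"
      using p_bound[OF s that(2)] h_bounds(3)[of s] S(3) s by (auto simp: algebra_simps)
    finally have *: "\<bar>b s * p s\<bar> \<le> (2 + K) / 2 * h s" .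
    have f: "f s > f u1 / 2" "f u1 > 0" "h s \<ge> 0"
      using \<delta>(2)[OF that(2)] f_pos[OF u1(1)] h_bounds(1)[of s] by auto
    have "\<bar>\<epsilon> * (b s * p s / f s)\<bar> = \<bar>b s * p s\<bar> / f s"
      using f \<epsilon> by (auto simp: abs_mult)
    also have "\<dots> \<le> ((2 + K) / 2 * h s) / (f u1 / 2)"
      using * f \<open>K \<ge> 0\<close> by (intro frac_le) auto
    finally show ?thesis by (simp add: M_def field_simps)
  qed
  \<comment> \<open>Gronwall is applied on the segment from such an \<open>s\<close> to
    \<open>u1\<close>; it lies in \<open>S\<close> except possibly for \<open>u1\<close> itself. The
    outcome \<open>b s = p s = 0\<close> contradicts regularity at \<open>s\<close>.\<close>
  obtain s where s: "s \<in> S" "dist s u1 < \<delta>"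
    using u1(2) \<delta>(1) closure_approachable by blast
  have seg: "r \<in> S \<or> r = u1" "dist r u1 < \<delta>" if "r \<in> closed_segment s u1" for r
  proof -
    have "open_segment s u1 \<subseteq> S"
      using in_interior_closure_convex_segment[OF is_interval_convex[OF S(2)], of s u1] S(1) s(1) u1(2)
      by (simp add: interior_open)
    then show "r \<in> S \<or> r = u1"
      using that s(1) by (auto simp: open_segment_def)
    have "dist u1 r \<le> dist s u1"
      using dist_in_closed_segment[OF that] by (simp add: dist_commute)
    then show "dist r u1 < \<delta>" using s(2) by (simp add: dist_commute)
  qed
  have "h s = 0"
  proof (rule gronwall_zero[where h = h and M = M])
    show "(h has_real_derivative \<epsilon> * (b r * p r / f r)) (at r)" if "r \<in> closed_segment s u1" for r
      using seg(1)[OF that] S(3) u1(1) by (intro h_deriv) blast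
    show "\<bar>\<epsilon> * (b r * p r / f r)\<bar> \<le> M * h r" if "r \<in> closed_segment s u1" for r
      by (rule h'_bound[OF seg[OF that]])
    show "h u1 = 0" by fact
    show "h s \<ge> 0" using h_bounds(1) s(1) S(3) by blast
  qed
  then have "b s = 0" "p s = 0"
    using p_bound[OF s] h_bounds(3)[of s] s(1) S(3) by auto
  then show False using reg[OF s(1)] by (simp add: regular_def)
qed

lemma simple_zero:
  assumes u1: "u1 \<in> I" "b u1 = 0" "p u1 \<noteq> 0"
  obtains \<delta> where "\<delta> > 0" "\<And>s. dist s u1 < \<delta> \<Longrightarrow> s \<in> I" "\<And>s. dist s u1 < \<delta> \<Longrightarrow> s \<noteq> u1 \<Longrightarrow> b s \<noteq> 0"
proof -
  have "a u1 \<noteq> 0" using unit[OF u1(1)] u1(2) by auto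
  then have "a u1 * p u1 / f u1 \<noteq> 0" using u1 f_pos[of u1] by auto
  moreover have "((\<lambda>s. (b s - b u1) / (s - u1)) \<longlongrightarrow> a u1 * p u1 / f u1) (at u1)"
    using b_deriv[OF u1(1)] by (simp add: has_field_derivative_iff)
  ultimately have "\<forall>\<^sub>F s in at u1. (b s - b u1) / (s - u1) \<noteq> 0"
    by (rule tendsto_imp_eventually_ne[rotated])
  moreover have "\<forall>\<^sub>F s in at u1. s \<in> I"
    using open_I u1(1) by (rule eventually_at_in_open')
  ultimately have "\<forall>\<^sub>F s in at u1. s \<in> I \<and> b s \<noteq> 0"
    by eventually_elim (use u1(2) in auto)
  then obtain \<delta> where "\<delta> > 0" "\<And>s. s \<noteq> u1 \<Longrightarrow> dist s u1 < \<delta> \<Longrightarrow> s \<in> I \<and> b s \<noteq> 0"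
    unfolding eventually_at by auto
  moreover have "s \<in> I" if "dist s u1 < \<delta>" for s
    using that calculation(2)[of s] u1(1) by (cases "s = u1") auto
  ultimately show ?thesis by (intro that[of \<delta>]) auto
qed

text \<open>At a simple zero of \<open>b\<close> the constants of the two sides agree, because
  \<open>num' = c den'\<close> and \<open>den' \<noteq> 0\<close> there.\<close>

lemma ratio_across_zero:
  assumes u1: "u1 \<in> I" "b u1 = 0" "p u1 \<noteq> 0" "p1 u1 = 0"
    and T: "u1 islimpt T" "\<And>s. s \<in> T \<Longrightarrow> num s = c * den s"
    and T': "u1 islimpt T'" "\<And>s. s \<in> T' \<Longrightarrow> num s = c' * den s"
  shows "c = c'"
proof -
  define b' where "b' = a u1 * p u1 / f u1"
  have a2: "a u1 * a u1 = 1" using unit[OF u1(1)] u1(2) by (simp add: power2_eq_square)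
  then have "a u1 \<noteq> 0" by auto
  then have b': "b' \<noteq> 0" using u1 f_pos[of u1] by (auto simp: b'_def)
  define N D where "N = f u1 * p2 u1 - a u1 * b'" and "D = b' * (1 + (p u1)\<^sup>2) - a u1 * f u1 * p2 u1"
  have nd: "(num has_real_derivative N) (at u1)" "(den has_real_derivative D) (at u1)"
    using num_deriv[OF u1(1)] den_deriv[OF u1(1)] u1 by (simp_all add: N_def D_def b'_def mult.assoc)
  have zero: "num u1 = 0" "den u1 = 0" using u1 by (simp_all add: num_def den_def)
  have "N - k * D = 0" if "u1 islimpt U" "\<And>s. s \<in> U \<Longrightarrow> num s = k * den s" for k U
  proof (rule DERIV_eq_0_if_const_within[OF _ that(1)])
    show "((\<lambda>s. num s - k * den s) has_real_derivative N - k * D) (at u1)"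
      by (auto intro!: derivative_eq_intros nd)
  qed (use that(2) zero in auto)
  from this[OF T] this[OF T'] have *: "N = c * D" "N = c' * D" by simp_all
  \<comment> \<open>The linearisation of \<open>den_identity\<close>:
    \<open>D + a N = b' p^2\<close> at the zero, which is non-zero, whereas \<open>D = 0\<close>
    would entail \<open>N = 0\<close>.\<close>
  have "D \<noteq> 0"
  proof
    assume "D = 0"
    then have "f u1 * p2 u1 = a u1 * b'" using * by (simp add: N_def)
    then have "D = b' * (1 + (p u1)\<^sup>2) - (a u1 * a u1) * b'"
      by (simp add: D_def mult.assoc)
    then show False using \<open>D = 0\<close> b' u1(3) by (simp add: a2 algebra_simps)
  qed
  then show ?thesis using * by simp
qed

end

section \<open>One constant on the whole interval\<close>

locale meridian_ode_case = meridian_ode +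
  assumes den_nonzero: "u \<in> I \<Longrightarrow> b u \<noteq> 0 \<Longrightarrow> den u \<noteq> 0"
    and ratio_deriv: "u \<in> I \<Longrightarrow> b u \<noteq> 0 \<Longrightarrow> ((\<lambda>s. num s / den s) has_real_derivative 0) (at u)"
begin

lemma ratio_const:
  assumes "is_interval S" "S \<subseteq> I" and b: "\<And>u. u \<in> S \<Longrightarrow> b u \<noteq> 0"
  obtains c where "\<And>u. u \<in> S \<Longrightarrow> num u = c * den u"
proof -
  obtain c where "\<And>u. u \<in> S \<Longrightarrow> num u / den u = c"
    using interval_constI[OF assms(1) ratio_deriv] b assms(2) by blast
  then have "num u = c * den u" if "u \<in> S" for u
    using \<open>\<And>u. u \<in> S \<Longrightarrow> num u / den u = c\<close>[OF that] den_nonzero[of u] b that assms(2)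
    by (metis nonzero_divide_eq_eq subsetD)
  then show ?thesis by (rule that)
qed

text \<open>Away from zeros of \<open>b\<close> the ratio is locally constant and agrees with
  \<open>c\<close> on the overlap with \<open>S\<close>. At a zero, the first integral excludes
  \<open>1 + c a = 0\<close> (as \<open>b u0 \<noteq> 0\<close>) and \<open>p = 0\<close>; so the
  zero is isolated and the constants on its two sides coincide.\<close>

lemma regular_extends:
  assumes S: "open S" "is_interval S" "S \<subseteq> I" and reg: "\<And>u. u \<in> S \<Longrightarrow> regular c u"
    and u0: "u0 \<in> S" "b u0 \<noteq> 0" and u1: "u1 \<in> I" "u1 \<in> closure S"
  obtains \<delta> where "\<delta> > 0" "ball u1 \<delta> \<subseteq> I" "\<And>s. s \<in> ball u1 \<delta> \<Longrightarrow> regular c s"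
proof (cases "b u1 = 0")
  case False
  obtain \<delta>1 where \<delta>1: "\<delta>1 > 0" "ball u1 \<delta>1 \<subseteq> I"
    using open_I u1(1) open_contains_ball by blast
  obtain \<delta>2 where \<delta>2: "\<delta>2 > 0" "\<And>s. dist u1 s < \<delta>2 \<Longrightarrow> b s \<noteq> 0"
    using continuous_at_avoid[OF isCont_all(3)[OF u1(1)] False] by blast
  define \<delta> where "\<delta> = min \<delta>1 \<delta>2"
  have \<delta>: "\<delta> > 0" "ball u1 \<delta> \<subseteq> I" "\<And>s. s \<in> ball u1 \<delta> \<Longrightarrow> b s \<noteq> 0"
    using \<delta>1 \<delta>2 by (auto simp: \<delta>_def)
  obtain c' where c': "\<And>s. s \<in> ball u1 \<delta> \<Longrightarrow> num s = c' * den s"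
    using ratio_const[OF is_interval_ball_real \<delta>(2,3)] by blast
  obtain s where s: "s \<in> S" "s \<in> ball u1 \<delta>"
    using u1(2) \<delta>(1) by (metis closure_approachable dist_commute mem_ball)
  have "c' = c"
    using c'[OF s(2)] reg[OF s(1)] den_nonzero[of s] s \<delta> by (auto simp: regular_def)
  then show ?thesis
    using that[OF \<delta>(1,2)] \<delta>(2,3) c' regularI by blast
next
  case True
  have num_eq: "num u1 = c * den u1"
  proof -
    have "isCont (\<lambda>s. num s - c * den s) u1"
      using isCont_all[OF u1(1)] by (intro continuous_intros)
    from isCont_eq_0_closure[OF this u1(2)] reg show ?thesis by (simp add: regular_def)
  qed
  have "(a u1)\<^sup>2 = 1" using unit[OF u1(1)] True by simp
  have ca: "1 + c * a u1 \<noteq> 0"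
  proof
    assume "1 + c * a u1 = 0"
    then have "b u0 = 0"
      using no_degenerate_coefficient[OF _ \<open>(a u1)\<^sup>2 = 1\<close> refl]
        first_integral_const[OF S _ u1 u0(1)] reg u0(1) S(3) by (auto simp: regular_def)
    then show False using u0(2) by simp
  qed
  have p: "p u1 \<noteq> 0"
    by (rule no_stationary_limit[OF S reg u1 True ca])
  \<comment> \<open>Where \<open>b = 0\<close>, \<open>num\<close> is \<open>f p'\<close> and
    \<open>den\<close> is \<open>- a f p'\<close>, so the limiting relation
    \<open>num = c den\<close> forces \<open>p' = 0\<close>.\<close>
  have "(1 + c * a u1) * (f u1 * p1 u1) = 0"
    using num_eq True by (simp add: num_def den_def algebra_simps)
  then have p1: "p1 u1 = 0" using ca f_pos[OF u1(1)] by simp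
  obtain \<delta> where \<delta>: "\<delta> > 0" "\<And>s. dist s u1 < \<delta> \<Longrightarrow> s \<in> I"
    "\<And>s. dist s u1 < \<delta> \<Longrightarrow> s \<noteq> u1 \<Longrightarrow> b s \<noteq> 0"
    using simple_zero[OF u1(1) True p] by blast
  let ?L = "{u1 - \<delta><..<u1}" and ?R = "{u1<..<u1 + \<delta>}"
  have LR: "s \<in> I" "b s \<noteq> 0" if "s \<in> ?L \<or> s \<in> ?R" for s
    using that \<delta>(2,3)[of s] by (auto simp: dist_real_def)
  obtain cL where cL: "\<And>s. s \<in> ?L \<Longrightarrow> num s = cL * den s"
    by (rule ratio_const[of ?L]) (use LR is_interval_oo in auto)
  obtain cR where cR: "\<And>s. s \<in> ?R \<Longrightarrow> num s = cR * den s"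
    by (rule ratio_const[of ?R]) (use LR is_interval_oo in auto)
  have "cL = cR"
    using ratio_across_zero[OF u1(1) True p p1 islimpt_greaterThanLessThan2[of "u1 - \<delta>"] cL
        islimpt_greaterThanLessThan1[of _ "u1 + \<delta>"] cR] \<delta>(1) by simp
  \<comment> \<open>\<open>S\<close> may approach \<open>u1\<close> from either side. Being open, it
    has a point other than \<open>u1\<close> nearby, and that point identifies the common constant
    with \<open>c\<close>.\<close>
  obtain s where s: "s \<in> S" "s \<in> ?L \<or> s \<in> ?R"
  proof -
    have "u1 islimpt S"
      using u1(2) S(1) by (metis closure_def UnE interior_limit_point interior_open mem_Collect_eq)
    then obtain s where "s \<in> S" "s \<noteq> u1" "dist s u1 < \<delta>"
      using \<delta>(1) islimpt_approachable by blast
    then show ?thesis using that[of s] by (cases "s < u1") (auto simp: dist_real_def)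
  qed
  then have "cL = c"
    using cL cR \<open>cL = cR\<close> reg[OF s(1)] den_nonzero LR[OF s(2)] unfolding regular_def
    by (metis mult_right_cancel)
  have "regular c s" if "s \<in> ball u1 \<delta>" for s
  proof (cases "s = u1")
    case True
    then show ?thesis using num_eq ca p by (simp add: regular_def)
  next
    case False
    then have "s \<in> ?L \<or> s \<in> ?R" using that by (auto simp: dist_real_def)
    then show ?thesis
      using LR cL cR \<open>cL = cR\<close> \<open>cL = c\<close> by (intro regularI) auto
  qed
  moreover have "ball u1 \<delta> \<subseteq> I" using \<delta>(2) by (auto simp: dist_commute)
  ultimately show ?thesis using that[OF \<delta>(1)] by blast
qed

text \<open>\<open>S\<close> is the largest connected open subset of \<open>I\<close> around
  \<open>u0\<close> on which \<open>regular c\<close> holds. By \<open>regular_extends\<close> it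
  contains its limit points in \<open>I\<close>, so it is clopen in the connected set
  \<open>I\<close>.\<close>

theorem global_ratio:
  assumes u0: "u0 \<in> I" "b u0 \<noteq> 0"
  obtains c where "\<And>u. u \<in> I \<Longrightarrow> regular c u"
proof -
  define c where "c = num u0 / den u0"
  define F where "F = {T. open T \<and> connected T \<and> u0 \<in> T \<and> T \<subseteq> I \<and> (\<forall>s\<in>T. regular c s)}"
  define S where "S = \<Union>F"
  have "open S" "S \<subseteq> I" "\<And>s. s \<in> S \<Longrightarrow> regular c s"
    by (auto simp: S_def F_def)
  have "connected S"
    unfolding S_def by (rule connected_Union) (auto simp: F_def)
  then have "is_interval S" by (simp add: is_interval_connected_1)
  have "u0 \<in> S"
  proof -
    obtain \<delta>1 where \<delta>1: "\<delta>1 > 0" "ball u0 \<delta>1 \<subseteq> I"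
      using open_I u0(1) open_contains_ball by blast
    obtain \<delta>2 where \<delta>2: "\<delta>2 > 0" "\<And>s. dist u0 s < \<delta>2 \<Longrightarrow> b s \<noteq> 0"
      using continuous_at_avoid[OF isCont_all(3)[OF u0(1)] u0(2)] by blast
    define \<delta> where "\<delta> = min \<delta>1 \<delta>2"
    have \<delta>: "\<delta> > 0" "ball u0 \<delta> \<subseteq> I" "\<And>s. s \<in> ball u0 \<delta> \<Longrightarrow> b s \<noteq> 0"
      using \<delta>1 \<delta>2 by (auto simp: \<delta>_def)
    obtain c' where c': "\<And>s. s \<in> ball u0 \<delta> \<Longrightarrow> num s = c' * den s"
      using ratio_const[OF is_interval_ball_real \<delta>(2,3)] by blast
    have "c' = c"
      using c'[of u0] \<delta>(1) den_nonzero[OF u0] by (simp add: c_def)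
    then have "ball u0 \<delta> \<in> F"
      using \<delta> c' regularI by (auto simp: F_def)
    then show ?thesis unfolding S_def using \<delta>(1) centre_in_ball by blast
  qed
  have "u1 \<in> S" if u1: "u1 \<in> I" "u1 \<in> closure S" for u1
  proof -
    obtain \<delta> where \<delta>: "\<delta> > 0" "ball u1 \<delta> \<subseteq> I" "\<And>s. s \<in> ball u1 \<delta> \<Longrightarrow> regular c s"
      using regular_extends[OF \<open>open S\<close> \<open>is_interval S\<close> \<open>S \<subseteq> I\<close> _ \<open>u0 \<in> S\<close> u0(2) u1]
        \<open>\<And>s. s \<in> S \<Longrightarrow> regular c s\<close> by blast
    have "S \<inter> ball u1 \<delta> \<noteq> {}"
      using u1(2) \<delta>(1) by (metis IntI closure_approachable dist_commute empty_iff mem_ball)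
    then have "S \<union> ball u1 \<delta> \<in> F"
      using \<delta> \<open>open S\<close> \<open>connected S\<close> \<open>u0 \<in> S\<close> \<open>S \<subseteq> I\<close> \<open>\<And>s. s \<in> S \<Longrightarrow> regular c s\<close>
      by (auto simp: F_def intro!: connected_Un)
    then show ?thesis using \<delta>(1) unfolding S_def by (meson UnionI UnI2 centre_in_ball)
  qed
  then have "closedin (top_of_set I) S"
    using \<open>S \<subseteq> I\<close> unfolding closedin_limpt closure_def by blast
  moreover have "openin (top_of_set I) S"
    using \<open>open S\<close> \<open>S \<subseteq> I\<close> by (simp add: open_subset)
  moreover have "connected I" using interval_I by (simp add: is_interval_connected_1)
  ultimately have "S = I"
    using connected_clopen \<open>u0 \<in> S\<close> by blast
  then show ?thesis
    using that \<open>\<And>s. s \<in> S \<Longrightarrow> regular c s\<close> by blast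
qed

end

section \<open>Curves of zero curvature\<close>

lemma DERIV_locally_const:
  fixes F :: "real \<Rightarrow> real"
  assumes "open S" "x \<in> S" "\<And>y. y \<in> S \<Longrightarrow> F y = c" "(F has_real_derivative D) (at x)"
  shows "D = 0"
  using has_vector_derivative_locally_const[OF assms(1-3)] assms(4)
  by (simp add: has_real_derivative_iff_has_vector_derivative)

text \<open>Writing the logarithm as \<open>ln (y^2) / 2\<close> avoids a case distinction on the
  sign; \<open>ln 0 = 0\<close> makes the identity hold for \<open>y = 0\<close> too.\<close>

lemma DERIV_ln_abs:
  fixes x :: "real \<Rightarrow> real"
  assumes "(x has_real_derivative x') (at u)" "x u \<noteq> 0"
  shows "((\<lambda>s. ln \<bar>x s\<bar>) has_real_derivative x' / x u) (at u)"
proof -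
  have "ln \<bar>y\<bar> = ln (y\<^sup>2) / 2" for y :: real
    using ln_realpow[of "\<bar>y\<bar>" 2] by (cases "y = 0") auto
  moreover have "((\<lambda>s. ln ((x s)\<^sup>2) / 2) has_real_derivative x' / x u) (at u)"
    using assms by (auto intro!: derivative_eq_intros simp: field_simps power2_eq_square zero_less_mult_iff)
  ultimately show ?thesis by (simp only:)
qed

context meridian begin

definition p where "p u = f u * (f1 u * g2 u - g1 u * f2 u)"

lemma smooth_p: "smooth_on I p"
  unfolding p_def[abs_def]
  by (intro smooth_on_mult smooth_on_diff smooth_f smooth_meridian open_I)

text \<open>The acceleration is orthogonal to the unit vector \<open>(f', g')\<close>, hence a
  multiple of \<open>(- g', f')\<close>, and the factor is the curvature
  \<open>p / f\<close>.\<close>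

lemma f2_eq:
  assumes u: "u \<in> I"
  shows "f2 u = - (g1 u * p u / f u)"
proof -
  have "f u \<noteq> 0" using f_pos[OF u] by simp
  have "g1 u * p u / f u = f1 u * (g1 u * g2 u) - (g1 u)\<^sup>2 * f2 u"
    using \<open>f u \<noteq> 0\<close> by (simp add: p_def field_simps power2_eq_square)
  also have "g1 u * g2 u = - (f1 u * f2 u)" using acceleration_orthogonal[OF u] by simp
  also have "f1 u * - (f1 u * f2 u) - (g1 u)\<^sup>2 * f2 u = - ((f1 u)\<^sup>2 + (g1 u)\<^sup>2) * f2 u"
    by (simp add: power2_eq_square algebra_simps)
  finally show ?thesis using unit_speed[OF u] by simp
qed

lemma g2_eq:
  assumes u: "u \<in> I"
  shows "g2 u = f1 u * p u / f u"
proof -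
  have "f u \<noteq> 0" using f_pos[OF u] by simp
  have "f1 u * p u / f u = (f1 u)\<^sup>2 * g2 u - g1 u * (f1 u * f2 u)"
    using \<open>f u \<noteq> 0\<close> by (simp add: p_def field_simps power2_eq_square)
  also have "f1 u * f2 u = - (g1 u * g2 u)" using acceleration_orthogonal[OF u] by simp
  also have "(f1 u)\<^sup>2 * g2 u - g1 u * - (g1 u * g2 u) = ((f1 u)\<^sup>2 + (g1 u)\<^sup>2) * g2 u"
    by (simp add: power2_eq_square algebra_simps)
  finally show ?thesis using unit_speed[OF u] by simp
qed

sublocale ode: meridian_ode I f f1 g1 p "deriv p" "deriv (deriv p)"
proof
  fix u assume u: "u \<in> I"
  show "(p has_real_derivative deriv p u) (at u)"
    "(deriv p has_real_derivative deriv (deriv p) u) (at u)"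
    by (intro smooth_on_DERIV[OF _ u] smooth_p smooth_on_deriv open_I)+
qed (use open_I interval_I f_pos meridian_derivs f2_eq g2_eq unit_speed in auto)

text \<open>Differentiating \<open>f f'' = - g' p\<close> trades the third derivative of
  \<open>f\<close> for \<open>p'\<close>.\<close>

lemma f_f2_deriv:
  assumes u: "u \<in> I"
  shows "((\<lambda>s. f s * f2 s) has_real_derivative f1 u * f2 u + f u * f3 u) (at u)"
    and "f u * (f1 u * f2 u + f u * f3 u) = - (f1 u * (p u)\<^sup>2 + f u * g1 u * deriv p u)"
proof -
  show d: "((\<lambda>s. f s * f2 s) has_real_derivative f1 u * f2 u + f u * f3 u) (at u)"
    by (auto intro!: derivative_eq_intros meridian_derivs u)
  have der: "((\<lambda>s. f s * f2 s + g1 s * p s) has_real_derivative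
      f1 u * f2 u + f u * f3 u + (g2 u * p u + g1 u * deriv p u)) (at u)"
    by (auto intro!: derivative_eq_intros meridian_derivs ode.p_deriv u)
  have zero: "f s * f2 s + g1 s * p s = 0" if "s \<in> I" for s
    using f_pos[OF that] by (simp add: f2_eq[OF that])
  have "f1 u * f2 u + f u * f3 u = - (g2 u * p u + g1 u * deriv p u)"
    using DERIV_locally_const[OF open_I u zero der] by simp
  then show "f u * (f1 u * f2 u + f u * f3 u) = - (f1 u * (p u)\<^sup>2 + f u * g1 u * deriv p u)"
    using f_pos[OF u] by (simp add: g2_eq[OF u] power2_eq_square field_simps)
qed

lemma f_g2_deriv:
  assumes u: "u \<in> I"
  shows "f u * (f1 u * g2 u + f u * g3 u) = f u * f1 u * deriv p u - g1 u * (p u)\<^sup>2"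
proof -
  have der: "((\<lambda>s. f s * g2 s - f1 s * p s) has_real_derivative
      f1 u * g2 u + f u * g3 u - (f2 u * p u + f1 u * deriv p u)) (at u)"
    by (auto intro!: derivative_eq_intros meridian_derivs ode.p_deriv u)
  have zero: "f s * g2 s - f1 s * p s = 0" if "s \<in> I" for s
    using f_pos[OF that] by (simp add: g2_eq[OF that])
  have "f1 u * g2 u + f u * g3 u = f2 u * p u + f1 u * deriv p u"
    using DERIV_locally_const[OF open_I u zero der] by simp
  then show ?thesis
    using f_pos[OF u] by (simp add: f2_eq[OF u] power2_eq_square field_simps)
qed

text \<open>Substituting \<open>1 - f'^2 = g'^2\<close> and \<open>f f'' = - g' p\<close> exposes
  the common factor \<open>g'^3\<close>. It cancels against the one in
  \<open>ode_den_eq\<close>.\<close>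

lemma ode_num_eq:
  assumes u: "u \<in> I"
  shows "ode_num f u = - (g1 u ^ 3 * ode.num u)"
proof -
  have w: "1 - (f1 u)\<^sup>2 = (g1 u)\<^sup>2" using unit_speed[OF u] by simp
  have q: "deriv (\<lambda>s. f s * f2 s) u = f1 u * f2 u + f u * f3 u"
    by (rule DERIV_imp_deriv[OF f_f2_deriv(1)[OF u]])
  have f2: "f u * f2 u = - (g1 u * p u)" using f_pos[OF u] by (simp add: f2_eq[OF u])
  have "ode_num f u = (g1 u)\<^sup>2 * (f u * (f1 u * f2 u + f u * f3 u)) + f1 u * (f u * f2 u)\<^sup>2
      + f1 u * ((g1 u)\<^sup>2)\<^sup>2"
    by (simp only: ode_num_def Let_def q w) (simp add: power2_eq_square algebra_simps)
  also have "\<dots> = - (g1 u ^ 3 * ode.num u)"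
    unfolding f2 f_f2_deriv(2)[OF u] ode.num_def
    by (simp add: power2_eq_square power3_eq_cube algebra_simps)
  finally show ?thesis .
qed

lemma ode_den_eq:
  assumes u: "u \<in> I"
  shows "ode_den f u = g1 u ^ 3 * ode.den u"
proof -
  have w: "1 - (f1 u)\<^sup>2 = (g1 u)\<^sup>2" using unit_speed[OF u] by simp
  have q: "deriv (\<lambda>s. f s * f2 s) u = f1 u * f2 u + f u * f3 u"
    by (rule DERIV_imp_deriv[OF f_f2_deriv(1)[OF u]])
  have f2: "f u * f2 u = - (g1 u * p u)" using f_pos[OF u] by (simp add: f2_eq[OF u])
  have "ode_den f u = ((g1 u)\<^sup>2)\<^sup>2 + (f u * f2 u)\<^sup>2 +
      f1 u * (g1 u)\<^sup>2 * (f u * (f1 u * f2 u + f u * f3 u))"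
    by (simp only: ode_den_def Let_def q w) (simp add: power2_eq_square algebra_simps)
  also have "\<dots> = (g1 u)\<^sup>2 * ((g1 u)\<^sup>2 + (1 - (f1 u)\<^sup>2) * (p u)\<^sup>2 - f1 u * f u * g1 u * deriv p u)"
    unfolding f2 f_f2_deriv(2)[OF u]
    by (simp add: power2_eq_square algebra_simps)
  also have "\<dots> = g1 u ^ 3 * ode.den u"
    unfolding w ode.den_def
    by (simp add: power2_eq_square power3_eq_cube algebra_simps)
  finally show ?thesis .
qed

text \<open>Explains the right-hand side of (iii): it is the logarithmic derivative of
  \<open>g'\<close>, hence of the square root, so the equation says exactly that the remaining
  quotient has derivative zero. \<open>r\<close> matters only up to sign because of the absolute
  value.\<close>

lemma ode_ln_deriv:
  assumes u: "u \<in> I" "g1 u \<noteq> 0" and r: "(r has_real_derivative r') (at u)" "r u \<noteq> 0"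
    and eq: "\<And>s. s \<in> I \<Longrightarrow> g1 s \<noteq> 0 \<Longrightarrow> \<bar>ode_num f s / ode_den f s\<bar> = \<bar>r s\<bar>"
  shows "deriv (\<lambda>s. ln \<bar>sqrt (1 - (f1 s)\<^sup>2) * ode_num f s / ode_den f s\<bar>) u
    = - (f1 u * f2 u / (1 - (f1 u)\<^sup>2)) + r' / r u"
proof -
  define T where "T = I \<inter> g1 -` (- {0})"
  have "open T"
    unfolding T_def
    by (rule continuous_open_preimage[OF smooth_on_continuous_on[OF smooth_meridian(4)] open_I]) auto
  moreover have "u \<in> T" using u by (simp add: T_def)
  moreover have "ln \<bar>sqrt (1 - (f1 s)\<^sup>2) * ode_num f s / ode_den f s\<bar> = ln \<bar>g1 s * r s\<bar>" if "s \<in> T" for s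
  proof -
    have s: "s \<in> I" "g1 s \<noteq> 0" using that by (auto simp: T_def)
    have "1 - (f1 s)\<^sup>2 = (g1 s)\<^sup>2" using unit_speed[OF s(1)] by simp
    then have "sqrt (1 - (f1 s)\<^sup>2) = \<bar>g1 s\<bar>" by simp
    then have "sqrt (1 - (f1 s)\<^sup>2) * ode_num f s / ode_den f s = \<bar>g1 s\<bar> * (ode_num f s / ode_den f s)"
      by simp
    then have "\<bar>sqrt (1 - (f1 s)\<^sup>2) * ode_num f s / ode_den f s\<bar> = \<bar>g1 s * r s\<bar>"
      by (simp only: abs_mult abs_abs eq[OF s])
    then show ?thesis by simp
  qed
  moreover have "((\<lambda>s. ln \<bar>g1 s * r s\<bar>) has_real_derivative (g2 u * r u + r' * g1 u) / (g1 u * r u)) (at u)"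
    by (intro DERIV_ln_abs DERIV_mult meridian_derivs u r) (simp add: u r)
  ultimately have "deriv (\<lambda>s. ln \<bar>sqrt (1 - (f1 s)\<^sup>2) * ode_num f s / ode_den f s\<bar>) u =
      (g2 u * r u + r' * g1 u) / (g1 u * r u)"
    by (rule deriv_eqI_open)
  also have "\<dots> = g1 u * g2 u / (g1 u)\<^sup>2 + r' / r u"
    using u(2) r(2) by (simp add: field_simps power2_eq_square)
  also have "g1 u * g2 u / (g1 u)\<^sup>2 = - (f1 u * f2 u / (1 - (f1 u)\<^sup>2))"
  proof -
    have "g1 u * g2 u = - (f1 u * f2 u)" "(g1 u)\<^sup>2 = 1 - (f1 u)\<^sup>2"
      using acceleration_orthogonal[OF u(1)] unit_speed[OF u(1)] by auto
    then show ?thesis by simp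
  qed
  finally show ?thesis .
qed

lemma f1_sq_ne_1_iff: "u \<in> I \<Longrightarrow> (f1 u)\<^sup>2 \<noteq> 1 \<longleftrightarrow> g1 u \<noteq> 0"
  using unit_speed[of u] by auto

lemma case_ode_second_kind:
  assumes ode: "case_ode I J f g \<kappa>"
  shows "pointwise_1_type_second_kind I J f z"
proof -
  have ode_ne: "ode_num f u \<noteq> 0" "ode_den f u \<noteq> 0"
    and ode_eq: "deriv (\<lambda>s. ln \<bar>sqrt (1 - (f1 s)\<^sup>2) * ode_num f s / ode_den f s\<bar>) u
      = - (f1 u * f2 u / (1 - (f1 u)\<^sup>2))" if "u \<in> I" "g1 u \<noteq> 0" for u
    using ode that f1_sq_ne_1_iff unfolding case_ode_def by blast+
  have ne: "ode.num u \<noteq> 0" "ode.den u \<noteq> 0" if "u \<in> I" "g1 u \<noteq> 0" for u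
    using ode_ne[OF that] that by (simp_all add: ode_num_eq ode_den_eq)
  interpret ode_case: meridian_ode_case I f f1 g1 p "deriv p" "deriv (deriv p)"
  proof
    fix u assume u: "u \<in> I" "g1 u \<noteq> 0"
    show "ode.den u \<noteq> 0" by (rule ne[OF u])
    define r where "r s = ode.num s / ode.den s" for s
    have r: "(r has_real_derivative deriv r u) (at u)"
      unfolding r_def[abs_def] DERIV_deriv_iff_real_differentiable
      using ode.num_deriv[OF u(1)] ode.den_deriv[OF u(1)] ne[OF u]
      by (intro derivative_intros) (auto simp: real_differentiable_def)
    have "r u \<noteq> 0" using ne[OF u] by (simp add: r_def)
    have abs_r: "\<bar>ode_num f s / ode_den f s\<bar> = \<bar>r s\<bar>" if "s \<in> I" "g1 s \<noteq> 0" for s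
      using that by (simp add: ode_num_eq ode_den_eq r_def)
    have "deriv r u / r u = 0"
      using ode_ln_deriv[OF u r \<open>r u \<noteq> 0\<close> abs_r] unfolding ode_eq[OF u] by simp
    then show "((\<lambda>s. ode.num s / ode.den s) has_real_derivative 0) (at u)"
      using r \<open>r u \<noteq> 0\<close> by (simp add: r_def[abs_def])
  qed
  obtain u0 where u0: "u0 \<in> I" "g1 u0 \<noteq> 0"
    using ode f1_sq_ne_1_iff unfolding case_ode_def by blast
  obtain c where reg: "\<And>u. u \<in> I \<Longrightarrow> ode.regular c u"
    using ode_case.global_ratio[OF u0] by blast
  then have eq: "ode.num u = c * ode.den u" and ne1: "1 + c * f1 u \<noteq> 0"
    and bp: "g1 u \<noteq> 0 \<or> p u \<noteq> 0" if "u \<in> I" for u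
    using that by (auto simp: ode.regular_def)
  show ?thesis
  \<comment> \<open>\<psi> is read off from \<open>ode.den_identity\<close>,
    \<open>den = \<psi> g'\<close>; regularity makes it smooth and non-zero even at zeros of
    \<open>g'\<close>.\<close>
  proof (rule second_kindI[where k = 0 and c = c and \<psi> = "\<lambda>u. ((g1 u)\<^sup>2 + (p u)\<^sup>2) / (1 + c * f1 u)"])
    show "\<kappa> v = 0" if "v \<in> J" for v
      using ode that unfolding case_ode_def by blast
    show "c \<noteq> 0"
      using eq[OF u0(1)] ne[OF u0] by auto
    show "smooth_on I (\<lambda>u. ((g1 u)\<^sup>2 + (p u)\<^sup>2) / (1 + c * f1 u))"
      using ne1
      by (intro smooth_on_divide smooth_on_add smooth_on_power smooth_on_mult smooth_on_const
          smooth_meridian smooth_p open_I)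
  next
    fix u assume u: "u \<in> I"
    show "((g1 u)\<^sup>2 + (p u)\<^sup>2) / (1 + c * f1 u) \<noteq> 0"
      using bp[OF u] ne1[OF u] by (simp add: sum_power2_eq_zero_iff)
    \<comment> \<open>The relation \<open>num = c den\<close> solved for \<open>p'\<close>, which
      removes \<open>p'\<close> from the l \<and> t equation.\<close>
    have key: "f u * deriv p u * (1 + c * f1 u) = g1 u * (f1 u + c + c * (p u)\<^sup>2)"
      using eq[OF u] by (simp add: ode.num_def ode.den_def algebra_simps)
    have "(f1 u * (p u)\<^sup>2 + f u * g1 u * deriv p u) * (1 + c * f1 u) =
        f1 u * (p u)\<^sup>2 * (1 + c * f1 u) + g1 u * (f u * deriv p u * (1 + c * f1 u))"
      by (simp add: algebra_simps)
    also have "\<dots> = ((g1 u)\<^sup>2 + (p u)\<^sup>2) * (f1 u + c) + c * (p u)\<^sup>2 * ((f1 u)\<^sup>2 + (g1 u)\<^sup>2 - 1)"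
      unfolding key by (simp add: power2_eq_square algebra_simps)
    also have "\<dots> = ((g1 u)\<^sup>2 + (p u)\<^sup>2) * (f1 u + c)"
      using unit_speed[OF u] by simp
    finally have "((g1 u)\<^sup>2 + (p u)\<^sup>2) / (1 + c * f1 u) * (f1 u + c) =
        f1 u * (p u)\<^sup>2 + f u * g1 u * deriv p u"
      using ne1[OF u] by (simp add: field_simps)
    then show "((g1 u)\<^sup>2 + (p u)\<^sup>2) / (1 + c * f1 u) * (f1 u + c) =
        - (f u)\<^sup>2 * f3 u - f u * f1 u * f2 u - f1 u * 0\<^sup>2"
      using f_f2_deriv(2)[OF u] by (simp add: power2_eq_square algebra_simps)
    have "((g1 u)\<^sup>2 + (p u)\<^sup>2) / (1 + c * f1 u) * g1 u = ode.den u"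
      using ode.den_identity[OF u eq[OF u]] ne1[OF u] by (simp add: field_simps)
    then show "((g1 u)\<^sup>2 + (p u)\<^sup>2) / (1 + c * f1 u) * g1 u =
        - (f u)\<^sup>2 * g3 u - f u * f1 u * g2 u - g1 u * (0\<^sup>2 - 1)"
      using f_g2_deriv[OF u] by (simp add: ode.den_def power2_eq_square algebra_simps)
  qed simp
qed

lemma case_odeI:
  assumes \<kappa>: "\<And>v. v \<in> J \<Longrightarrow> \<kappa> v = 0" and u0: "u0 \<in> I" "g1 u0 \<noteq> 0" and c: "c \<noteq> 0"
    and \<psi>: "\<And>u. u \<in> I \<Longrightarrow> \<psi> u \<noteq> 0"
    and lt: "\<And>u. u \<in> I \<Longrightarrow> - (f u)\<^sup>2 * f3 u - f u * f1 u * f2 u = \<psi> u * (f1 u + c)"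
    and et: "\<And>u. u \<in> I \<Longrightarrow> - (f u)\<^sup>2 * g3 u - f u * f1 u * g2 u + g1 u = \<psi> u * g1 u"
  shows "case_ode I J f g \<kappa>"
proof -
  have den: "ode.den u = \<psi> u * g1 u" if u: "u \<in> I" for u
    using et[OF u] f_g2_deriv[OF u] by (simp add: ode.den_def power2_eq_square algebra_simps)
  have num: "ode.num u = c * ode.den u" if u: "u \<in> I" "g1 u \<noteq> 0" for u
  proof -
    have "f1 u * (p u)\<^sup>2 + f u * g1 u * deriv p u = \<psi> u * (f1 u + c)"
      using lt[OF u(1)] f_f2_deriv(2)[OF u(1)] by (simp add: power2_eq_square algebra_simps)
    \<comment> \<open>Elimination of \<psi>: \<open>g'\<close> times the l \<and> t equation minus
      \<open>f'\<close> times the e 1 \<and> t equation has \<open>num\<close> on the left and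
      \<open>c \<psi> g' = c den\<close> on the right.\<close>
    moreover have "ode.num u = (f1 u * (p u)\<^sup>2 + f u * g1 u * deriv p u) * g1 u - f1 u * ode.den u
        + f u * deriv p u * (1 - ((f1 u)\<^sup>2 + (g1 u)\<^sup>2))"
      by (simp add: ode.num_def ode.den_def power2_eq_square algebra_simps)
    ultimately show ?thesis
      using unit_speed[OF u(1)] by (simp add: den[OF u(1)] algebra_simps)
  qed
  have ne: "ode_num f u \<noteq> 0" "ode_den f u \<noteq> 0" if u: "u \<in> I" "g1 u \<noteq> 0" for u
    using num[OF u] den[OF u(1)] u c \<psi>[OF u(1)] by (auto simp: ode_num_eq ode_den_eq)
  have ln_deriv: "deriv (\<lambda>s. ln \<bar>sqrt (1 - (f1 s)\<^sup>2) * ode_num f s / ode_den f s\<bar>) u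
    = - (f1 u * f2 u / (1 - (f1 u)\<^sup>2))" if u: "u \<in> I" "g1 u \<noteq> 0" for u
  proof -
    have "\<bar>ode_num f s / ode_den f s\<bar> = \<bar>c\<bar>" if s: "s \<in> I" "g1 s \<noteq> 0" for s
      using num[OF s] ne[OF s] s by (auto simp: ode_num_eq ode_den_eq abs_mult)
    then show ?thesis
      using ode_ln_deriv[OF u, of "\<lambda>_. c" 0] c by simp
  qed
  have g': "\<bar>g1 u\<bar> = sqrt (1 - (f1 u)\<^sup>2)" if u: "u \<in> I" for u
  proof -
    have "1 - (f1 u)\<^sup>2 = (g1 u)\<^sup>2" using unit_speed[OF u] by simp
    then show ?thesis by simp
  qed
  show ?thesis
    unfolding case_ode_def using \<kappa> u0 ne ln_deriv g' f1_sq_ne_1_iff by blast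
qed

text \<open>The Laplacian has no e 1 \<and> l part, so that component of \<open>C\<close> vanishes;
  differentiating twice along the curve kills the e 1 \<and> t component and \<kappa> times the e 1
  \<and> n component. The factor \<open>f^2\<close> is absorbed into \<open>lam\<close>.\<close>

lemma second_kind_components:
  assumes "pointwise_1_type_second_kind I J f z"
  obtains lam C where "C \<in> bivectors" "C \<noteq> 0"
    "\<And>u v. u \<in> I \<Longrightarrow> v \<in> J \<Longrightarrow> lam u v \<noteq> 0"
    "\<And>u v. u \<in> I \<Longrightarrow> v \<in> J \<Longrightarrow> - (f u)\<^sup>2 * f3 u - f u * f1 u * f2 u - f1 u * (\<kappa> v)\<^sup>2 =
      lam u v * (f1 u + bpair C (l v) (t v))"
    "\<And>u v. u \<in> I \<Longrightarrow> v \<in> J \<Longrightarrow> - (f u)\<^sup>2 * g3 u - f u * f1 u * g2 u - g1 u * ((\<kappa> v)\<^sup>2 - 1) =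
      lam u v * g1 u"
    "\<And>u v. u \<in> I \<Longrightarrow> v \<in> J \<Longrightarrow> - (f1 u * \<kappa>' v) = lam u v * bpair C (l v) (n v)"
    "\<And>u v. u \<in> I \<Longrightarrow> v \<in> J \<Longrightarrow> - (f1 u * \<kappa> v) = lam u v * bpair C (t v) (n v)"
    "\<And>v. v \<in> J \<Longrightarrow> bpair C (e 1) (l v) = 0" "\<And>v. v \<in> J \<Longrightarrow> bpair C (e 1) (t v) = 0"
    "\<And>u v. u \<in> I \<Longrightarrow> v \<in> J \<Longrightarrow> g1 u * \<kappa>' v = 0"
    "\<And>v. v \<in> J \<Longrightarrow> bpair C (e 1) (n v) = 0"
proof -
  obtain \<mu> C where C: "C \<in> bivectors" "C \<noteq> 0"
    and \<mu>: "\<And>u v. u \<in> I \<Longrightarrow> v \<in> J \<Longrightarrow> \<mu> u v \<noteq> 0"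
    and eq: "\<And>u v. u \<in> I \<Longrightarrow> v \<in> J \<Longrightarrow>
      laplacian f z (gauss_map f z) u v = \<mu> u v *\<^sub>R (gauss_map f z u v + C)"
    using assms unfolding pointwise_1_type_second_kind_def by blast
  define lam where "lam u v = (f u)\<^sup>2 * \<mu> u v" for u v
  have scale: "(f u)\<^sup>2 * x = lam u v * y" if "x = \<mu> u v * y" for u v x y
    using that by (simp add: lam_def)
  have pos: "f u \<noteq> 0" if "u \<in> I" for u using f_pos[OF that] by simp
  obtain u0 v0 where u0: "u0 \<in> I" and v0: "v0 \<in> J" using I_nonempty J_nonempty by blast
  have el: "bpair C (e 1) (l v) = 0" if v: "v \<in> J" for v
    using gauss_map_components(6)[OF u0 v eq[OF u0 v]] \<mu>[OF u0 v] by simp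
  have et: "bpair C (e 1) (t v) = 0" if v: "v \<in> J" for v
    by (rule DERIV_locally_const[OF open_J v el bpair_derivs(3)[OF v C(1)]])
  have \<kappa>_en: "\<kappa> v * bpair C (e 1) (n v) = 0" if v: "v \<in> J" for v
    using DERIV_locally_const[OF open_J v et bpair_derivs(2)[OF v C(1)]] el[OF v] by simp
  obtain E where E: "\<And>v. v \<in> J \<Longrightarrow> bpair C (e 1) (n v) = E"
    using interval_constI[OF interval_J, of "\<lambda>v. bpair C (e 1) (n v)"] bpair_derivs(4)[OF _ C(1)] et
    by (metis mult_zero_right)
  have \<kappa>'E: "\<kappa>' v * E = 0" if v: "v \<in> J" for v
  proof (rule DERIV_locally_const[OF open_J v])
    show "\<kappa> w * E = 0" if "w \<in> J" for w using \<kappa>_en[OF that] E[OF that] by simp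
    show "((\<lambda>v. \<kappa> v * E) has_real_derivative \<kappa>' v * E) (at v)"
      by (rule DERIV_cmult_right[OF \<kappa>_deriv[OF v]])
  qed
  \<comment> \<open>Either \<open>\<kappa>'\<close> or the constant \<open>E\<close> vanishes, and
    the e 1 \<and> n equation equates \<open>- g' \<kappa>' / f^2\<close> with a non-zero multiple
    of \<open>E\<close>; hence both sides are zero.\<close>
  have g\<kappa>: "g1 u * \<kappa>' v = 0" if u: "u \<in> I" and v: "v \<in> J" for u v
    using gauss_map_components(5)[OF u v eq[OF u v]] \<kappa>'E[OF v] E[OF v] pos[OF u] by auto
  have "E = 0"
    using gauss_map_components(5)[OF u0 v0 eq[OF u0 v0]] g\<kappa>[OF u0 v0] E[OF v0] \<mu>[OF u0 v0] by auto
  show ?thesis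
  proof (rule that[OF C])
    fix u v assume u: "u \<in> I" and v: "v \<in> J"
    note comps = gauss_map_components(1-4)[OF u v eq[OF u v], THEN scale]
    show "lam u v \<noteq> 0" using \<mu>[OF u v] pos[OF u] by (simp add: lam_def)
    show "- (f u)\<^sup>2 * f3 u - f u * f1 u * f2 u - f1 u * (\<kappa> v)\<^sup>2 = lam u v * (f1 u + bpair C (l v) (t v))"
      unfolding comps(1)[symmetric] using pos[OF u] by (simp add: field_simps power2_eq_square)
    show "- (f u)\<^sup>2 * g3 u - f u * f1 u * g2 u - g1 u * ((\<kappa> v)\<^sup>2 - 1) = lam u v * g1 u"
      unfolding comps(2)[unfolded et[OF v] add_0_right, symmetric]
      using pos[OF u] by (simp add: field_simps power2_eq_square)
    show "- (f1 u * \<kappa>' v) = lam u v * bpair C (l v) (n v)"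
      unfolding comps(3)[symmetric] using pos[OF u] by simp
    show "- (f1 u * \<kappa> v) = lam u v * bpair C (t v) (n v)"
      unfolding comps(4)[symmetric] using pos[OF u] by simp
    show "g1 u * \<kappa>' v = 0" by (rule g\<kappa>[OF u v])
  qed (use el et E \<open>E = 0\<close> in auto)
qed

end

section \<open>Classification\<close>

context meridian begin

text \<open>With \<open>f' = \<epsilon>\<close> constant, the three equations at a fixed
  \<open>u0\<close> involve only \<open>v\<close>. Dividing out the non-zero factor \<open>X\<close>
  leaves algebraic relations between \<kappa>, \<open>\<kappa>'\<close> and the components of
  \<open>C\<close>, which are then differentiated.\<close>

lemma vertical_meridian_affine:
  assumes g: "\<And>u. u \<in> I \<Longrightarrow> g1 u = 0" and C: "C \<in> bivectors"
    and lam: "\<And>u v. u \<in> I \<Longrightarrow> v \<in> J \<Longrightarrow> lam u v \<noteq> 0"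
    and lt: "\<And>u v. u \<in> I \<Longrightarrow> v \<in> J \<Longrightarrow> - (f u)\<^sup>2 * f3 u - f u * f1 u * f2 u - f1 u * (\<kappa> v)\<^sup>2 =
      lam u v * (f1 u + bpair C (l v) (t v))"
    and l_n: "\<And>u v. u \<in> I \<Longrightarrow> v \<in> J \<Longrightarrow> - (f1 u * \<kappa>' v) = lam u v * bpair C (l v) (n v)"
    and tn: "\<And>u v. u \<in> I \<Longrightarrow> v \<in> J \<Longrightarrow> - (f1 u * \<kappa> v) = lam u v * bpair C (t v) (n v)"
  obtains k \<epsilon> a b where "case_affine_line I J f g \<kappa> k \<epsilon> a 0 b" "\<epsilon> \<noteq> 0" "k \<noteq> 1" "k \<noteq> -1"
proof -
  have f1_sq: "(f1 u)\<^sup>2 = 1" if "u \<in> I" for u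
    using unit_speed[OF that] g[OF that] by simp
  have f2: "f2 u = 0" if "u \<in> I" for u
    using acceleration_orthogonal[OF that] g[OF that] f1_sq[OF that] by auto
  have f3: "f3 u = 0" if "u \<in> I" for u
    by (rule const_deriv[OF open_I that f2])
  obtain \<epsilon> where \<epsilon>: "\<And>u. u \<in> I \<Longrightarrow> f1 u = \<epsilon>"
    using interval_constI[OF interval_I, of f1] meridian_derivs(2) f2 by metis
  obtain b where b: "\<And>u. u \<in> I \<Longrightarrow> g u = b"
    using interval_constI[OF interval_I, of g] meridian_derivs(4) g by metis
  have "((\<lambda>u. f u - \<epsilon> * u) has_real_derivative 0) (at u)" if "u \<in> I" for u
    using meridian_derivs(1)[OF that] \<epsilon>[OF that] by (auto intro!: derivative_eq_intros)
  then obtain a where a: "\<And>u. u \<in> I \<Longrightarrow> f u - \<epsilon> * u = a"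
    using interval_constI[OF interval_I, of "\<lambda>u. f u - \<epsilon> * u"] by blast
  obtain u0 v0 where u0: "u0 \<in> I" and v0: "v0 \<in> J" using I_nonempty J_nonempty by blast
  have \<epsilon>_sq: "\<epsilon> * \<epsilon> = 1" using f1_sq[OF u0] \<epsilon>[OF u0] by (simp add: power2_eq_square)
  then have \<epsilon>0: "\<epsilon> \<noteq> 0" by auto
  define X where "X v = - \<epsilon> * lam u0 v" for v
  define cA cF cT where "cA v = bpair C (l v) (t v)" and "cF v = bpair C (l v) (n v)"
    and "cT v = bpair C (t v) (n v)" for v
  have X: "X v \<noteq> 0" if "v \<in> J" for v using lam[OF u0 that] \<epsilon>0 by (simp add: X_def)
  have XF: "X v * cF v = \<kappa>' v" and XT: "X v * cT v = \<kappa> v" and XA: "X v * (\<epsilon> + cA v) = (\<kappa> v)\<^sup>2"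
    if v: "v \<in> J" for v
  proof -
    have "X v * cF v = \<epsilon> * \<epsilon> * \<kappa>' v" "X v * cT v = \<epsilon> * \<epsilon> * \<kappa> v"
      by (simp_all add: X_def cF_def cT_def mult.assoc l_n[OF u0 v, symmetric] tn[OF u0 v, symmetric]
          \<epsilon>[OF u0])
    moreover have "X v * (\<epsilon> + cA v) = \<epsilon> * \<epsilon> * (\<kappa> v)\<^sup>2"
      by (simp add: X_def cA_def mult.assoc lt[OF u0 v, unfolded \<epsilon>[OF u0], symmetric] f2[OF u0] f3[OF u0])
    ultimately show "X v * cF v = \<kappa>' v" "X v * cT v = \<kappa> v" "X v * (\<epsilon> + cA v) = (\<kappa> v)\<^sup>2"
      by (simp_all add: \<epsilon>_sq)
  qed
  have A: "\<epsilon> + cA v = \<kappa> v * cT v" if v: "v \<in> J" for v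
  proof -
    have "X v * (\<epsilon> + cA v) = X v * (\<kappa> v * cT v)"
      using XA[OF v] XT[OF v] by (simp add: power2_eq_square mult.left_commute)
    then show ?thesis using X[OF v] by simp
  qed
  have F: "\<kappa> v * cF v = \<kappa>' v * cT v" if v: "v \<in> J" for v
  proof -
    have "X v * (\<kappa> v * cF v) = X v * (\<kappa>' v * cT v)"
      unfolding mult.left_commute[of "X v"] XF[OF v] XT[OF v] by (rule mult.commute)
    then show ?thesis using X[OF v] by simp
  qed
  have der: "(cA has_real_derivative - \<kappa> v * cF v) (at v)" "(cF has_real_derivative cT v - \<kappa> v * cA v) (at v)"
    "(cT has_real_derivative - cF v) (at v)" if "v \<in> J" for v
    using bpair_derivs[OF that C] by (simp_all add: cA_def[abs_def] cF_def[abs_def] cT_def[abs_def])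
  \<comment> \<open>Differentiating \<open>\<epsilon> + cA = \<kappa> cT\<close> makes the terms
    \<open>\<kappa> cF\<close> cancel and leaves \<open>\<kappa>' cT = 0\<close>; by
    \<open>F\<close> this product equals \<open>\<kappa> cF\<close>.\<close>
  have \<kappa>F: "\<kappa> v * cF v = 0" if v: "v \<in> J" for v
  proof -
    have "((\<lambda>v. cA v - \<kappa> v * cT v) has_real_derivative
        - \<kappa> v * cF v - (\<kappa>' v * cT v - \<kappa> v * cF v)) (at v)"
      using v by (auto intro!: derivative_eq_intros der \<kappa>_deriv)
    moreover have "cA w - \<kappa> w * cT w = - \<epsilon>" if "w \<in> J" for w
      using A[OF that] by simp
    ultimately have "- \<kappa> v * cF v - (\<kappa>' v * cT v - \<kappa> v * cF v) = 0"
      using DERIV_locally_const[OF open_J v, of "\<lambda>v. cA v - \<kappa> v * cT v"] by blast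
    then show ?thesis using F[OF v] by simp
  qed
  have "((\<lambda>v. (\<kappa> v)\<^sup>2) has_real_derivative 0) (at v)" if v: "v \<in> J" for v
  proof -
    have "\<kappa> v * \<kappa>' v = 0"
      using \<kappa>F[OF v] XF[OF v] by (metis mult.left_commute mult_zero_right)
    then show ?thesis
      using v by (auto intro!: derivative_eq_intros \<kappa>_deriv)
  qed
  then obtain k2 where k2: "\<And>v. v \<in> J \<Longrightarrow> (\<kappa> v)\<^sup>2 = k2"
    using interval_constI[OF interval_J, of "\<lambda>v. (\<kappa> v)\<^sup>2"] by blast
  have "\<kappa>' v = 0" if v: "v \<in> J" for v
  proof (cases "k2 = 0")
    case True
    then have "\<kappa> w = 0" if "w \<in> J" for w using k2[OF that] by simp
    then show ?thesis by (rule const_deriv[OF open_J v])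
  next
    case False
    then have "\<kappa> v \<noteq> 0" using k2[OF v] by auto
    then show ?thesis using \<kappa>F[OF v] XF[OF v] by auto
  qed
  then obtain k where k: "\<And>v. v \<in> J \<Longrightarrow> \<kappa> v = k" "\<And>v. v \<in> J \<Longrightarrow> \<kappa>' v = 0"
    using interval_constI[OF interval_J, of \<kappa>] \<kappa>_deriv by metis
  have F0: "cF v = 0" if "v \<in> J" for v
    using XF[OF that] X[OF that] k(2)[OF that] by simp
  \<comment> \<open>Now \<open>cT = k cA\<close>, and inserting it in \<open>A\<close> gives
    \<open>\<epsilon> = cA (k^2 - 1)\<close>: this excludes
    \<open>k = \<plusminus>1\<close>.\<close>
  have "cT v0 - \<kappa> v0 * cA v0 = 0"
    by (rule DERIV_locally_const[OF open_J v0 F0 der(2)[OF v0]])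
  then have "\<epsilon> = cA v0 * (k\<^sup>2 - 1)"
    using A[OF v0] k(1)[OF v0] by (simp add: power2_eq_square algebra_simps)
  then have "k \<noteq> 1" "k \<noteq> -1" using \<epsilon>0 by auto
  moreover have "case_affine_line I J f g \<kappa> k \<epsilon> a 0 b"
    using k a b \<epsilon>_sq by (auto simp: case_affine_line_def power2_eq_square algebra_simps)
  ultimately show ?thesis using that \<epsilon>0 by blast
qed

text \<open>Use the t \<and> n equation to replace \<open>\<psi> c\<close> by \<open>- f'\<close>,
  then rotate the other two by \<open>(f', g')\<close>. The result is \<open>p' = 0\<close> and
  \<open>\<psi> = p^2 - k^2 + 1\<close>, so \<psi> and \<open>f' = - \<psi> c\<close> are constant.
  Then the meridian is straight, \<open>p = 0\<close> and \<open>f' = (k^2 - 1) c\<close>, which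
  excludes \<open>k = \<plusminus>1\<close>.\<close>

lemma curved_curve_affine:
  assumes \<kappa>: "\<And>v. v \<in> J \<Longrightarrow> \<kappa> v = k" and k: "k \<noteq> 0" and c: "c \<noteq> 0"
    and \<psi>: "\<And>u. u \<in> I \<Longrightarrow> \<psi> u \<noteq> 0"
    and lt: "\<And>u. u \<in> I \<Longrightarrow> - (f u)\<^sup>2 * f3 u - f u * f1 u * f2 u - f1 u * k\<^sup>2 = \<psi> u * (f1 u + c)"
    and et: "\<And>u. u \<in> I \<Longrightarrow> - (f u)\<^sup>2 * g3 u - f u * f1 u * g2 u - g1 u * (k\<^sup>2 - 1) = \<psi> u * g1 u"
    and tn: "\<And>u. u \<in> I \<Longrightarrow> - (f1 u) = \<psi> u * c"
  obtains a a1 b b1 where "case_affine_line I J f g \<kappa> k a a1 b b1" "a \<noteq> 0" "k \<noteq> 1" "k \<noteq> -1"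
proof -
  have p1: "deriv p u = 0" and \<psi>_eq: "\<psi> u = (p u)\<^sup>2 - k\<^sup>2 + 1" if u: "u \<in> I" for u
  proof -
    note ff = f_f2_deriv(2)[OF u] and fg = f_g2_deriv[OF u]
    have unit: "f1 u * f1 u + g1 u * g1 u = 1" using unit_speed[OF u] by (simp add: power2_eq_square)
    define P where "P = f u * deriv p u"
    have A0: "f1 u * (p u)\<^sup>2 + g1 u * P - f1 u * k\<^sup>2 = \<psi> u * (f1 u + c)"
      using lt[OF u] ff by (simp add: P_def power2_eq_square algebra_simps)
    have B: "g1 u * (p u)\<^sup>2 - f1 u * P - g1 u * (k\<^sup>2 - 1) = \<psi> u * g1 u"
      using et[OF u] fg by (simp add: P_def power2_eq_square algebra_simps)
    have A: "f1 u * (p u)\<^sup>2 + g1 u * P - f1 u * k\<^sup>2 = \<psi> u * f1 u - f1 u"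
      using A0 tn[OF u] by (simp add: algebra_simps)
    have "P * (f1 u * f1 u + g1 u * g1 u) =
        g1 u * (f1 u * (p u)\<^sup>2 + g1 u * P - f1 u * k\<^sup>2) - f1 u * (g1 u * (p u)\<^sup>2 - f1 u * P - g1 u * (k\<^sup>2 - 1))
        + f1 u * g1 u"
      by (simp add: algebra_simps)
    also have "\<dots> = 0" unfolding A B by (simp add: algebra_simps)
    finally have "P = 0" unfolding unit by simp
    then show "deriv p u = 0" using f_pos[OF u] by (simp add: P_def)
    have "((p u)\<^sup>2 - k\<^sup>2 + 1 - \<psi> u) * (f1 u * f1 u + g1 u * g1 u) =
        f1 u * (f1 u * (p u)\<^sup>2 + g1 u * P - f1 u * k\<^sup>2 - (\<psi> u * f1 u - f1 u)) +
        g1 u * (g1 u * (p u)\<^sup>2 - f1 u * P - g1 u * (k\<^sup>2 - 1) - \<psi> u * g1 u)"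
      by (simp add: algebra_simps)
    also have "\<dots> = 0" unfolding A B by simp
    finally show "\<psi> u = (p u)\<^sup>2 - k\<^sup>2 + 1" unfolding unit by simp
  qed
  obtain p0 where p0: "\<And>u. u \<in> I \<Longrightarrow> p u = p0"
    using interval_constI[OF interval_I, of p] ode.p_deriv p1 by metis
  define a where "a = - ((p0\<^sup>2 - k\<^sup>2 + 1) * c)"
  have f1: "f1 u = a" if "u \<in> I" for u
    using tn[OF that] unfolding \<psi>_eq[OF that] p0[OF that] a_def by linarith
  obtain u0 where u0: "u0 \<in> I" using I_nonempty by blast
  have "a \<noteq> 0" using tn[OF u0] f1[OF u0] \<psi>[OF u0] c by auto
  have f2: "f2 u = 0" if "u \<in> I" for u
    by (rule const_deriv[OF open_I that f1])
  have g1_sq: "(g1 u)\<^sup>2 = 1 - a\<^sup>2" if "u \<in> I" for u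
    using unit_speed[OF that] f1[OF that] by simp
  have g2: "g2 u = 0" if u: "u \<in> I" for u
  proof (cases "a\<^sup>2 = 1")
    case True
    then have "g1 w = 0" if "w \<in> I" for w using g1_sq[OF that] by simp
    then show ?thesis by (rule const_deriv[OF open_I u])
  next
    case False
    then have "g1 u \<noteq> 0" using g1_sq[OF u] by auto
    then show ?thesis using acceleration_orthogonal[OF u] f2[OF u] by simp
  qed
  have "p0 = 0" using p0[OF u0] f2[OF u0] g2[OF u0] by (simp add: p_def)
  then have "a = (k\<^sup>2 - 1) * c" by (simp add: a_def algebra_simps)
  then have k_ne: "k \<noteq> 1" "k \<noteq> -1" using \<open>a \<noteq> 0\<close> by auto
  obtain b where b: "\<And>u. u \<in> I \<Longrightarrow> g1 u = b"
    using interval_constI[OF interval_I, of g1] meridian_derivs(5) g2 by metis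
  have "((\<lambda>u. f u - a * u) has_real_derivative 0) (at u)" if "u \<in> I" for u
    using meridian_derivs(1)[OF that] f1[OF that] by (auto intro!: derivative_eq_intros)
  then obtain a1 where a1: "\<And>u. u \<in> I \<Longrightarrow> f u - a * u = a1"
    using interval_constI[OF interval_I, of "\<lambda>u. f u - a * u"] by blast
  have "((\<lambda>u. g u - b * u) has_real_derivative 0) (at u)" if "u \<in> I" for u
    using meridian_derivs(4)[OF that] b[OF that] by (auto intro!: derivative_eq_intros)
  then obtain b1 where b1: "\<And>u. u \<in> I \<Longrightarrow> g u - b * u = b1"
    using interval_constI[OF interval_I, of "\<lambda>u. g u - b * u"] by blast
  have "a\<^sup>2 + b\<^sup>2 = 1" using unit_speed[OF u0] f1[OF u0] b[OF u0] by simp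
  then have "case_affine_line I J f g \<kappa> k a a1 b b1"
    using \<kappa> a1 b1 by (auto simp: case_affine_line_def algebra_simps)
  then show ?thesis using that \<open>a \<noteq> 0\<close> k_ne by blast
qed

text \<open>Two alternatives suffice: radial lines appear here as affine lines with
  \<open>b = 0\<close>.\<close>

lemma second_kind_cases:
  assumes sk: "pointwise_1_type_second_kind I J f z"
  shows "(\<exists>k a a1 b b1. case_affine_line I J f g \<kappa> k a a1 b b1 \<and> a \<noteq> 0 \<and> k \<noteq> 1 \<and> k \<noteq> -1) \<or>
    case_ode I J f g \<kappa>"
proof -
  obtain lam C where C: "C \<in> bivectors" "C \<noteq> 0"
    and lam: "\<And>u v. u \<in> I \<Longrightarrow> v \<in> J \<Longrightarrow> lam u v \<noteq> 0"
    and lt: "\<And>u v. u \<in> I \<Longrightarrow> v \<in> J \<Longrightarrow> - (f u)\<^sup>2 * f3 u - f u * f1 u * f2 u - f1 u * (\<kappa> v)\<^sup>2 =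
      lam u v * (f1 u + bpair C (l v) (t v))"
    and et: "\<And>u v. u \<in> I \<Longrightarrow> v \<in> J \<Longrightarrow>
      - (f u)\<^sup>2 * g3 u - f u * f1 u * g2 u - g1 u * ((\<kappa> v)\<^sup>2 - 1) = lam u v * g1 u"
    and l_n: "\<And>u v. u \<in> I \<Longrightarrow> v \<in> J \<Longrightarrow> - (f1 u * \<kappa>' v) = lam u v * bpair C (l v) (n v)"
    and tn: "\<And>u v. u \<in> I \<Longrightarrow> v \<in> J \<Longrightarrow> - (f1 u * \<kappa> v) = lam u v * bpair C (t v) (n v)"
    and el0: "\<And>v. v \<in> J \<Longrightarrow> bpair C (e 1) (l v) = 0"
    and et0: "\<And>v. v \<in> J \<Longrightarrow> bpair C (e 1) (t v) = 0"
    and g\<kappa>: "\<And>u v. u \<in> I \<Longrightarrow> v \<in> J \<Longrightarrow> g1 u * \<kappa>' v = 0"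
    and en0: "\<And>v. v \<in> J \<Longrightarrow> bpair C (e 1) (n v) = 0"
    by (rule second_kind_components[OF sk]) (rule that)
  show ?thesis
  proof (cases "\<forall>u\<in>I. g1 u = 0")
    case True
    then show ?thesis
      using vertical_meridian_affine[OF _ C(1) lam lt l_n tn] by metis
  next
    case False
    then obtain u0 where u0: "u0 \<in> I" "g1 u0 \<noteq> 0" by blast
    obtain v0 where v0: "v0 \<in> J" using J_nonempty by blast
    have \<kappa>': "\<kappa>' v = 0" if "v \<in> J" for v using g\<kappa>[OF u0(1) that] u0(2) by simp
    then obtain k where k: "\<And>v. v \<in> J \<Longrightarrow> \<kappa> v = k"
      using interval_constI[OF interval_J, of \<kappa>] \<kappa>_deriv by metis
    have ln0: "bpair C (l v) (n v) = 0" if "v \<in> J" for v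
      using l_n[OF u0(1) that] lam[OF u0(1) that] \<kappa>'[OF that] by simp
    define c where "c = bpair C (l v0) (t v0)"
    \<comment> \<open>The l \<and> n component vanishes along the whole curve; its derivative links
      the two components that are left. Hence \<open>C \<noteq> 0\<close> forces
      \<open>c \<noteq> 0\<close>.\<close>
    have tn_eq: "bpair C (t v0) (n v0) = k * c"
      using DERIV_locally_const[OF open_J v0 ln0 bpair_derivs(5)[OF v0 C(1)]] k[OF v0]
      by (simp add: c_def)
    have c: "c \<noteq> 0"
    proof
      assume "c = 0"
      then have "C = 0"
        using bivector_eq_0I[OF C(1) curve_frame[OF v0]] el0 et0 en0 ln0 tn_eq v0 by (simp add: c_def)
      then show False using C(2) by simp
    qed
    \<comment> \<open>As \<kappa> is constant, freezing \<open>v\<close> at \<open>v0\<close> loses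
      nothing and leaves ordinary differential equations in \<open>u\<close>.\<close>
    define \<psi> where "\<psi> u = lam u v0" for u
    have \<psi>: "\<psi> u \<noteq> 0"
      "- (f u)\<^sup>2 * f3 u - f u * f1 u * f2 u - f1 u * k\<^sup>2 = \<psi> u * (f1 u + c)"
      "- (f u)\<^sup>2 * g3 u - f u * f1 u * g2 u - g1 u * (k\<^sup>2 - 1) = \<psi> u * g1 u"
      "- (f1 u * k) = \<psi> u * (k * c)" if "u \<in> I" for u
      using lam[OF that v0] lt[OF that v0] et[OF that v0] tn[OF that v0] k[OF v0] tn_eq
      by (simp_all add: \<psi>_def c_def)
    show ?thesis
    proof (cases "k = 0")
      case True
      have "case_ode I J f g \<kappa>"
      proof (rule case_odeI[where \<psi> = \<psi>, OF _ u0 c])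
        show "\<kappa> v = 0" if "v \<in> J" for v using k[OF that] True by simp
      qed (use \<psi> True in simp_all)
      then show ?thesis ..
    next
      case False
      have tn': "- (f1 u) = \<psi> u * c" if "u \<in> I" for u
      proof -
        have "k * - (f1 u) = k * (\<psi> u * c)" using \<psi>(4)[OF that] by (simp add: algebra_simps)
        then show ?thesis using False mult_left_cancel by blast
      qed
      show ?thesis
        using curved_curve_affine[OF k False c \<psi>(1-3) tn'] by metis
    qed
  qed
qed

end

theorem theorem6p2:
  fixes I J :: "real set" and f g :: "real \<Rightarrow> real" and l n :: "real \<Rightarrow> real^4"
    and \<kappa> :: "real \<Rightarrow> real" and z :: "real \<Rightarrow> real \<Rightarrow> real^4"
  assumes "open I" "is_interval I" "I \<noteq> {}"
    and "open J" "is_interval J" "J \<noteq> {}"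
    and "smooth_on I f" "smooth_on I g"
    and "\<And>u. u \<in> I \<Longrightarrow> f u > 0"
    and "\<And>u. u \<in> I \<Longrightarrow> (deriv f u)\<^sup>2 + (deriv g u)\<^sup>2 = 1"
    and "spherical_frame J l n"
    and "\<kappa> = spherical_curvature l n"
    and "z = meridian_surface f g l"
  shows "(pointwise_1_type_second_kind I J f z \<longleftrightarrow>
      (\<exists>k a b. case_radial_line I J f g \<kappa> k a b) \<or>
      (\<exists>k a a1 b b1. case_affine_line I J f g \<kappa> k a a1 b b1 \<and>
         a \<noteq> 0 \<and> k \<noteq> 1 \<and> k \<noteq> -1) \<or>
      case_ode I J f g \<kappa>)
    \<and> (\<forall>k a b. case_radial_line I J f g \<kappa> k a b \<longrightarrow>
      developable_ruled (I \<times> J) z \<and> (\<exists>P. hyperplane_E31 P \<and> lies_in I J z P))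
    \<and> (\<forall>k a a1 b b1. case_affine_line I J f g \<kappa> k a a1 b b1 \<longrightarrow>
      developable_ruled (I \<times> J) z \<and>
      (k\<^sup>2 = b\<^sup>2 \<and> b \<noteq> 0 \<longrightarrow> marginally_trapped I J f z) \<and>
      (k\<^sup>2 - b\<^sup>2 > 0 \<longrightarrow> (\<exists>P. hyperplane_E31 P \<and> lies_in I J z P)) \<and>
      (k\<^sup>2 - b\<^sup>2 < 0 \<longrightarrow> (\<exists>P. hyperplane_E3 P \<and> lies_in I J z P)))"
proof -
  interpret m: meridian J l n I f g
    by unfold_locales (use assms in auto)
  note [simp] = \<open>\<kappa> = spherical_curvature l n\<close> \<open>z = meridian_surface f g l\<close>
  have radial: "pointwise_1_type_second_kind I J f z \<and> developable_ruled (I \<times> J) z \<and>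
      (\<exists>P. hyperplane_E31 P \<and> lies_in I J z P)"
    if rad: "case_radial_line I J f g \<kappa> k a b" for k a b
  proof -
    obtain \<epsilon> where cas: "case_affine_line I J f g m.\<kappa> k \<epsilon> a 0 b"
      and ne: "\<epsilon> \<noteq> 0" "k \<noteq> 0" "k \<noteq> 1" "k \<noteq> -1"
      using m.case_radial_imp_affine[of k a b] rad by auto
    show ?thesis
      using m.case_affine_second_kind[OF cas ne(1,3,4)] m.case_affine_developable[OF cas]
        m.case_affine_E31[OF cas] ne(2) by simp
  qed
  have "pointwise_1_type_second_kind I J f z \<longleftrightarrow>
      (\<exists>k a b. case_radial_line I J f g \<kappa> k a b) \<or>
      (\<exists>k a a1 b b1. case_affine_line I J f g \<kappa> k a a1 b b1 \<and>
         a \<noteq> 0 \<and> k \<noteq> 1 \<and> k \<noteq> -1) \<or>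
      case_ode I J f g \<kappa>" (is "?L \<longleftrightarrow> ?R")
  proof
    show ?R if ?L using m.second_kind_cases that by simp
    show ?L if ?R
      using that radial m.case_affine_second_kind m.case_ode_second_kind by auto
  qed
  then show ?thesis
    using radial m.case_affine_developable m.case_affine_marginally_trapped m.case_affine_E31
      m.case_affine_E3 by auto
qed

end
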